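(* Let $(A,\mathfrak m,k)$ be a commutative Noetherian local ring and let $M$ be a nonzero finitely generated $A$-module having reducible complexity. Then $$\sup\{n\mid\operatorname{Ext}_A^n(M,M)\neq0\}=\operatorname{pd}_A M$$ (an equality in $\mathbb N_0\cup\{\infty\}$).
   Context: All modules are finitely generated; $\operatorname{pd}$ is projective dimension. Complexity: for an $A$-module $X$ the $n$-th Betti number is $\beta_n(X)=\dim_k\operatorname{Ext}_A^n(X,k)$, and $\operatorname{cx}X=\inf\{t\in\mathbb N_0 \mid \exists\, a\in\mathbb R \text{ with } \beta_n(X)\le a n^{t-1}\text{ for } n\gg 0\}$ (where $\mathbb N_0=\{0,1,2,\dots\}$; the value is $\infty$ if no such $t$ exists). Thus $\operatorname{cx}X=0$ iff $X$ has finite projective dimension. Syzygies and $K_\eta$: if $\cdots\to P_1\to P_0\to X\to 0$ is the minimal free resolution of $X$, then $\Omega_A^n(X)$ denotes the cokernel of $P_{n+1}\to P_n$ (so $\Omega_A^0(X)=X$). For a homogeneous element $\eta\in\operatorname{Ext}_A^*(X,Y)$ of degree $|\eta|>0$, choose a map $f_\eta:\Omega_A^{|\eta|}(X)\to Y$ representing $\eta$, and let $K_\eta$ be the pushout of $f_\eta$ and the inclusion $\Omega_A^{|\eta|}(X)\hookrightarrow P_{|\eta|-1}$. There is an exact sequence $0\to Y\to K_\eta\to\Omega_A^{|\eta|-1}(X)\to 0$, and up to isomorphism $K_\eta$ is independent of the choice of $f_\eta$. Reducible complexity: the class of $A$-modules having reducible complexity is defined inductively, inside the class of $A$-modules of finite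 complexity, by: (1) every module of finite projective dimension has reducible complexity; (2) a module $X$ with $0<\operatorname{cx}X<\infty$ has reducible complexity if there is a homogeneous $\eta\in\operatorname{Ext}_A^*(X,X)$ of positive degree such that $\operatorname{cx}K_\eta<\operatorname{cx}X$, $\operatorname{depth}K_\eta=\operatorname{depth}X$, and $K_\eta$ has reducible complexity. *)

theory Defs
  imports
    "Jordan_Normal_Form.Missing_VectorSpace"
    "HOL-Algebra.QuotRing"
    "HOL-Algebra.Ring_Divisibility"
    "HOL-Library.Extended_Nat"
begin

text \<open>These names would shadow their \<open>HOL-Algebra\<close> and \<open>VectorSpace\<close> counterparts.\<close>

hide_const (open) Modules.module Modules.module_hom Multiset.mult

text \<open>
  Modules are records over \<open>HOL-Algebra\<close> rings.  Homomorphisms, spans, direct sums, finite free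
  modules (\<open>func_space\<close>) and dimensions of vector spaces are those of the AFP entry
  \<open>VectorSpace\<close>.  The ring fields \<open>mult\<close> and \<open>one\<close> of a module record carry no meaning;
  they are filled with zeros.
\<close>

section \<open>Local rings and modules\<close>

definition local_ring :: "('a, 'r) ring_scheme \<Rightarrow> bool" where
  "local_ring R \<longleftrightarrow> cring R \<and> (\<exists>!I. maximalideal I R)"

definition max_ideal :: "('a, 'r) ring_scheme \<Rightarrow> 'a set" where
  "max_ideal R = (THE I. maximalideal I R)"

definition residue_field :: "('a, 'r) ring_scheme \<Rightarrow> 'a set ring" where
  "residue_field R = R Quot max_ideal R"

definition fg_module :: "('a, 'r) ring_scheme \<Rightarrow> ('a, 'm) module \<Rightarrow> bool" where
  "fg_module R M \<longleftrightarrow> module R M \<and>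
     (\<exists>S. finite S \<and> S \<subseteq> carrier M \<and> LinearCombinations.module.span R M S = carrier M)"

definition zero_module :: "('a, 'm) module \<Rightarrow> bool" where
  "zero_module M \<longleftrightarrow> carrier M = {\<zero>\<^bsub>M\<^esub>}"

definition iso_modules ::
    "('a, 'r) ring_scheme \<Rightarrow> ('a, 'm) module \<Rightarrow> ('a, 'n) module \<Rightarrow> bool" where
  "iso_modules R M N \<longleftrightarrow> (\<exists>h \<in> module_hom R M N. bij_betw h (carrier M) (carrier N))"

definition regular_module :: "('a, 'r) ring_scheme \<Rightarrow> ('a, 'a) module" where
  "regular_module R =
     \<lparr>carrier = carrier R, mult = (\<lambda>x y. \<zero>\<^bsub>R\<^esub>), one = \<zero>\<^bsub>R\<^esub>,
      zero = \<zero>\<^bsub>R\<^esub>, add = add R, smult = mult R\<rparr>"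

text \<open>Carrier, zero and addition as in \<open>R Quot I\<close>; on cosets, \<open>a (N + x) = N + a x\<close>.\<close>

definition quot_module :: "('a, 'm) module \<Rightarrow> 'm set \<Rightarrow> ('a, 'm set) module" where
  "quot_module M N =
     \<lparr>carrier = a_rcosets\<^bsub>M\<^esub> N, mult = (\<lambda>x y. N), one = N,
      zero = N, add = set_add M,
      smult = (\<lambda>a C. \<Union>x\<in>C. N +>\<^bsub>M\<^esub> (a \<odot>\<^bsub>M\<^esub> x))\<rparr>"

definition residue_module :: "('a, 'r) ring_scheme \<Rightarrow> ('a, 'a set) module" where
  "residue_module R = quot_module (regular_module R) (max_ideal R)"

text \<open>
  The vector space over the residue field \<open>k\<close> underlying a module \<open>V\<close> that is annihilated by the
  maximal ideal: the class of \<open>a\<close> acts as \<open>a\<close>.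
\<close>

definition residue_space :: "('a, 'm) module \<Rightarrow> ('a set, 'm) module" where
  "residue_space V =
     \<lparr>carrier = carrier V, mult = mult V, one = one V, zero = zero V, add = add V,
      smult = (\<lambda>C v. the_elem ((\<lambda>a. a \<odot>\<^bsub>V\<^esub> v) ` C))\<rparr>"

text \<open>Homomorphisms are taken extensional, so that equal maps are equal functions.\<close>

definition Hom_module ::
    "('a, 'r) ring_scheme \<Rightarrow> ('a, 'm) module \<Rightarrow> ('a, 'n) module \<Rightarrow> ('a, 'm \<Rightarrow> 'n) module" where
  "Hom_module R M N =
     \<lparr>carrier = module_hom R M N \<inter> extensional (carrier M),
      mult = (\<lambda>f g. \<lambda>x\<in>carrier M. \<zero>\<^bsub>N\<^esub>), one = (\<lambda>x\<in>carrier M. \<zero>\<^bsub>N\<^esub>),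
      zero = (\<lambda>x\<in>carrier M. \<zero>\<^bsub>N\<^esub>),
      add = (\<lambda>f g. \<lambda>x\<in>carrier M. f x \<oplus>\<^bsub>N\<^esub> g x),
      smult = (\<lambda>a f. \<lambda>x\<in>carrier M. a \<odot>\<^bsub>N\<^esub> f x)\<rparr>"

definition free_module :: "('a, 'r) ring_scheme \<Rightarrow> nat \<Rightarrow> ('a, nat \<Rightarrow> 'a) module" where
  "free_module R n = ring.func_space R {..<n}"

text \<open>The pushout of \<open>f : W \<rightarrow> Y\<close> and \<open>g : W \<rightarrow> P\<close>.\<close>

definition pushout ::
    "('a, 'w) module \<Rightarrow> ('a, 'y) module \<Rightarrow> ('a, 'p) module \<Rightarrow> ('w \<Rightarrow> 'y) \<Rightarrow> ('w \<Rightarrow> 'p)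
      \<Rightarrow> ('a, ('y \<times> 'p) set) module" where
  "pushout W Y P f g =
     quot_module (direct_sum Y P) ((\<lambda>w. (f w, \<ominus>\<^bsub>P\<^esub> g w)) ` carrier W)"

section \<open>Resolutions and projective dimension\<close>

text \<open>Here \<open>d n : P (n + 1) \<rightarrow> P n\<close> and \<open>e : P 0 \<rightarrow> X\<close> is the augmentation.\<close>

definition resolution ::
    "('a, 'r) ring_scheme \<Rightarrow> ('a, 'm) module \<Rightarrow> (nat \<Rightarrow> ('a, 'p) module) \<Rightarrow>
     (nat \<Rightarrow> 'p \<Rightarrow> 'p) \<Rightarrow> ('p \<Rightarrow> 'm) \<Rightarrow> bool" where
  "resolution R X P d e \<longleftrightarrow>
     (\<forall>n. module R (P n)) \<and>
     e \<in> module_hom R (P 0) X \<and>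
     (\<forall>n. d n \<in> module_hom R (P (Suc n)) (P n)) \<and>
     e ` carrier (P 0) = carrier X \<and>
     d 0 ` carrier (P 1) = a_kernel (P 0) X e \<and>
     (\<forall>n. d (Suc n) ` carrier (P (Suc (Suc n))) = a_kernel (P (Suc n)) (P n) (d n))"

text \<open>A finitely generated module is projective iff it is a direct summand of some \<open>R\<^sup>n\<close>.\<close>

definition fg_projective :: "('a, 'r) ring_scheme \<Rightarrow> ('a, 'm) module \<Rightarrow> bool" where
  "fg_projective R P \<longleftrightarrow> module R P \<and>
     (\<exists>n. \<exists>i \<in> module_hom R P (free_module R n). \<exists>p \<in> module_hom R (free_module R n) P.
        \<forall>x \<in> carrier P. p (i x) = x)"

text \<open>
  Up to isomorphism, the finitely generated modules over \<open>R\<close> are the quotients of the \<open>R\<^sup>n\<close>, whose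
  elements are cosets of type \<open>(nat \<Rightarrow> 'a) set\<close>.  This type therefore serves as a universe
  wherever an existential quantifier or an induction ranges over all finitely generated modules.
\<close>

type_synonym 'a fgmod = "('a, (nat \<Rightarrow> 'a) set) module"

definition pd :: "('a, 'r) ring_scheme \<Rightarrow> ('a, 'm) module \<Rightarrow> enat" where
  "pd R X = Inf {enat n | n. \<exists>(P :: nat \<Rightarrow> 'a fgmod) d e.
     resolution R X P d e \<and> (\<forall>i. fg_projective R (P i)) \<and> (\<forall>i>n. zero_module (P i))}"

text \<open>The differentials of a minimal free resolution have image in \<open>\<mm> P\<^sub>n\<close>.\<close>

definition minimal_free_resolution ::
    "('a, 'r) ring_scheme \<Rightarrow> ('a, 'm) module \<Rightarrow> (nat \<Rightarrow> nat) \<Rightarrow>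
     (nat \<Rightarrow> (nat \<Rightarrow> 'a) \<Rightarrow> (nat \<Rightarrow> 'a)) \<Rightarrow> ((nat \<Rightarrow> 'a) \<Rightarrow> 'm) \<Rightarrow> bool" where
  "minimal_free_resolution R X b d e \<longleftrightarrow>
     resolution R X (\<lambda>n. free_module R (b n)) d e \<and>
     (\<forall>n. \<forall>x \<in> carrier (free_module R (b (Suc n))). \<forall>i < b n. d n x i \<in> max_ideal R)"

text \<open>Minimal free resolutions are unique up to isomorphism; one of them is fixed for each \<open>X\<close>.\<close>

definition mfr ::
    "('a, 'r) ring_scheme \<Rightarrow> ('a, 'm) module \<Rightarrow>
     (nat \<Rightarrow> nat) \<times> (nat \<Rightarrow> (nat \<Rightarrow> 'a) \<Rightarrow> (nat \<Rightarrow> 'a))" where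
  "mfr R X = (SOME (b, d). \<exists>e. minimal_free_resolution R X b d e)"

definition mfr_term ::
    "('a, 'r) ring_scheme \<Rightarrow> ('a, 'm) module \<Rightarrow> nat \<Rightarrow> ('a, nat \<Rightarrow> 'a) module" where
  "mfr_term R X n = free_module R (fst (mfr R X) n)"

definition mfr_diff ::
    "('a, 'r) ring_scheme \<Rightarrow> ('a, 'm) module \<Rightarrow> nat \<Rightarrow> (nat \<Rightarrow> 'a) \<Rightarrow> (nat \<Rightarrow> 'a)" where
  "mfr_diff R X n = snd (mfr R X) n"

section \<open>Ext\<close>

definition cochains ::
    "('a, 'r) ring_scheme \<Rightarrow> nat \<Rightarrow> ('a, 'm) module \<Rightarrow> ('a, 'n) module
      \<Rightarrow> ('a, (nat \<Rightarrow> 'a) \<Rightarrow> 'n) module" where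
  "cochains R n X Y = Hom_module R (mfr_term R X n) Y"

definition codiff ::
    "('a, 'r) ring_scheme \<Rightarrow> nat \<Rightarrow> ('a, 'm) module
      \<Rightarrow> ((nat \<Rightarrow> 'a) \<Rightarrow> 'n) \<Rightarrow> ((nat \<Rightarrow> 'a) \<Rightarrow> 'n)" where
  "codiff R n X f = compose (carrier (mfr_term R X (Suc n))) f (mfr_diff R X n)"

definition cocycles ::
    "('a, 'r) ring_scheme \<Rightarrow> nat \<Rightarrow> ('a, 'm) module \<Rightarrow> ('a, 'n) module
      \<Rightarrow> ((nat \<Rightarrow> 'a) \<Rightarrow> 'n) set" where
  "cocycles R n X Y = a_kernel (cochains R n X Y) (cochains R (Suc n) X Y) (codiff R n X)"

fun coboundaries ::
    "('a, 'r) ring_scheme \<Rightarrow> nat \<Rightarrow> ('a, 'm) module \<Rightarrow> ('a, 'n) module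
      \<Rightarrow> ((nat \<Rightarrow> 'a) \<Rightarrow> 'n) set" where
  "coboundaries R 0 X Y = {\<zero>\<^bsub>cochains R 0 X Y\<^esub>}"
| "coboundaries R (Suc n) X Y = codiff R n X ` carrier (cochains R n X Y)"

definition Ext ::
    "('a, 'r) ring_scheme \<Rightarrow> nat \<Rightarrow> ('a, 'm) module \<Rightarrow> ('a, 'n) module
      \<Rightarrow> ('a, ((nat \<Rightarrow> 'a) \<Rightarrow> 'n) set) module" where
  "Ext R n X Y =
     quot_module ((cochains R n X Y)\<lparr>carrier := cocycles R n X Y\<rparr>) (coboundaries R n X Y)"

section \<open>Betti numbers and complexity\<close>

definition betti :: "('a, 'r) ring_scheme \<Rightarrow> ('a, 'm) module \<Rightarrow> nat \<Rightarrow> nat" where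
  "betti R X n =
     vectorspace.dim (residue_field R) (residue_space (Ext R n X (residue_module R)))"

definition cx :: "('a, 'r) ring_scheme \<Rightarrow> ('a, 'm) module \<Rightarrow> enat" where
  "cx R X = Inf {enat t | t. \<exists>a::real.
     eventually (\<lambda>n. real (betti R X n) \<le> a * real n powi (int t - 1)) sequentially}"

section \<open>Depth\<close>

definition ideal_mult :: "('a, 'r) ring_scheme \<Rightarrow> 'a set \<Rightarrow> ('a, 'm) module \<Rightarrow> 'm set" where
  "ideal_mult R S X =
     LinearCombinations.module.span R X {a \<odot>\<^bsub>X\<^esub> x | a x. a \<in> S \<and> x \<in> carrier X}"

definition regular_sequence ::
    "('a, 'r) ring_scheme \<Rightarrow> ('a, 'm) module \<Rightarrow> 'a list \<Rightarrow> bool" where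
  "regular_sequence R X as \<longleftrightarrow> set as \<subseteq> carrier R \<and>
     (\<forall>i < length as. let Q = quot_module X (ideal_mult R (set (take i as)) X) in
        \<forall>v \<in> carrier Q. (as ! i) \<odot>\<^bsub>Q\<^esub> v = \<zero>\<^bsub>Q\<^esub> \<longrightarrow> v = \<zero>\<^bsub>Q\<^esub>) \<and>
     ideal_mult R (set as) X \<noteq> carrier X"

text \<open>The depth of the zero module is \<open>\<infinity>\<close> by convention.\<close>

definition depth :: "('a, 'r) ring_scheme \<Rightarrow> ('a, 'm) module \<Rightarrow> enat" where
  "depth R X = (if zero_module X then \<infinity>
     else Sup {enat (length as) | as. set as \<subseteq> max_ideal R \<and> regular_sequence R X as})"

section \<open>Syzygies and the modules attached to cohomology classes\<close>

definition syzygy ::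
    "('a, 'r) ring_scheme \<Rightarrow> nat \<Rightarrow> ('a, 'm) module \<Rightarrow> 'a fgmod" where
  "syzygy R n X =
     quot_module (mfr_term R X n) (mfr_diff R X n ` carrier (mfr_term R X (Suc n)))"

definition syzygy_proj ::
    "('a, 'r) ring_scheme \<Rightarrow> nat \<Rightarrow> ('a, 'm) module \<Rightarrow> (nat \<Rightarrow> 'a) \<Rightarrow> (nat \<Rightarrow> 'a) set" where
  "syzygy_proj R n X x =
     (mfr_diff R X n ` carrier (mfr_term R X (Suc n))) +>\<^bsub>mfr_term R X n\<^esub> x"

text \<open>
  For \<open>n > 0\<close>, the inclusion of the \<open>n\<close>-th syzygy into \<open>P\<^sub>n\<^sub>-\<^sub>1\<close> is the map induced by the
  differential \<open>P\<^sub>n \<rightarrow> P\<^sub>n\<^sub>-\<^sub>1\<close>, which is constant on cosets.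
\<close>

definition syzygy_incl ::
    "('a, 'r) ring_scheme \<Rightarrow> nat \<Rightarrow> ('a, 'm) module \<Rightarrow> (nat \<Rightarrow> 'a) set \<Rightarrow> (nat \<Rightarrow> 'a)" where
  "syzygy_incl R n X C = the_elem (mfr_diff R X (n - 1) ` C)"

text \<open>A map on the \<open>n\<close>-th syzygy represents the class of the cocycle it induces on \<open>P\<^sub>n\<close>.\<close>

definition represents ::
    "('a, 'r) ring_scheme \<Rightarrow> nat \<Rightarrow> ('a, 'm) module \<Rightarrow> ('a, 'n) module \<Rightarrow>
     ((nat \<Rightarrow> 'a) set \<Rightarrow> 'n) \<Rightarrow> ((nat \<Rightarrow> 'a) \<Rightarrow> 'n) set \<Rightarrow> bool" where
  "represents R n X Y f \<eta> \<longleftrightarrow> f \<in> module_hom R (syzygy R n X) Y \<and>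
     compose (carrier (mfr_term R X n)) f (syzygy_proj R n X) \<in> \<eta>"

definition K_module ::
    "('a, 'r) ring_scheme \<Rightarrow> nat \<Rightarrow> ('a, 'm) module \<Rightarrow> ('a, 'n) module \<Rightarrow>
     ((nat \<Rightarrow> 'a) \<Rightarrow> 'n) set \<Rightarrow> ('a, ('n \<times> (nat \<Rightarrow> 'a)) set) module" where
  "K_module R n X Y \<eta> =
     pushout (syzygy R n X) Y (mfr_term R X (n - 1))
       (SOME f. represents R n X Y f \<eta>) (syzygy_incl R n X)"

section \<open>Reducible complexity\<close>

text \<open>
  The type of \<open>K_module R n X X \<eta>\<close> differs from that of \<open>X\<close>, so the induction runs over the
  universe \<open>'a fgmod\<close> and refers to a copy \<open>Z\<close> of this module there.  A module of arbitrary type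
  has reducible complexity if a copy of it in the universe does.
\<close>

inductive reducible_cx_fgmod :: "('a, 'r) ring_scheme \<Rightarrow> 'a fgmod \<Rightarrow> bool"
  for R :: "('a, 'r) ring_scheme" where
  finite_pd:
    "\<lbrakk>fg_module R X; pd R X < \<infinity>\<rbrakk> \<Longrightarrow> reducible_cx_fgmod R X"
| reduce:
    "\<lbrakk>fg_module R X; 0 < cx R X; cx R X < \<infinity>;
      0 < n; \<eta> \<in> carrier (Ext R n X X);
      cx R (K_module R n X X \<eta>) < cx R X;
      depth R (K_module R n X X \<eta>) = depth R X;
      iso_modules R Z (K_module R n X X \<eta>); reducible_cx_fgmod R Z\<rbrakk>
     \<Longrightarrow> reducible_cx_fgmod R X"

definition reducible_complexity ::
    "('a, 'r) ring_scheme \<Rightarrow> ('a, 'm) module \<Rightarrow> bool" where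
  "reducible_complexity R M \<longleftrightarrow> (\<exists>X. reducible_cx_fgmod R X \<and> iso_modules R X M)"

end

theory Submission
  imports Defs
begin

text \<open>
  Let \<open>P\<close> be the minimal free resolution of a module \<open>X\<close> and let \<open>\<theta> : P\<^sub>i\<^sub>+\<^sub>n \<rightarrow> P\<^sub>i\<close> be a chain map that lifts
  \<open>\<eta> \<in> Ext\<^sup>n(X, X)\<close>.  The mapping cone with terms \<open>P\<^sub>i \<oplus> P\<^sub>i\<^sub>+\<^sub>n\<^sub>-\<^sub>1\<close> is a free resolution of \<open>K\<^sub>\<eta>\<close>.
  Comparing it with the minimal resolution \<open>Q\<close> of \<open>K\<^sub>\<eta>\<close> shows that \<open>P\<^sub>i\<close> is generated modulo \<open>\<mm> P\<^sub>i\<close>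
  by the images of \<open>Q\<^sub>i\<close> and of \<open>\<theta>\<close>.  If \<open>Ext\<^sup>n(X, X)\<close> vanishes for all large \<open>n\<close>, then \<open>\<eta>\<close> is
  nilpotent, say \<open>\<eta>\<^sup>t = 0\<close>; so \<open>\<theta>\<^sup>t\<close> is null homotopic and maps into \<open>\<mm> P\<close> by minimality.
  Iterating, \<open>\<beta>\<^sub>i(X) \<le> \<Sum>\<^sub>j\<^sub><\<^sub>t \<beta>\<^sub>i\<^sub>+\<^sub>j\<^sub>n(K\<^sub>\<eta>)\<close> and hence \<open>cx X \<le> cx K\<^sub>\<eta>\<close>.  A module of infinite
  projective dimension and reducible complexity thus has nonvanishing self-extensions in infinitely
  many degrees.  When \<open>p = pd M\<close> is finite, \<open>Ext\<^sup>n(M, M) = 0\<close> for \<open>n > p\<close>, and \<open>Ext\<^sup>p(M, M) \<noteq> 0\<close> because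
  coboundaries have values in \<open>\<mm> M\<close>.
\<close>

section \<open>Module homomorphisms\<close>

text \<open>\<open>K_\<eta>\<close> is an extension of \<open>\<Omega>^(n-1)(X)\<close> by
  \<open>X\<close>, and the terms \<open>P_(i+n-1)\<close> resolve that syzygy, which explains the
  second summand of the cone. The cone need not be minimal: units in the matrix of
  \<open>\<theta>\<close> can make its ranks larger than the Betti numbers of
  \<open>K_\<eta>\<close>, whereas a lower bound for the latter is wanted. The comparison with
  \<open>Q\<close> controls this loss. Powers of \<open>\<eta>\<close> are composites of chain maps,
  so no product on Ext is set up; \<open>\<eta>^t = 0\<close> is read off from the vanishing of the
  whole of \<open>Ext^(tn)(X, X)\<close>. The number \<open>t\<close> of summands in the resulting
  bound is independent of \<open>i\<close>, and a bounded shift of the index changes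
  \<open>i^(s-1)\<close> by at most a constant factor once \<open>i\<close> is large, so the order
  of growth survives. Since Ext is computed from one chosen minimal resolution, Betti numbers are
  dimensions of Ext, and \<open>pd\<close> is an infimum over resolutions, all three are expressed
  through the ranks and differentials of that resolution.\<close>

lemma hom_closed: "f \<in> module_hom R M N \<Longrightarrow> x \<in> carrier M \<Longrightarrow> f x \<in> carrier N"
  by (auto simp: LinearCombinations.module_hom_def)

lemmas hom_add = LinearCombinations.module_hom_add
lemmas hom_smult = LinearCombinations.module_hom_smult

lemma module_homI:
  assumes "\<And>x. x \<in> carrier M \<Longrightarrow> f x \<in> carrier N"
    and "\<And>x y. x \<in> carrier M \<Longrightarrow> y \<in> carrier M \<Longrightarrow> f (x \<oplus>\<^bsub>M\<^esub> y) = f x \<oplus>\<^bsub>N\<^esub> f y"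
    and "\<And>a x. a \<in> carrier R \<Longrightarrow> x \<in> carrier M \<Longrightarrow> f (a \<odot>\<^bsub>M\<^esub> x) = a \<odot>\<^bsub>N\<^esub> f x"
  shows "f \<in> module_hom R M N"
  using assms by (auto simp: LinearCombinations.module_hom_def)

lemma mod_homI:
  "\<lbrakk>module R M; module R N; f \<in> module_hom R M N\<rbrakk> \<Longrightarrow> mod_hom R M N f"
  by (simp add: mod_hom_def mod_hom_axioms_def)

context
  fixes R :: "('a, 'r) ring_scheme" and M :: "('a, 'm, 'y) module_scheme" and N :: "('a, 'n, 'z) module_scheme" and f
  assumes M: "module R M" and N: "module R N" and f: "f \<in> module_hom R M N"
begin

interpretation mod_hom R M N f
  by (rule mod_homI[OF M N f])

lemma hom_zero: "f \<zero>\<^bsub>M\<^esub> = \<zero>\<^bsub>N\<^esub>"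
  by (rule f0_is_0)

lemma hom_uminus: "x \<in> carrier M \<Longrightarrow> f (\<ominus>\<^bsub>M\<^esub> x) = \<ominus>\<^bsub>N\<^esub> f x"
  by (rule f_neg)

lemma hom_minus: "x \<in> carrier M \<Longrightarrow> y \<in> carrier M \<Longrightarrow> f (x \<ominus>\<^bsub>M\<^esub> y) = f x \<ominus>\<^bsub>N\<^esub> f y"
  by (rule f_minus)

lemma hom_finsum:
  "g \<in> A \<rightarrow> carrier M \<Longrightarrow> f (\<Oplus>\<^bsub>M\<^esub>i\<in>A. g i) = (\<Oplus>\<^bsub>N\<^esub>i\<in>A. f (g i))"
proof (induct A rule: infinite_finite_induct)
  case (insert x A)
  then have "g x \<in> carrier M" "g \<in> A \<rightarrow> carrier M" by auto
  with insert show ?case by (auto simp: Pi_def)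
qed auto

lemma submodule_kernel: "LinearCombinations.submodule R (a_kernel M N f) M"
  unfolding a_kernel_def' using ker_is_submodule by (simp add: ker_def)

lemma submodule_image: "LinearCombinations.submodule R (f ` carrier M) N"
  using im_is_submodule by (simp add: im_def)

end

lemma minus_zero_eq: "module R M \<Longrightarrow> \<ominus>\<^bsub>M\<^esub> \<zero>\<^bsub>M\<^esub> = \<zero>\<^bsub>M\<^esub>"
proof -
  assume "module R M"
  then interpret Module.module R M .
  show ?thesis using M.minus_equality[of "\<zero>\<^bsub>M\<^esub>" "\<zero>\<^bsub>M\<^esub>"] by simp
qed

lemma finsum_submodule:
  assumes N: "LinearCombinations.submodule R N M" and g: "g \<in> A \<rightarrow> N"
  shows "(\<Oplus>\<^bsub>M\<^esub>i\<in>A. g i) \<in> N"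
proof -
  interpret N: LinearCombinations.submodule R N M by fact
  interpret M: Module.module R M by (rule N.module)
  from g show ?thesis
  proof (induct A rule: infinite_finite_induct)
    case (insert x A)
    then have "g \<in> A \<rightarrow> carrier M" "g x \<in> carrier M" using N.subset by auto
    with insert show ?case by auto
  qed auto
qed

lemma hom_comp:
  "\<lbrakk>f \<in> module_hom R M N; g \<in> module_hom R N L\<rbrakk> \<Longrightarrow> (\<lambda>x. g (f x)) \<in> module_hom R M L"
  by (auto simp: LinearCombinations.module_hom_def Pi_def)

lemma hom_id: "(\<lambda>x. x) \<in> module_hom R M M"
  by (auto simp: LinearCombinations.module_hom_def)

text \<open>Homomorphisms are constrained only on the carrier, so a restricted map inherits the
  property; \<open>module R M\<close> supplies the closure of the carrier under the
  operations.\<close>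

lemma hom_cong:
  assumes "module R M" "f \<in> module_hom R M N" and eq: "\<And>x. x \<in> carrier M \<Longrightarrow> g x = f x"
  shows "g \<in> module_hom R M N"
proof -
  interpret Module.module R M by fact
  show ?thesis using assms(2) by (auto simp: LinearCombinations.module_hom_def Pi_def eq)
qed

lemma hom_const_zero: "module R N \<Longrightarrow> (\<lambda>x. \<zero>\<^bsub>N\<^esub>) \<in> module_hom R M N"
proof -
  assume "module R N"
  then interpret Module.module R N .
  show ?thesis by (auto simp: LinearCombinations.module_hom_def)
qed

lemma hom_plus:
  assumes "module R N" "f \<in> module_hom R M N" "g \<in> module_hom R M N"
  shows "(\<lambda>x. f x \<oplus>\<^bsub>N\<^esub> g x) \<in> module_hom R M N"
proof -
  interpret N: Module.module R N by fact
  show ?thesis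
    by (intro module_homI)
      (use assms in \<open>simp_all add: hom_closed hom_add hom_smult N.smult_r_distr N.a_ac\<close>)
qed

lemma hom_neg:
  assumes "module R N" "f \<in> module_hom R M N"
  shows "(\<lambda>x. \<ominus>\<^bsub>N\<^esub> f x) \<in> module_hom R M N"
proof -
  interpret N: Module.module R N by fact
  show ?thesis
    by (intro module_homI)
      (use assms in \<open>simp_all add: hom_closed hom_add hom_smult N.smult_r_minus N.minus_add\<close>)
qed

lemma hom_diff:
  assumes "module R N" "f \<in> module_hom R M N" "g \<in> module_hom R M N"
  shows "(\<lambda>x. f x \<ominus>\<^bsub>N\<^esub> g x) \<in> module_hom R M N"
  using hom_plus[OF assms(1,2) hom_neg[OF assms(1,3)]] by (simp add: a_minus_def)

lemma hom_inv:
  assumes "module R M" "h \<in> module_hom R M N" "bij_betw h (carrier M) (carrier N)"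
  shows "inv_into (carrier M) h \<in> module_hom R N M"
proof -
  interpret M: Module.module R M by fact
  let ?g = "inv_into (carrier M) h"
  have g: "?g y \<in> carrier M" "h (?g y) = y" if "y \<in> carrier N" for y
    using assms(3) that bij_betw_inv_into_right bij_betwE bij_betw_inv_into by fastforce+
  have inj: "x = y" if "h x = h y" "x \<in> carrier M" "y \<in> carrier M" for x y
    using assms(3) that by (auto simp: bij_betw_def inj_on_def)
  have hc: "h x \<in> carrier N" if "x \<in> carrier M" for x
    using assms(2) that by (rule hom_closed)
  have add: "x \<oplus>\<^bsub>N\<^esub> y = h (?g x \<oplus>\<^bsub>M\<^esub> ?g y)" if "x \<in> carrier N" "y \<in> carrier N" for x y
    using that by (simp add: hom_add[OF assms(2)] g)
  have smult: "a \<odot>\<^bsub>N\<^esub> x = h (a \<odot>\<^bsub>M\<^esub> ?g x)" if "a \<in> carrier R" "x \<in> carrier N" for x a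
    using that by (simp add: hom_smult[OF assms(2)] g)
  have gh: "?g (h x) = x" if "x \<in> carrier M" for x
    using assms(3) that by (simp add: bij_betw_inv_into_left)
  show ?thesis
    by (intro module_homI) (simp_all add: g add smult gh)
qed

section \<open>Free modules\<close>

definition unit_vec :: "('a, 'r) ring_scheme \<Rightarrow> nat \<Rightarrow> nat \<Rightarrow> nat \<Rightarrow> 'a" where
  "unit_vec R n i = (\<lambda>j\<in>{..<n}. if j = i then \<one>\<^bsub>R\<^esub> else \<zero>\<^bsub>R\<^esub>)"

text \<open>On \<open>R^n\<close> this is the homomorphism that sends the \<open>i\<close>-th unit
  vector to \<open>v i\<close>. Coefficients are attached to indices, whereas those of
  \<open>lincomb\<close> are attached to elements and cannot distinguish repeated values of
  \<open>v\<close>.\<close>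

definition comb :: "('a, 'm, 'z) module_scheme \<Rightarrow> nat \<Rightarrow> (nat \<Rightarrow> 'm) \<Rightarrow> (nat \<Rightarrow> 'a) \<Rightarrow> 'm" where
  "comb M n v x = (\<Oplus>\<^bsub>M\<^esub>i\<in>{..<n}. x i \<odot>\<^bsub>M\<^esub> v i)"

context cring
begin

lemma carrier_free: "carrier (free_module R n) = {..<n} \<rightarrow>\<^sub>E carrier R"
  and zero_free: "\<zero>\<^bsub>free_module R n\<^esub> = (\<lambda>i\<in>{..<n}. \<zero>)"
  and add_free: "x \<oplus>\<^bsub>free_module R n\<^esub> y = (\<lambda>i\<in>{..<n}. x i \<oplus> y i)"
  and smult_free: "a \<odot>\<^bsub>free_module R n\<^esub> x = (\<lambda>i\<in>{..<n}. a \<otimes> x i)"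
  by (simp_all add: free_module_def func_space_def)

lemma module_free [simp]: "module R (free_module R n)"
  unfolding free_module_def by (rule func_space_is_module)

lemma free_coeff_closed: "x \<in> carrier (free_module R n) \<Longrightarrow> i < n \<Longrightarrow> x i \<in> carrier R"
  by (auto simp: carrier_free)

lemma free_eqI:
  assumes "x \<in> carrier (free_module R n)" "y \<in> carrier (free_module R n)"
    and "\<And>i. i < n \<Longrightarrow> x i = y i"
  shows "x = y"
  using assms by (auto simp: carrier_free intro: PiE_ext)

lemma coord_hom: "i < n \<Longrightarrow> (\<lambda>x. x i) \<in> module_hom R (free_module R n) (regular_module R)"
  by (rule module_homI) (auto simp: carrier_free add_free smult_free regular_module_def)

lemma module_regular [simp]: "module R (regular_module R)"
  by (rule module_criteria)
    (auto simp: regular_module_def is_cring a_ac m_ac l_distr r_distr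
      intro!: bexI[of _ "\<ominus> _"] r_neg)

lemma unit_vec_closed [simp]: "unit_vec R n i \<in> carrier (free_module R n)"
  by (auto simp: unit_vec_def carrier_free)

lemma comb_hom:
  assumes M: "module R M" and v: "v \<in> {..<n} \<rightarrow> carrier M"
  shows "comb M n v \<in> module_hom R (free_module R n) M"
proof -
  interpret M: Module.module R M by fact
  have vi: "v i \<in> carrier M" if "i < n" for i
    using v that by auto
  show ?thesis
  proof (rule module_homI)
    fix x assume x: "x \<in> carrier (free_module R n)"
    then show "comb M n v x \<in> carrier M"
      unfolding comb_def by (intro M.finsum_closed) (auto simp: free_coeff_closed vi)
    fix y assume y: "y \<in> carrier (free_module R n)"
    have "comb M n v (x \<oplus>\<^bsub>free_module R n\<^esub> y)
        = (\<Oplus>\<^bsub>M\<^esub>i\<in>{..<n}. x i \<odot>\<^bsub>M\<^esub> v i \<oplus>\<^bsub>M\<^esub> y i \<odot>\<^bsub>M\<^esub> v i)"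
      unfolding comb_def using x y
      by (intro M.finsum_cong') (auto simp: add_free M.smult_l_distr free_coeff_closed vi)
    also have "\<dots> = comb M n v x \<oplus>\<^bsub>M\<^esub> comb M n v y"
      unfolding comb_def using x y
      by (intro M.finsum_addf) (auto simp: free_coeff_closed vi)
    finally show "comb M n v (x \<oplus>\<^bsub>free_module R n\<^esub> y) = comb M n v x \<oplus>\<^bsub>M\<^esub> comb M n v y" .
  next
    fix a x assume a: "a \<in> carrier R" and x: "x \<in> carrier (free_module R n)"
    have "comb M n v (a \<odot>\<^bsub>free_module R n\<^esub> x) = (\<Oplus>\<^bsub>M\<^esub>i\<in>{..<n}. a \<odot>\<^bsub>M\<^esub> (x i \<odot>\<^bsub>M\<^esub> v i))"
      unfolding comb_def using x a
      by (intro M.finsum_cong') (auto simp: smult_free M.smult_assoc1 free_coeff_closed vi)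
    also have "\<dots> = a \<odot>\<^bsub>M\<^esub> comb M n v x"
      unfolding comb_def using x a
      by (intro M.finsum_smult_ldistr[symmetric]) (auto simp: free_coeff_closed vi)
    finally show "comb M n v (a \<odot>\<^bsub>free_module R n\<^esub> x) = a \<odot>\<^bsub>M\<^esub> comb M n v x" .
  qed
qed

lemma comb_unit_vec:
  assumes M: "module R M" and v: "v \<in> {..<n} \<rightarrow> carrier M" and i: "i < n"
  shows "comb M n v (unit_vec R n i) = v i"
proof -
  interpret M: Module.module R M by fact
  have vi: "v i \<in> carrier M" if "i < n" for i
    using v that by auto
  have "comb M n v (unit_vec R n i) = (\<Oplus>\<^bsub>M\<^esub>j\<in>{..<n}. if i = j then v j else \<zero>\<^bsub>M\<^esub>)"
    unfolding comb_def
    by (intro M.finsum_cong') (auto simp: unit_vec_def vi)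
  also have "\<dots> = v i"
    by (rule M.finsum_singleton) (use i vi in auto)
  finally show ?thesis .
qed

lemma free_expand:
  assumes x: "x \<in> carrier (free_module R n)"
  shows "comb (free_module R n) n (unit_vec R n) x = x"
proof (rule free_eqI[OF _ x])
  have c: "comb (free_module R n) n (unit_vec R n) \<in> module_hom R (free_module R n) (free_module R n)"
    by (rule comb_hom) auto
  show "comb (free_module R n) n (unit_vec R n) x \<in> carrier (free_module R n)"
    using c x by (rule hom_closed)
  fix i assume i: "i < n"
  interpret F: Module.module R "free_module R n" by simp
  interpret S: Module.module R "regular_module R" by (rule module_regular)
  have "comb (free_module R n) n (unit_vec R n) x i
      = (\<Oplus>\<^bsub>regular_module R\<^esub>j\<in>{..<n}. (x j \<odot>\<^bsub>free_module R n\<^esub> unit_vec R n j) i)"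
    unfolding comb_def
    by (rule hom_finsum[OF module_free module_regular coord_hom[OF i]])
      (use x in \<open>auto simp: free_coeff_closed\<close>)
  \<comment> \<open>Coefficients and vectors change roles: by commutativity the sum combines the
    entries of \<open>x\<close> with the coordinates of a unit vector as coefficients.\<close>
  also have "\<dots> = comb (regular_module R) n x (unit_vec R n i)"
    unfolding comb_def
    by (rule S.finsum_cong')
      (use x i in \<open>auto simp: unit_vec_def smult_free regular_module_def free_coeff_closed m_comm\<close>)
  also have "\<dots> = x i"
    by (rule comb_unit_vec[OF module_regular])
      (use x i in \<open>auto simp: regular_module_def free_coeff_closed\<close>)
  finally show "comb (free_module R n) n (unit_vec R n) x i = x i" .
qed

lemma free_hom_eq_comb:
  assumes M: "module R M" and f: "f \<in> module_hom R (free_module R n) M"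
    and x: "x \<in> carrier (free_module R n)"
  shows "f x = comb M n (\<lambda>i. f (unit_vec R n i)) x"
proof -
  interpret M: Module.module R M by fact
  interpret F: Module.module R "free_module R n" by simp
  have "f x = f (comb (free_module R n) n (unit_vec R n) x)"
    by (simp add: free_expand x)
  also have "\<dots> = (\<Oplus>\<^bsub>M\<^esub>i\<in>{..<n}. f (x i \<odot>\<^bsub>free_module R n\<^esub> unit_vec R n i))"
    unfolding comb_def
    by (rule hom_finsum[OF module_free M f]) (use x in \<open>auto simp: free_coeff_closed\<close>)
  also have "\<dots> = comb M n (\<lambda>i. f (unit_vec R n i)) x"
    unfolding comb_def
    by (rule M.finsum_cong')
      (use x in \<open>auto simp: free_coeff_closed hom_smult[OF f] hom_closed[OF f]\<close>)
  finally show ?thesis .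
qed

lemma free_hom_ext:
  assumes "module R M" "f \<in> module_hom R (free_module R n) M" "g \<in> module_hom R (free_module R n) M"
    and "\<And>i. i < n \<Longrightarrow> f (unit_vec R n i) = g (unit_vec R n i)"
    and x: "x \<in> carrier (free_module R n)"
  shows "f x = g x"
proof -
  interpret M: Module.module R M by fact
  show ?thesis
    unfolding free_hom_eq_comb[OF assms(1,2) x] free_hom_eq_comb[OF assms(1,3) x] comb_def
    by (rule M.finsum_cong')
      (use assms in \<open>auto simp: free_coeff_closed hom_closed[OF assms(3)]\<close>)
qed

lemma free_lift:
  assumes Y: "module R Y" and Q: "module R Q"
    and f: "f \<in> module_hom R (free_module R n) Y" and h: "h \<in> module_hom R Q Y"
    and sub: "\<And>x. x \<in> carrier (free_module R n) \<Longrightarrow> f x \<in> h ` carrier Q"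
  shows "\<exists>l\<in>module_hom R (free_module R n) Q. \<forall>x\<in>carrier (free_module R n). h (l x) = f x"
proof -
  have "\<forall>i. \<exists>v. v \<in> carrier Q \<and> h v = f (unit_vec R n i)"
    using sub[OF unit_vec_closed] by (metis imageE)
  then obtain v where v: "\<And>i. v i \<in> carrier Q" "\<And>i. h (v i) = f (unit_vec R n i)"
    by metis
  then have l: "comb Q n v \<in> module_hom R (free_module R n) Q"
    by (intro comb_hom) (auto simp: Q)
  have "h (comb Q n v x) = f x" if "x \<in> carrier (free_module R n)" for x
    by (rule free_hom_ext[OF Y hom_comp[OF l h] f _ that]) (simp add: comb_unit_vec Q v)
  with l show ?thesis by blast
qed

text \<open>\<open>P\<close> is a retract of a free module, and a map out of a free module lifts by
  choosing preimages for the unit vectors. Asking only that \<open>f\<close> take values in the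
  image of \<open>h\<close> is the form in which exactness of a resolution provides
  liftings.\<close>

lemma projective_lift:
  assumes P: "fg_projective R P" and Y: "module R Y" and Q: "module R Q"
    and f: "f \<in> module_hom R P Y" and h: "h \<in> module_hom R Q Y"
    and sub: "\<And>x. x \<in> carrier P \<Longrightarrow> f x \<in> h ` carrier Q"
  obtains l where "l \<in> module_hom R P Q" "\<And>x. x \<in> carrier P \<Longrightarrow> h (l x) = f x"
proof -
  from P obtain n i p where ip: "i \<in> module_hom R P (free_module R n)"
      "p \<in> module_hom R (free_module R n) P" "\<And>x. x \<in> carrier P \<Longrightarrow> p (i x) = x"
    unfolding fg_projective_def by blast
  obtain l where l: "l \<in> module_hom R (free_module R n) Q"
      "\<And>x. x \<in> carrier (free_module R n) \<Longrightarrow> h (l x) = f (p x)"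
    using free_lift[OF Y Q hom_comp[OF ip(2) f] h] sub hom_closed[OF ip(2)] by blast
  show ?thesis
    by (rule that[of "\<lambda>x. l (i x)"])
      (use ip l hom_comp[OF ip(1) l(1)] in \<open>auto simp: hom_closed[OF ip(1)]\<close>)
qed

lemma projective_free [simp]: "fg_projective R (free_module R n)"
  unfolding fg_projective_def using hom_id by force

end

section \<open>Noetherian local rings and minimal free resolutions\<close>

locale local_noetherian = cring R + noetherian_ring R for R (structure) +
  assumes local: "local_ring R"
begin

lemma maximal_max_ideal: "maximalideal (max_ideal R) R"
  using local unfolding local_ring_def max_ideal_def by (metis theI')

lemma maximalideal_unique: "maximalideal I R \<Longrightarrow> I = max_ideal R"
  using local maximal_max_ideal unfolding local_ring_def by blast

lemma ideal_max_ideal: "ideal (max_ideal R) R"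
  using maximal_max_ideal by (rule maximalideal.axioms(1))

lemma additive_max_ideal: "additive_subgroup (max_ideal R) R"
  using ideal_max_ideal by (rule ideal.axioms(1))

lemma max_ideal_closed [simp]: "a \<in> max_ideal R \<Longrightarrow> a \<in> carrier R"
  using additive_subgroup.a_Hcarr[OF additive_max_ideal] .

lemma max_ideal_add: "a \<in> max_ideal R \<Longrightarrow> b \<in> max_ideal R \<Longrightarrow> a \<oplus> b \<in> max_ideal R"
  using additive_subgroup.a_closed[OF additive_max_ideal] .

lemma max_ideal_zero: "\<zero> \<in> max_ideal R"
  using additive_subgroup.zero_closed[OF additive_max_ideal] .

lemma max_ideal_mult: "a \<in> max_ideal R \<Longrightarrow> x \<in> carrier R \<Longrightarrow> x \<otimes> a \<in> max_ideal R"
  using ideal.I_l_closed[OF ideal_max_ideal] .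

lemma max_ideal_mult_right: "a \<in> max_ideal R \<Longrightarrow> x \<in> carrier R \<Longrightarrow> a \<otimes> x \<in> max_ideal R"
  using ideal.I_r_closed[OF ideal_max_ideal] .

lemma one_notin_max_ideal: "\<one> \<notin> max_ideal R"
  using maximalideal.I_notcarr[OF maximal_max_ideal] ideal.one_imp_carrier[OF ideal_max_ideal]
  by metis

text \<open>Some maximal ideal contains \<open>I\<close>, and locality leaves only one candidate. In
  Zorn's lemma for the ideals avoiding \<open>\<one>\<close>, upper bounds come from the Noetherian
  property: a nonempty chain of ideals contains its own union.\<close>

lemma ideal_le_maximal:
  assumes I: "ideal I R" "\<one> \<notin> I"
  shows "I \<subseteq> max_ideal R"
proof -
  let ?F = "{J. ideal J R \<and> I \<subseteq> J \<and> \<one> \<notin> J}"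
  have "\<exists>J\<in>?F. \<forall>X\<in>?F. J \<subseteq> X \<longrightarrow> X = J"
  proof (rule subset_Zorn)
    fix C assume C: "subset.chain ?F C"
    show "\<exists>U\<in>?F. \<forall>X\<in>C. X \<subseteq> U"
    proof (cases "C = {}")
      case True
      with I show ?thesis by auto
    next
      case False
      from C have "subset.chain {I. ideal I R} C"
        by (auto simp: subset.chain_def)
      with False have "\<Union>C \<in> C" by (rule ideal_chain_is_trivial)
      moreover from C have "C \<subseteq> ?F" by (auto simp: subset.chain_def)
      ultimately show ?thesis by blast
    qed
  qed
  then obtain J where J: "ideal J R" "I \<subseteq> J" "\<one> \<notin> J"
    and max: "\<And>X. ideal X R \<Longrightarrow> I \<subseteq> X \<Longrightarrow> \<one> \<notin> X \<Longrightarrow> J \<subseteq> X \<Longrightarrow> X = J"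
    by auto
  have "maximalideal J R"
  proof (rule maximalidealI[OF J(1)])
    show "carrier R \<noteq> J" using J(3) by auto
    fix X assume X: "ideal X R" "J \<subseteq> X" "X \<subseteq> carrier R"
    show "X = J \<or> X = carrier R"
    proof (cases "\<one> \<in> X")
      case True
      then show ?thesis using ideal.one_imp_carrier[OF X(1)] by simp
    next
      case False
      then show ?thesis using max[OF X(1)] X J by blast
    qed
  qed
  with J(2) show ?thesis using maximalideal_unique by blast
qed

text \<open>Otherwise the principal ideal of \<open>a\<close> is proper, and the maximal ideal
  contains it together with \<open>a\<close>.\<close>

lemma unit_if_notin_max_ideal:
  assumes "a \<in> carrier R" "a \<notin> max_ideal R"
  shows "a \<in> Units R"
proof -
  have "\<one> \<in> PIdl a"
    using ideal_le_maximal[OF cgenideal_ideal[OF assms(1)]] cgenideal_self[OF assms(1)] assms(2)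
    by blast
  then obtain x where "x \<in> carrier R" "\<one> = x \<otimes> a"
    unfolding cgenideal_def by auto
  then show ?thesis
    using assms(1) m_comm unfolding Units_def by force
qed

text \<open>This is \<open>\<mm> F\<close> for \<open>F = R^n\<close>, in coordinates; uses of
  minimality become statements about membership in this submodule.\<close>

definition mvec :: "nat \<Rightarrow> (nat \<Rightarrow> 'a) set" where
  "mvec n = {x \<in> carrier (free_module R n). \<forall>i<n. x i \<in> max_ideal R}"

lemma zero_coord: "i < n \<Longrightarrow> \<zero>\<^bsub>free_module R n\<^esub> i = \<zero>"
  by (simp add: zero_free)

lemma mvec_closed: "x \<in> mvec n \<Longrightarrow> x \<in> carrier (free_module R n)"
  by (simp add: mvec_def)

lemma mvec_zero: "\<zero>\<^bsub>free_module R n\<^esub> \<in> mvec n"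
  by (auto simp: mvec_def zero_free carrier_free max_ideal_zero)

lemma mvec_add: "x \<in> mvec n \<Longrightarrow> y \<in> mvec n \<Longrightarrow> x \<oplus>\<^bsub>free_module R n\<^esub> y \<in> mvec n"
  by (auto simp: mvec_def add_free carrier_free max_ideal_add)

lemma mvec_smult_max:
  "a \<in> max_ideal R \<Longrightarrow> x \<in> carrier (free_module R n) \<Longrightarrow> a \<odot>\<^bsub>free_module R n\<^esub> x \<in> mvec n"
  by (auto simp: mvec_def smult_free carrier_free PiE_iff max_ideal_mult_right)

lemma mvec_smult:
  "x \<in> mvec n \<Longrightarrow> a \<in> carrier R \<Longrightarrow> a \<odot>\<^bsub>free_module R n\<^esub> x \<in> mvec n"
  by (auto simp: mvec_def smult_free carrier_free max_ideal_mult)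

lemma submodule_mvec: "LinearCombinations.submodule R (mvec n) (free_module R n)"
  by (rule LinearCombinations.submodule.intro)
    (auto simp: mvec_closed mvec_add mvec_zero mvec_smult)

lemma unit_vec_notin_mvec: "i < n \<Longrightarrow> unit_vec R n i \<notin> mvec n"
  using one_notin_max_ideal by (auto simp: mvec_def unit_vec_def)

text \<open>Expanding \<open>x\<close> in unit vectors puts all coefficients into the maximal ideal.
  Applied after a minimal differential, this makes every composite that contains such a differential
  invisible modulo \<open>\<mm>\<close>.\<close>

lemma hom_mvec:
  assumes f: "f \<in> module_hom R (free_module R n) (free_module R k)" and x: "x \<in> mvec n"
  shows "f x \<in> mvec k"
proof -
  interpret F: Module.module R "free_module R k" by simp
  have "(\<Oplus>\<^bsub>free_module R k\<^esub>i\<in>{..<n}. x i \<odot>\<^bsub>free_module R k\<^esub> f (unit_vec R n i)) \<in> mvec k"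
    by (rule finsum_submodule[OF submodule_mvec])
      (use x in \<open>auto simp: mvec_def intro!: mvec_smult_max[unfolded mvec_def, simplified]
          hom_closed[OF f]\<close>)
  then show ?thesis
    using free_hom_eq_comb[OF module_free f mvec_closed[OF x]] by (simp add: comb_def)
qed

text \<open>Induction on the number \<open>k\<close> of leading coordinates in which vectors of
  \<open>N\<close> may be nonzero. The last of these coordinates runs through an ideal, which is
  finitely generated; lifts of its generators reduce a vector of \<open>N\<close> to one with one
  coordinate fewer.\<close>

lemma fg_submodule_free:
  assumes N: "LinearCombinations.submodule R N (free_module R n)"
  shows "\<exists>S. finite S \<and> S \<subseteq> N \<and> LinearCombinations.module.span R (free_module R n) S = N"
proof -
  interpret F: Module.module R "free_module R n" by simp
  have "\<exists>S. finite S \<and> S \<subseteq> N \<and> F.span S = N"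
    if "k \<le> n" "LinearCombinations.submodule R N (free_module R n)"
      "\<And>x i. x \<in> N \<Longrightarrow> k \<le> i \<Longrightarrow> i < n \<Longrightarrow> x i = \<zero>" for k N
    using that
  proof (induct k arbitrary: N)
    case 0
    interpret N: LinearCombinations.submodule R N "free_module R n" by (rule 0(2))
    have "x = \<zero>\<^bsub>free_module R n\<^esub>" if "x \<in> N" for x
      using that N.subset 0(3) by (intro free_eqI[OF _ F.zero_closed]) (auto simp: zero_free)
    then have "N = {\<zero>\<^bsub>free_module R n\<^esub>}" using N.zero_closed by blast
    moreover have "F.span {\<zero>\<^bsub>free_module R n\<^esub>} \<subseteq> N"
      by (rule F.span_is_subset[OF _ 0(2)]) simp
    moreover have "{\<zero>\<^bsub>free_module R n\<^esub>} \<subseteq> F.span {\<zero>\<^bsub>free_module R n\<^esub>}"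
      by (rule F.in_own_span) simp
    ultimately show ?case by (intro exI[of _ "{\<zero>\<^bsub>free_module R n\<^esub>}"]) simp
  next
    case (Suc k)
    interpret N: LinearCombinations.submodule R N "free_module R n" by (rule Suc.prems(2))
    have k: "k < n" using Suc.prems(1) by simp
    note Nc = subsetD[OF N.subset]
    have coord: "(x \<oplus>\<^bsub>free_module R n\<^esub> y) k = x k \<oplus> y k" "(a \<odot>\<^bsub>free_module R n\<^esub> x) k = a \<otimes> x k"
      for x y a using k by (auto simp: add_free smult_free)
    have minus_coord: "(x \<ominus>\<^bsub>free_module R n\<^esub> y) i = x i \<ominus> y i"
      if "x \<in> N" "y \<in> N" "i < n" for x y i
      using hom_minus[OF module_free module_regular coord_hom[OF that(3)] Nc[OF that(1)] Nc[OF that(2)]]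
        hom_closed[OF coord_hom[OF that(3)] Nc[OF that(1)]]
        hom_closed[OF coord_hom[OF that(3)] Nc[OF that(2)]]
      by (simp add: a_minus_def a_inv_def regular_module_def m_inv_def)
    have Nminus: "x \<ominus>\<^bsub>free_module R n\<^esub> y \<in> N" if "x \<in> N" "y \<in> N" for x y
      using that N.smult_closed[of "\<ominus> \<one>" y] by (simp add: a_minus_def F.smult_minus_1 Nc)
    \<comment> \<open>Stated for an arbitrary submodule \<open>L\<close>, since it serves both for
      \<open>N\<close> and for the span \<open>?W\<close> of the lifted generators.\<close>
    have ideal_coord: "ideal ((\<lambda>x. x k) ` L) R"
      if L: "LinearCombinations.submodule R L (free_module R n)" for L
    proof -
      interpret L: LinearCombinations.submodule R L "free_module R n" by (rule L)
      have Lc: "x k \<in> carrier R" if "x \<in> L" for x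
        using L.subset that k by (auto simp: free_coeff_closed)
      have neg: "\<ominus> (x k) \<in> (\<lambda>x. x k) ` L" if "x \<in> L" for x
      proof (rule image_eqI)
        show "\<ominus> \<one> \<odot>\<^bsub>free_module R n\<^esub> x \<in> L" using that by simp
        show "\<ominus> (x k) = (\<ominus> \<one> \<odot>\<^bsub>free_module R n\<^esub> x) k" using Lc[OF that] k
          by (simp add: coord l_minus)
      qed
      have mult: "a \<otimes> x k \<in> (\<lambda>x. x k) ` L" if "x \<in> L" "a \<in> carrier R" for x a
        by (rule image_eqI[of _ _ "a \<odot>\<^bsub>free_module R n\<^esub> x"]) (use that in \<open>auto simp: coord\<close>)
      have "subgroup ((\<lambda>x. x k) ` L) (add_monoid R)"
      proof
        show "(\<lambda>x. x k) ` L \<subseteq> carrier (add_monoid R)" using Lc by auto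
        fix a b assume "a \<in> (\<lambda>x. x k) ` L" "b \<in> (\<lambda>x. x k) ` L"
        then obtain x y where "a = x k" "b = y k" "x \<in> L" "y \<in> L" by auto
        then show "a \<otimes>\<^bsub>add_monoid R\<^esub> b \<in> (\<lambda>x. x k) ` L"
          by (auto simp: coord intro!: image_eqI[of _ _ "x \<oplus>\<^bsub>free_module R n\<^esub> y"])
      next
        show "\<one>\<^bsub>add_monoid R\<^esub> \<in> (\<lambda>x. x k) ` L"
          using k by (intro image_eqI[OF _ L.zero_closed]) (simp add: zero_free)
      next
        fix a assume "a \<in> (\<lambda>x. x k) ` L"
        then show "inv\<^bsub>add_monoid R\<^esub> a \<in> (\<lambda>x. x k) ` L"
          using neg by (auto simp: a_inv_def)
      qed
      then show ?thesis
        by (intro idealI ring_axioms) (auto simp: mult Lc m_comm[OF Lc])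
    qed
    obtain G where G: "G \<subseteq> carrier R" "finite G" "(\<lambda>x. x k) ` N = Idl G"
      using finetely_gen[OF ideal_coord[OF Suc.prems(2)]] by blast
    then have "\<forall>a\<in>G. \<exists>x. x \<in> N \<and> x k = a"
      using genideal_self[OF G(1)] by (metis (no_types, lifting) imageE subsetD)
    then obtain w where w: "\<And>a. a \<in> G \<Longrightarrow> w a \<in> N" "\<And>a. a \<in> G \<Longrightarrow> w a k = a"
      by metis
    let ?W = "F.span (w ` G)"
    have wN: "w ` G \<subseteq> N" using w by auto
    then have wc: "w ` G \<subseteq> carrier (free_module R n)" using N.subset by blast
    have W: "LinearCombinations.submodule R ?W (free_module R n)"
      using wc by (rule F.span_is_submodule)
    have WN: "?W \<subseteq> N" using wN Suc.prems(2) by (rule F.span_is_subset)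
    have "G \<subseteq> (\<lambda>x. x k) ` ?W"
    proof
      fix a assume a: "a \<in> G"
      then show "a \<in> (\<lambda>x. x k) ` ?W"
        using F.in_own_span[OF wc] w(2) by (intro image_eqI[of _ _ "w a"]) auto
    qed
    \<comment> \<open>The coordinates of \<open>?W\<close> form an ideal, so it suffices that they
      contain the generators \<open>G\<close>.\<close>
    then have sub: "(\<lambda>x. x k) ` N \<subseteq> (\<lambda>x. x k) ` ?W"
      unfolding G(3) by (rule genideal_minimal[OF ideal_coord[OF W]])
    let ?N' = "{x \<in> N. x k = \<zero>}"
    have N'_sub: "LinearCombinations.submodule R ?N' (free_module R n)"
      by (rule LinearCombinations.submodule.intro)
        (use k in \<open>auto simp: coord Nc zero_coord\<close>)
    have N'_zero: "x i = \<zero>" if "x \<in> ?N'" "k \<le> i" "i < n" for x i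
      using that Suc.prems(3)[of x i] by (cases "i = k") auto
    have "\<exists>S. finite S \<and> S \<subseteq> ?N' \<and> F.span S = ?N'"
      by (rule Suc.hyps[OF less_imp_le[OF k] N'_sub]) (rule N'_zero)
    then obtain S where S: "finite S" "S \<subseteq> ?N'" "F.span S = ?N'"
      by (elim exE conjE)
    let ?T = "S \<union> w ` G"
    have TN: "?T \<subseteq> N" using S wN by auto
    then have Tc: "?T \<subseteq> carrier (free_module R n)" using N.subset by blast
    interpret T: LinearCombinations.submodule R "F.span ?T" "free_module R n"
      using Tc by (rule F.span_is_submodule)
    have "x \<in> F.span ?T" if x: "x \<in> N" for x
    proof -
      have "x k \<in> (\<lambda>x. x k) ` ?W"
        by (rule subsetD[OF sub]) (rule imageI[OF x])
      then obtain y where y: "x k = y k" "y \<in> ?W" by (rule imageE)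
      have yN: "y \<in> N" using WN y(2) by (rule subsetD)
      have "(x \<ominus>\<^bsub>free_module R n\<^esub> y) k = \<zero>"
        using minus_coord[OF x yN k] y(1) free_coeff_closed[OF Nc[OF yN] k]
        by (simp add: a_minus_def r_neg)
      with Nminus[OF x yN] have "x \<ominus>\<^bsub>free_module R n\<^esub> y \<in> F.span S"
        unfolding S(3) by simp
      then have "x \<ominus>\<^bsub>free_module R n\<^esub> y \<in> F.span ?T"
        by (rule subsetD[OF F.span_is_monotone[OF Un_upper1]])
      moreover have "y \<in> F.span ?T"
        using y(2) by (rule subsetD[OF F.span_is_monotone[OF Un_upper2]])
      ultimately have "(x \<ominus>\<^bsub>free_module R n\<^esub> y) \<oplus>\<^bsub>free_module R n\<^esub> y \<in> F.span ?T"
        by (rule T.m_closed)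
      then show ?thesis
        using Nc[OF x] Nc[OF yN] by (simp add: a_minus_def F.a_assoc F.l_neg)
    qed
    then have "N \<subseteq> F.span ?T" by (rule subsetI)
    moreover have "F.span ?T \<subseteq> N" using TN Suc.prems(2) by (rule F.span_is_subset)
    ultimately have "F.span ?T = N" by (intro equalityI)
    then show ?case
      using S(1) G(2) TN by (intro exI[of _ ?T]) simp
  qed
  from this[of n N] N show ?thesis by auto
qed

text \<open>A generating set of least cardinality is taken. A relation with a coefficient outside
  the maximal ideal, hence a unit, would express one generator by the others, so all relations have
  coefficients in the maximal ideal.\<close>

lemma minimal_cover:
  assumes M: "module R M" and S: "finite S" "S \<subseteq> carrier M"
  shows "\<exists>b f. f \<in> module_hom R (free_module R b) M \<and>
    f ` carrier (free_module R b) = LinearCombinations.module.span R M S \<and>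
    a_kernel (free_module R b) M f \<subseteq> mvec b"
proof -
  interpret M: Module.module R M by fact
  define P where "P T \<longleftrightarrow> finite T \<and> T \<subseteq> carrier M \<and> M.span T = M.span S" for T
  have "P S" using S by (simp add: P_def)
  then obtain T where T: "P T" and least: "\<And>T'. P T' \<Longrightarrow> card T \<le> card T'"
    using ex_has_least_nat[of P S card] by blast
  from T have fin: "finite T" and Tc: "T \<subseteq> carrier M" and span: "M.span T = M.span S"
    by (auto simp: P_def)
  \<comment> \<open>The enumeration \<open>v\<close> and its inverse \<open>u\<close> translate
    between \<open>comb\<close>, which works with indices, and \<open>lincomb\<close>, which works
    with elements.\<close>
  obtain v where v: "bij_betw v {..<card T} T"
    using ex_bij_betw_nat_finite[OF fin] by (auto simp: atLeast0LessThan)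
  define u where "u = inv_into {..<card T} v"
  have uv: "u (v i) = i" if "i < card T" for i
    using that v unfolding u_def by (simp add: bij_betw_inv_into_left)
  have vu: "v (u t) = t" "u t < card T" if "t \<in> T" for t
    using that v bij_betw_inv_into[OF v] unfolding u_def
    by (auto simp: bij_betw_inv_into_right bij_betw_def)
  have vT: "v i \<in> T" if "i < card T" for i using that v by (auto simp: bij_betw_def)
  let ?F = "free_module R (card T)" and ?f = "comb M (card T) v"
  have hom: "?f \<in> module_hom R ?F M"
    by (rule comb_hom[OF M]) (use vT Tc in auto)
  have comb_lincomb: "?f x = M.lincomb (\<lambda>t. x (u t)) T" if x: "x \<in> carrier ?F" for x
  proof -
    have "M.lincomb (\<lambda>t. x (u t)) T = (\<Oplus>\<^bsub>M\<^esub>t\<in>v ` {..<card T}. x (u t) \<odot>\<^bsub>M\<^esub> t)"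
      using v by (simp add: M.lincomb_def bij_betw_def)
    also have "\<dots> = (\<Oplus>\<^bsub>M\<^esub>i\<in>{..<card T}. x (u (v i)) \<odot>\<^bsub>M\<^esub> v i)"
      by (rule M.finsum_reindex)
        (use v vu Tc x in \<open>auto simp: bij_betw_def free_coeff_closed\<close>)
    also have "\<dots> = ?f x"
      unfolding comb_def
      by (rule M.finsum_cong') (use vT Tc uv in \<open>auto simp: free_coeff_closed[OF x] subset_iff\<close>)
    finally show ?thesis by simp
  qed
  have image: "?f ` carrier ?F = M.span S"
  proof -
    have "?f ` carrier ?F = {M.lincomb a T | a. a \<in> T \<rightarrow> carrier R}"
    proof (intro equalityI subsetI)
      fix y assume "y \<in> ?f ` carrier ?F"
      then obtain x where "x \<in> carrier ?F" "y = M.lincomb (\<lambda>t. x (u t)) T"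
        using comb_lincomb by auto
      then show "y \<in> {M.lincomb a T | a. a \<in> T \<rightarrow> carrier R}"
        using vu by (auto simp: free_coeff_closed)
    next
      fix y assume "y \<in> {M.lincomb a T | a. a \<in> T \<rightarrow> carrier R}"
      then obtain a where a: "a \<in> T \<rightarrow> carrier R" "y = M.lincomb a T" by auto
      let ?x = "\<lambda>i\<in>{..<card T}. a (v i)"
      have x: "?x \<in> carrier ?F" using a vT by (auto simp: carrier_free)
      have "?f ?x = M.lincomb (\<lambda>t. ?x (u t)) T" by (rule comb_lincomb[OF x])
      also have "\<dots> = y" unfolding a(2)
        by (rule M.lincomb_cong) (use a Tc vu in auto)
      finally show "y \<in> ?f ` carrier ?F" using x by blast
    qed
    then show ?thesis using M.finite_span[OF fin Tc] span by simp
  qed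
  have "x \<in> mvec (card T)" if x: "x \<in> carrier ?F" and x0: "?f x = \<zero>\<^bsub>M\<^esub>" for x
  proof (rule ccontr)
    assume "x \<notin> mvec (card T)"
    then obtain i where i: "i < card T" "x i \<notin> max_ideal R"
      using x by (auto simp: mvec_def)
    have xi: "x i \<in> carrier R" using x i by (simp add: free_coeff_closed)
    have unit: "x i \<in> Units R" using unit_if_notin_max_ideal[OF xi i(2)] .
    let ?t = "v i" and ?D = "T - {v i}" and ?a = "\<lambda>t. x (u t)"
    have a: "?a \<in> T \<rightarrow> carrier R" using x vu by (auto simp: free_coeff_closed)
    have t: "?t \<in> T" "?t \<in> carrier M" using vT[OF i(1)] Tc by auto
    have Dc: "?D \<subseteq> carrier M" using Tc by auto
    interpret D: LinearCombinations.submodule R "M.span ?D" M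
      using Dc by (rule M.span_is_submodule)
    let ?w = "M.lincomb ?a ?D"
    have w: "?w \<in> M.span ?D" using a fin unfolding M.span_def by auto
    have wc: "?w \<in> carrier M" using w D.subset by auto
    \<comment> \<open>The relation is split at \<open>?t\<close>. Its coefficient is a unit, so
      \<open>?t\<close> is a combination of the remaining generators, against the minimality of
      \<open>card T\<close>.\<close>
    have "\<zero>\<^bsub>M\<^esub> = x i \<odot>\<^bsub>M\<^esub> ?t \<oplus>\<^bsub>M\<^esub> ?w"
      using M.lincomb_del2[OF fin Tc a t(1)] comb_lincomb[OF x] x0 uv[OF i(1)] by simp
    then have "x i \<odot>\<^bsub>M\<^esub> ?t = \<ominus>\<^bsub>M\<^esub> ?w"
      using xi t wc by (metis M.minus_equality M.add.m_comm M.smult_closed M.minus_minus M.a_inv_closed)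
    then have "inv (x i) \<odot>\<^bsub>M\<^esub> (x i \<odot>\<^bsub>M\<^esub> ?t) = inv (x i) \<odot>\<^bsub>M\<^esub> ((\<ominus> \<one>) \<odot>\<^bsub>M\<^esub> ?w)"
      using wc by (simp add: M.smult_minus_1)
    moreover have "inv (x i) \<odot>\<^bsub>M\<^esub> (x i \<odot>\<^bsub>M\<^esub> ?t) = ?t"
      using unit xi t by (simp add: M.smult_assoc1[symmetric])
    ultimately have "?t = inv (x i) \<odot>\<^bsub>M\<^esub> ((\<ominus> \<one>) \<odot>\<^bsub>M\<^esub> ?w)" by simp
    also have "\<dots> \<in> M.span ?D"
      using w unit by (intro D.smult_closed) auto
    finally have "?t \<in> M.span ?D" .
    then have "T \<subseteq> M.span ?D"
      using M.in_own_span[OF Dc] by auto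
    then have "M.span T \<subseteq> M.span ?D"
      by (rule M.span_is_subset) (rule M.span_is_submodule[OF Dc])
    moreover have "M.span ?D \<subseteq> M.span T" by (rule M.span_is_monotone) auto
    ultimately have "P ?D" using fin Dc span by (auto simp: P_def)
    then have "card T \<le> card ?D" by (rule least)
    moreover have "card ?D < card T" using t fin by (intro psubset_card_mono) auto
    ultimately show False by simp
  qed
  then have "a_kernel ?F M ?f \<subseteq> mvec (card T)" by (auto simp: a_kernel_def')
  with hom image show ?thesis by blast
qed

text \<open>Minimal covers are spliced: each one has its kernel in \<open>\<mm> F\<close>, and this
  kernel is the image of the next differential. It is again finitely generated because
  \<open>R\<close> is Noetherian.\<close>

lemma minimal_free_resolution_exists:
  assumes "fg_module R X"
  shows "\<exists>b d e. minimal_free_resolution R X b d e"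
proof -
  from assms obtain S where X: "module R X" and S: "finite S" "S \<subseteq> carrier X"
      "LinearCombinations.module.span R X S = carrier X"
    unfolding fg_module_def by auto
  obtain b0 e where e: "e \<in> module_hom R (free_module R b0) X"
      "e ` carrier (free_module R b0) = carrier X" "a_kernel (free_module R b0) X e \<subseteq> mvec b0"
    using minimal_cover[OF X S(1,2)] S(3) by metis
  \<comment> \<open>A state is the rank of the current term with the kernel still to be covered.
    That the kernel lies in \<open>\<mm> F\<close> is the minimality of the next
    differential.\<close>
  define sub where "sub s \<longleftrightarrow> LinearCombinations.submodule R (snd s) (free_module R (fst s)) \<and>
    snd s \<subseteq> mvec (fst s)" for s :: "nat \<times> (nat \<Rightarrow> 'a) set"
  define Q where "Q s t \<longleftrightarrow> (\<exists>d\<in>module_hom R (free_module R (fst t)) (free_module R (fst s)).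
    d ` carrier (free_module R (fst t)) = snd s \<and>
    snd t = a_kernel (free_module R (fst t)) (free_module R (fst s)) d)"
    for s t :: "nat \<times> (nat \<Rightarrow> 'a) set"
  have step: "\<exists>t. sub t \<and> Q s t" if s: "sub s" for s
  proof -
    obtain T where T: "finite T" "T \<subseteq> snd s"
        "LinearCombinations.module.span R (free_module R (fst s)) T = snd s"
      using fg_submodule_free[of "snd s" "fst s"] s unfolding sub_def by auto
    have "T \<subseteq> carrier (free_module R (fst s))"
      using T(2) s mvec_closed unfolding sub_def by auto
    from minimal_cover[OF module_free T(1) this]
    obtain c d where d: "d \<in> module_hom R (free_module R c) (free_module R (fst s))"
        "d ` carrier (free_module R c) = snd s"
        "a_kernel (free_module R c) (free_module R (fst s)) d \<subseteq> mvec c"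
      using T(3) by auto
    have "sub (c, a_kernel (free_module R c) (free_module R (fst s)) d)"
      unfolding sub_def using d submodule_kernel[OF module_free module_free d(1)] by simp
    then show ?thesis using d unfolding Q_def by force
  qed
  define s0 where "s0 = (b0, a_kernel (free_module R b0) X e)"
  have "sub s0"
    unfolding sub_def s0_def using e submodule_kernel[OF module_free X e(1)] by simp
  have "\<exists>s. \<forall>n. (sub (s n) \<and> (n = 0 \<longrightarrow> s n = s0)) \<and> Q (s n) (s (Suc n))"
    by (rule dependent_nat_choice) (use \<open>sub s0\<close> step in blast)+
  then obtain s where s: "s 0 = s0" "\<And>n. sub (s n)" "\<And>n. Q (s n) (s (Suc n))"
    by blast
  from s(3) obtain d where d: "\<And>n. d n \<in> module_hom R (free_module R (fst (s (Suc n)))) (free_module R (fst (s n)))"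
      "\<And>n. d n ` carrier (free_module R (fst (s (Suc n)))) = snd (s n)"
      "\<And>n. snd (s (Suc n)) = a_kernel (free_module R (fst (s (Suc n)))) (free_module R (fst (s n))) (d n)"
    unfolding Q_def by metis
  have "minimal_free_resolution R X (\<lambda>n. fst (s n)) d e"
    unfolding minimal_free_resolution_def resolution_def
  proof (intro conjI allI ballI impI)
    fix n x i
    assume x: "x \<in> carrier (free_module R (fst (s (Suc n))))" and i: "i < fst (s n)"
    have "d n x \<in> snd (s n)" using d(2)[of n] x by blast
    then have "d n x \<in> mvec (fst (s n))" using s(2)[of n] unfolding sub_def by blast
    then show "d n x i \<in> max_ideal R" using i by (simp add: mvec_def)
  next
    show "d 0 ` carrier (free_module R (fst (s 1))) = a_kernel (free_module R (fst (s 0))) X e"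
      using d(2)[of 0] by (simp add: s(1) s0_def)
  qed (use e d in \<open>auto simp: s(1) s0_def\<close>)
  then show ?thesis by blast
qed

text \<open>The choice \<open>mfr\<close> records ranks and differentials but no augmentation, so an
  augmentation is recovered existentially.\<close>

lemma mfr_minimal:
  assumes "fg_module R X"
  shows "\<exists>e. minimal_free_resolution R X (fst (mfr R X)) (mfr_diff R X) e"
proof -
  obtain b d e where "minimal_free_resolution R X b d e"
    using minimal_free_resolution_exists[OF assms] by blast
  then have "\<exists>p. case p of (b, d) \<Rightarrow> \<exists>e. minimal_free_resolution R X b d e"
    by (intro exI[of _ "(b, d)"]) auto
  then have "case mfr R X of (b, d) \<Rightarrow> \<exists>e. minimal_free_resolution R X b d e"
    unfolding mfr_def by (rule someI_ex)
  then show ?thesis by (auto simp: mfr_diff_def[abs_def] split: prod.splits)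
qed

end

section \<open>Comparison of resolutions\<close>

context
  fixes R :: "('a, 'r) ring_scheme" and X :: "('a, 'm) module"
    and P :: "nat \<Rightarrow> ('a, 'p) module" and d e
  assumes res: "resolution R X P d e"
begin

lemma resolution_module: "module R (P n)"
  and resolution_aug_hom: "e \<in> module_hom R (P 0) X"
  and resolution_diff_hom: "d n \<in> module_hom R (P (Suc n)) (P n)"
  and resolution_aug_surj: "e ` carrier (P 0) = carrier X"
  and resolution_exact_0: "d 0 ` carrier (P (Suc 0)) = a_kernel (P 0) X e"
  and resolution_exact_Suc: "d (Suc n) ` carrier (P (Suc (Suc n))) = a_kernel (P (Suc n)) (P n) (d n)"
  using res unfolding resolution_def by auto

lemma resolution_aug_diff: "x \<in> carrier (P (Suc 0)) \<Longrightarrow> e (d 0 x) = \<zero>\<^bsub>X\<^esub>"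
  using resolution_exact_0 by (auto simp: a_kernel_def')

lemma resolution_diff_diff: "x \<in> carrier (P (Suc (Suc n))) \<Longrightarrow> d n (d (Suc n) x) = \<zero>\<^bsub>P n\<^esub>"
  using resolution_exact_Suc[of n] by (auto simp: a_kernel_def')

lemma resolution_aug_kernel:
  "x \<in> carrier (P 0) \<Longrightarrow> e x = \<zero>\<^bsub>X\<^esub> \<Longrightarrow> x \<in> d 0 ` carrier (P (Suc 0))"
  unfolding resolution_exact_0 by (simp add: a_kernel_def')

lemma resolution_diff_kernel:
  "x \<in> carrier (P (Suc n)) \<Longrightarrow> d n x = \<zero>\<^bsub>P n\<^esub> \<Longrightarrow> x \<in> d (Suc n) ` carrier (P (Suc (Suc n)))"
  unfolding resolution_exact_Suc by (simp add: a_kernel_def')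

end

context cring
begin

text \<open>Each map lifts because its composite with the differential of \<open>P\<close> lands in
  the image of the next differential of \<open>Q\<close>. \<open>P\<close> is merely a complex over
  \<open>Y\<close>: the lemma is also applied to the terms \<open>P_(i+n)\<close> of a resolution
  over a cocycle, which need not be surjective.\<close>

lemma chain_map_lift:
  fixes P :: "nat \<Rightarrow> ('a, 'p) module" and Q :: "nat \<Rightarrow> ('a, 'q) module" and Y :: "('a, 'y) module"
  assumes proj: "\<And>i. fg_projective R (P i)"
    and dP: "\<And>i. dP i \<in> module_hom R (P (Suc i)) (P i)"
    and ddP: "\<And>i x. x \<in> carrier (P (Suc (Suc i))) \<Longrightarrow> dP i (dP (Suc i) x) = \<zero>\<^bsub>P i\<^esub>"
    and Y: "module R Y" and Q: "resolution R Y Q dQ eQ"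
    and f: "f \<in> module_hom R (P 0) Y"
    and fd: "\<And>x. x \<in> carrier (P (Suc 0)) \<Longrightarrow> f (dP 0 x) = \<zero>\<^bsub>Y\<^esub>"
  obtains \<theta> where "\<And>i. \<theta> i \<in> module_hom R (P i) (Q i)"
    "\<And>x. x \<in> carrier (P 0) \<Longrightarrow> eQ (\<theta> 0 x) = f x"
    "\<And>i x. x \<in> carrier (P (Suc i)) \<Longrightarrow> dQ i (\<theta> (Suc i) x) = \<theta> i (dP i x)"
proof -
  note Qm = resolution_module[OF Q] and dQ = resolution_diff_hom[OF Q]
  have Pm: "module R (P i)" for i using proj[of i] by (simp add: fg_projective_def)
  \<comment> \<open>The middle clause is what the lift in the next degree requires; the clause for
    \<open>i = 0\<close> carries the augmentation through
    \<open>dependent_nat_choice\<close>.\<close>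
  define A where "A i t \<longleftrightarrow> t \<in> module_hom R (P i) (Q i) \<and>
    (\<forall>x\<in>carrier (P (Suc i)). t (dP i x) \<in> dQ i ` carrier (Q (Suc i))) \<and>
    (i = 0 \<longrightarrow> (\<forall>x\<in>carrier (P 0). eQ (t x) = f x))" for i t
  define B where "B i t t' \<longleftrightarrow> (\<forall>x\<in>carrier (P (Suc i)). dQ i (t' x) = t (dP i x))" for i t t'
  have "\<exists>t. A 0 t"
  proof -
    obtain t where t: "t \<in> module_hom R (P 0) (Q 0)" "\<And>x. x \<in> carrier (P 0) \<Longrightarrow> eQ (t x) = f x"
      by (rule projective_lift[OF proj[of 0] Y Qm[of 0] f resolution_aug_hom[OF Q]])
        (simp_all add: resolution_aug_surj[OF Q] hom_closed[OF f])
    have "t (dP 0 x) \<in> dQ 0 ` carrier (Q (Suc 0))" if x: "x \<in> carrier (P (Suc 0))" for x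
      by (rule resolution_aug_kernel[OF Q])
        (simp_all add: t(2) fd x hom_closed[OF t(1)] hom_closed[OF dP[of 0]])
    with t show ?thesis unfolding A_def by auto
  qed
  moreover have "\<exists>t'. A (Suc i) t' \<and> B i t t'" if A: "A i t" for i t
  proof -
    have t: "t \<in> module_hom R (P i) (Q i)"
        "\<And>x. x \<in> carrier (P (Suc i)) \<Longrightarrow> t (dP i x) \<in> dQ i ` carrier (Q (Suc i))"
      using A unfolding A_def by auto
    obtain t' where t': "t' \<in> module_hom R (P (Suc i)) (Q (Suc i))"
        "\<And>x. x \<in> carrier (P (Suc i)) \<Longrightarrow> dQ i (t' x) = t (dP i x)"
      by (rule projective_lift[OF proj[of "Suc i"] Qm[of i] Qm[of "Suc i"] hom_comp[OF dP[of i] t(1)] dQ[of i] t(2)]) (assumption | rule that)+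
    have "t' (dP (Suc i) x) \<in> dQ (Suc i) ` carrier (Q (Suc (Suc i)))"
      if x: "x \<in> carrier (P (Suc (Suc i)))" for x
    proof (rule resolution_diff_kernel[OF Q])
      have "t (dP i (dP (Suc i) x)) = \<zero>\<^bsub>Q i\<^esub>"
        unfolding ddP[OF x] by (rule hom_zero[OF Pm Qm t(1)])
      then show "dQ i (t' (dP (Suc i) x)) = \<zero>\<^bsub>Q i\<^esub>"
        using t'(2)[OF hom_closed[OF dP x]] by simp
    qed (rule hom_closed[OF t'(1) hom_closed[OF dP x]])
    with t' show ?thesis unfolding A_def B_def by auto
  qed
  ultimately have "\<exists>\<theta>. \<forall>i. A i (\<theta> i) \<and> B i (\<theta> i) (\<theta> (Suc i))"
    by (rule dependent_nat_choice)
  then obtain \<theta> where \<theta>: "\<And>i. A i (\<theta> i)" "\<And>i. B i (\<theta> i) (\<theta> (Suc i))" by metis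
  show thesis
  proof (rule that[of \<theta>])
    show "\<theta> i \<in> module_hom R (P i) (Q i)" for i using \<theta>(1)[of i] unfolding A_def by simp
    show "eQ (\<theta> 0 x) = f x" if "x \<in> carrier (P 0)" for x
      using \<theta>(1)[of 0] that unfolding A_def by simp
    show "dQ i (\<theta> (Suc i) x) = \<theta> i (dP i x)" if "x \<in> carrier (P (Suc i))" for i x
      using \<theta>(2)[of i] that unfolding B_def by simp
  qed
qed

text \<open>Once \<open>s i\<close> is known, \<open>\<theta> (Suc i) - s i d\<close> is a cycle,
  and exactness of \<open>Q\<close> makes it a boundary. The source may be a shifted complex, as for
  the powers of a chain map of positive degree.\<close>

lemma null_homotopy:
  fixes P :: "nat \<Rightarrow> ('a, 'p) module" and Q :: "nat \<Rightarrow> ('a, 'q) module" and Y :: "('a, 'y) module"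
  assumes proj: "\<And>i. fg_projective R (P i)"
    and dP: "\<And>i. dP i \<in> module_hom R (P (Suc i)) (P i)"
    and ddP: "\<And>i x. x \<in> carrier (P (Suc (Suc i))) \<Longrightarrow> dP i (dP (Suc i) x) = \<zero>\<^bsub>P i\<^esub>"
    and Q: "resolution R Y Q dQ eQ"
    and \<theta>: "\<And>i. \<theta> i \<in> module_hom R (P i) (Q i)"
    and \<theta>0: "\<And>x. x \<in> carrier (P 0) \<Longrightarrow> eQ (\<theta> 0 x) = \<zero>\<^bsub>Y\<^esub>"
    and \<theta>d: "\<And>i x. x \<in> carrier (P (Suc i)) \<Longrightarrow> dQ i (\<theta> (Suc i) x) = \<theta> i (dP i x)"
  obtains s where "\<And>i. s i \<in> module_hom R (P i) (Q (Suc i))"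
    "\<And>x. x \<in> carrier (P 0) \<Longrightarrow> \<theta> 0 x = dQ 0 (s 0 x)"
    "\<And>i x. x \<in> carrier (P (Suc i)) \<Longrightarrow> \<theta> (Suc i) x = dQ (Suc i) (s (Suc i) x) \<oplus>\<^bsub>Q (Suc i)\<^esub> s i (dP i x)"
proof -
  note Qm = resolution_module[OF Q] and dQ = resolution_diff_hom[OF Q]
  have Pm: "module R (P i)" for i using proj[of i] by (simp add: fg_projective_def)
  \<comment> \<open>The invariant \<open>d t d = \<theta> d\<close> is what makes
    \<open>\<theta> (Suc i) - t d\<close> a cycle.\<close>
  define A where "A i t \<longleftrightarrow> t \<in> module_hom R (P i) (Q (Suc i)) \<and>
    (\<forall>x\<in>carrier (P (Suc i)). dQ i (t (dP i x)) = \<theta> i (dP i x)) \<and>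
    (i = 0 \<longrightarrow> (\<forall>x\<in>carrier (P 0). \<theta> 0 x = dQ 0 (t x)))" for i t
  define B where "B i t t' \<longleftrightarrow> (\<forall>x\<in>carrier (P (Suc i)).
    \<theta> (Suc i) x = dQ (Suc i) (t' x) \<oplus>\<^bsub>Q (Suc i)\<^esub> t (dP i x))" for i t t'
  have "\<exists>t. A 0 t"
  proof -
    obtain t where "t \<in> module_hom R (P 0) (Q (Suc 0))"
        "\<And>x. x \<in> carrier (P 0) \<Longrightarrow> dQ 0 (t x) = \<theta> 0 x"
      by (rule projective_lift[OF proj[of 0] Qm[of 0] Qm[of "Suc 0"] \<theta>[of 0] dQ[of 0]])
        (auto intro!: resolution_aug_kernel[OF Q] hom_closed[OF \<theta>] \<theta>0)
    then show ?thesis unfolding A_def by (auto simp: hom_closed[OF dP[of 0]])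
  qed
  moreover have "\<exists>t'. A (Suc i) t' \<and> B i t t'" if A: "A i t" for i t
  proof -
    have t: "t \<in> module_hom R (P i) (Q (Suc i))"
        "\<And>x. x \<in> carrier (P (Suc i)) \<Longrightarrow> dQ i (t (dP i x)) = \<theta> i (dP i x)"
      using A unfolding A_def by auto
    interpret Qi: Module.module R "Q i" by (rule Qm)
    interpret QS: Module.module R "Q (Suc i)" by (rule Qm)
    let ?g = "\<lambda>x. \<theta> (Suc i) x \<ominus>\<^bsub>Q (Suc i)\<^esub> t (dP i x)"
    have g: "?g \<in> module_hom R (P (Suc i)) (Q (Suc i))"
      by (rule hom_diff[OF Qm \<theta> hom_comp[OF dP t(1)]])
    have sub: "?g x \<in> dQ (Suc i) ` carrier (Q (Suc (Suc i)))" if x: "x \<in> carrier (P (Suc i))" for x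
    proof (rule resolution_diff_kernel[OF Q hom_closed[OF g x]])
      show "dQ i (?g x) = \<zero>\<^bsub>Q i\<^esub>"
        using x hom_closed[OF \<theta> x] hom_closed[OF t(1) hom_closed[OF dP x]]
        by (simp add: hom_minus[OF Qm Qm dQ] \<theta>d t(2))
          (simp add: a_minus_def Qi.r_neg hom_closed[OF \<theta>] hom_closed[OF dP])
    qed
    obtain t' where t': "t' \<in> module_hom R (P (Suc i)) (Q (Suc (Suc i)))"
        "\<And>x. x \<in> carrier (P (Suc i)) \<Longrightarrow> dQ (Suc i) (t' x) = ?g x"
      by (rule projective_lift[OF proj[of "Suc i"] Qm[of "Suc i"] Qm[of "Suc (Suc i)"] g dQ[of "Suc i"] sub]) (assumption | rule that)+
    have "\<theta> (Suc i) x = dQ (Suc i) (t' x) \<oplus>\<^bsub>Q (Suc i)\<^esub> t (dP i x)" if x: "x \<in> carrier (P (Suc i))" for x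
      using hom_closed[OF \<theta> x] hom_closed[OF t(1) hom_closed[OF dP x]]
      by (simp add: t'(2)[OF x] a_minus_def QS.a_assoc QS.l_neg)
    moreover have "dQ (Suc i) (t' (dP (Suc i) x)) = \<theta> (Suc i) (dP (Suc i) x)"
      if x: "x \<in> carrier (P (Suc (Suc i)))" for x
      using t'(2)[OF hom_closed[OF dP x]] hom_closed[OF \<theta> hom_closed[OF dP x]]
      by (simp add: ddP[OF x] hom_zero[OF Pm Qm t(1)] a_minus_def)
    ultimately show ?thesis using t'(1) unfolding A_def B_def by auto
  qed
  ultimately have "\<exists>s. \<forall>i. A i (s i) \<and> B i (s i) (s (Suc i))"
    by (rule dependent_nat_choice)
  then obtain s where s: "\<And>i. A i (s i)" "\<And>i. B i (s i) (s (Suc i))" by metis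
  show thesis
  proof (rule that[of s])
    show "s i \<in> module_hom R (P i) (Q (Suc i))" for i using s(1)[of i] unfolding A_def by simp
    show "\<theta> 0 x = dQ 0 (s 0 x)" if "x \<in> carrier (P 0)" for x
      using s(1)[of 0] that unfolding A_def by simp
    show "\<theta> (Suc i) x = dQ (Suc i) (s (Suc i) x) \<oplus>\<^bsub>Q (Suc i)\<^esub> s i (dP i x)"
      if "x \<in> carrier (P (Suc i))" for i x
      using s(2)[of i] that unfolding B_def by simp
  qed
qed

text \<open>\<open>null_homotopy\<close> is applied to \<open>id - \<psi> \<phi>\<close>, a chain
  map over the zero map of \<open>Y\<close>. The identity of \<open>P i\<close> is written as a sum
  because, for a minimal free \<open>P\<close>, the homotopy terms lie in \<open>\<mm> P\<close>:
  modulo \<open>\<mm>\<close> everything factors through \<open>Q\<close>.\<close>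

lemma comparison_homotopy:
  fixes P :: "nat \<Rightarrow> ('a, 'p) module" and Q :: "nat \<Rightarrow> ('a, 'q) module" and Y :: "('a, 'y) module"
  assumes Y: "module R Y"
    and P: "resolution R Y P dP eP" and projP: "\<And>i. fg_projective R (P i)"
    and Q: "resolution R Y Q dQ eQ" and projQ: "\<And>i. fg_projective R (Q i)"
  obtains \<phi> \<psi> s where "\<And>i. \<phi> i \<in> module_hom R (P i) (Q i)" "\<And>i. \<psi> i \<in> module_hom R (Q i) (P i)"
    "\<And>i x. x \<in> carrier (P (Suc i)) \<Longrightarrow> dQ i (\<phi> (Suc i) x) = \<phi> i (dP i x)"
    "\<And>i x. x \<in> carrier (Q (Suc i)) \<Longrightarrow> dP i (\<psi> (Suc i) x) = \<psi> i (dQ i x)"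
    "\<And>i. s i \<in> module_hom R (P i) (P (Suc i))"
    "\<And>x. x \<in> carrier (P 0) \<Longrightarrow> x = \<psi> 0 (\<phi> 0 x) \<oplus>\<^bsub>P 0\<^esub> dP 0 (s 0 x)"
    "\<And>i x. x \<in> carrier (P (Suc i)) \<Longrightarrow> x = \<psi> (Suc i) (\<phi> (Suc i) x) \<oplus>\<^bsub>P (Suc i)\<^esub>
       (dP (Suc i) (s (Suc i) x) \<oplus>\<^bsub>P (Suc i)\<^esub> s i (dP i x))"
proof -
  note Pm = resolution_module[OF P] and dP = resolution_diff_hom[OF P]
  note Qm = resolution_module[OF Q] and dQ = resolution_diff_hom[OF Q]
  obtain \<phi> where \<phi>: "\<And>i. \<phi> i \<in> module_hom R (P i) (Q i)"
      "\<And>x. x \<in> carrier (P 0) \<Longrightarrow> eQ (\<phi> 0 x) = eP x"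
      "\<And>i x. x \<in> carrier (P (Suc i)) \<Longrightarrow> dQ i (\<phi> (Suc i) x) = \<phi> i (dP i x)"
    by (rule chain_map_lift[where P = P and dP = dP, OF projP dP resolution_diff_diff[OF P] Y Q
          resolution_aug_hom[OF P] resolution_aug_diff[OF P]]) (assumption | rule that)+
  obtain \<psi> where \<psi>: "\<And>i. \<psi> i \<in> module_hom R (Q i) (P i)"
      "\<And>x. x \<in> carrier (Q 0) \<Longrightarrow> eP (\<psi> 0 x) = eQ x"
      "\<And>i x. x \<in> carrier (Q (Suc i)) \<Longrightarrow> dP i (\<psi> (Suc i) x) = \<psi> i (dQ i x)"
    by (rule chain_map_lift[where P = Q and dP = dQ, OF projQ dQ resolution_diff_diff[OF Q] Y P
          resolution_aug_hom[OF Q] resolution_aug_diff[OF Q]]) (assumption | rule that)+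
  let ?g = "\<lambda>i x. x \<ominus>\<^bsub>P i\<^esub> \<psi> i (\<phi> i x)"
  have g: "?g i \<in> module_hom R (P i) (P i)" for i
    by (rule hom_diff[OF Pm hom_id hom_comp[OF \<phi>(1) \<psi>(1)]])
  interpret Y: Module.module R Y by (rule Y)
  have c: "\<psi> i (\<phi> i x) \<in> carrier (P i)" if "x \<in> carrier (P i)" for i x
    by (rule hom_closed[OF \<psi>(1) hom_closed[OF \<phi>(1) that]])
  have g0: "eP (?g 0 x) = \<zero>\<^bsub>Y\<^esub>" if x: "x \<in> carrier (P 0)" for x
    using x c[OF x] hom_closed[OF resolution_aug_hom[OF P] x]
    by (simp add: hom_minus[OF Pm Y resolution_aug_hom[OF P]] \<phi>(2) \<psi>(2) hom_closed[OF \<phi>(1)])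
  have gd: "dP i (?g (Suc i) x) = ?g i (dP i x)" if x: "x \<in> carrier (P (Suc i))" for i x
    using x c[OF x] by (simp add: hom_minus[OF Pm Pm dP] \<phi>(3) \<psi>(3) hom_closed[OF \<phi>(1)])
  obtain s where s: "\<And>i. s i \<in> module_hom R (P i) (P (Suc i))"
      "\<And>x. x \<in> carrier (P 0) \<Longrightarrow> ?g 0 x = dP 0 (s 0 x)"
      "\<And>i x. x \<in> carrier (P (Suc i)) \<Longrightarrow> ?g (Suc i) x = dP (Suc i) (s (Suc i) x) \<oplus>\<^bsub>P (Suc i)\<^esub> s i (dP i x)"
    by (rule null_homotopy[where P = P and dP = dP and \<theta> = ?g, OF projP dP resolution_diff_diff[OF P] P g g0 gd]) (assumption | rule that)+
  have recover: "x = \<psi> i (\<phi> i x) \<oplus>\<^bsub>P i\<^esub> ?g i x" if x: "x \<in> carrier (P i)" for i x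
  proof -
    interpret Pi: Module.module R "P i" by (rule Pm)
    show ?thesis using x c[OF x] by (simp add: a_minus_def Pi.a_lcomm Pi.r_neg)
  qed
  show thesis
  proof (rule that[of \<phi> \<psi> s, OF \<phi>(1) \<psi>(1) \<phi>(3) \<psi>(3) s(1)])
    show "x = \<psi> 0 (\<phi> 0 x) \<oplus>\<^bsub>P 0\<^esub> dP 0 (s 0 x)" if x: "x \<in> carrier (P 0)" for x
      using recover[OF x] unfolding s(2)[OF x] .
    show "x = \<psi> (Suc i) (\<phi> (Suc i) x) \<oplus>\<^bsub>P (Suc i)\<^esub>
       (dP (Suc i) (s (Suc i) x) \<oplus>\<^bsub>P (Suc i)\<^esub> s i (dP i x))" if x: "x \<in> carrier (P (Suc i))" for i x
      using recover[OF x] unfolding s(3)[OF x] .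
  qed
qed

end

section \<open>Quotient modules\<close>

text \<open>The module axioms pass to the image of a surjection that respects the operations; for
  cosets this avoids any computation with sets.\<close>

lemma module_image:
  assumes M: "module R M"
    and Q: "carrier Q = p ` carrier M"
    and add: "\<And>x y. \<lbrakk>x \<in> carrier M; y \<in> carrier M\<rbrakk> \<Longrightarrow> p x \<oplus>\<^bsub>Q\<^esub> p y = p (x \<oplus>\<^bsub>M\<^esub> y)"
    and smult: "\<And>a x. \<lbrakk>a \<in> carrier R; x \<in> carrier M\<rbrakk> \<Longrightarrow> a \<odot>\<^bsub>Q\<^esub> p x = p (a \<odot>\<^bsub>M\<^esub> x)"
    and zero: "\<zero>\<^bsub>Q\<^esub> = p \<zero>\<^bsub>M\<^esub>"
  shows "module R Q"
proof -
  interpret M: Module.module R M by fact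
  have neg: "\<exists>w\<in>carrier M. p (x \<oplus>\<^bsub>M\<^esub> w) = p \<zero>\<^bsub>M\<^esub>" if "x \<in> carrier M" for x
    using that by (intro bexI[of _ "\<ominus>\<^bsub>M\<^esub> x"]) (simp_all add: M.r_neg)
  show ?thesis
    by (rule module_criteria)
      (auto simp: Q add smult zero M.is_cring M.smult_l_distr M.smult_r_distr M.smult_assoc1
        M.a_ac neg)
qed

context
  fixes R :: "('a, 'r) ring_scheme" and M :: "('a, 'm) module" and N
  assumes sub: "LinearCombinations.submodule R N M"
begin

interpretation N: LinearCombinations.submodule R N M
  by (rule sub)

interpretation M: Module.module R M
  by (rule N.module)

text \<open>Negatives come from the scalar \<open>\<ominus> \<one>\<close>. This opens the coset
  calculus of abelian groups to submodules.\<close>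

lemma abelian_subgroup_submodule: "abelian_subgroup N M"
proof (rule abelian_subgroupI3)
  have "\<ominus>\<^bsub>M\<^esub> x \<in> N" if x: "x \<in> N" for x
    using N.smult_closed[OF _ x, of "\<ominus>\<^bsub>R\<^esub> \<one>\<^bsub>R\<^esub>"]
    by (simp add: M.smult_minus_1 subsetD[OF N.subset x])
  then show "additive_subgroup N M"
    using N.subset by unfold_locales (auto simp: a_inv_def[symmetric])
  show "abelian_group M" by (rule M.abelian_group_axioms)
qed

interpretation S: abelian_subgroup N M
  by (rule abelian_subgroup_submodule)

lemma carrier_quot_module: "carrier (quot_module M N) = (\<lambda>x. N +>\<^bsub>M\<^esub> x) ` carrier M"
  by (auto simp: quot_module_def A_RCOSETS_def' a_r_coset_def')

lemma coset_in_quot [intro]: "x \<in> carrier M \<Longrightarrow> N +>\<^bsub>M\<^esub> x \<in> carrier (quot_module M N)"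
  by (simp add: carrier_quot_module)

lemma coset_self: "x \<in> carrier M \<Longrightarrow> x \<in> N +>\<^bsub>M\<^esub> x"
  by (rule S.a_rcos_self)

lemma in_coset_iff:
  assumes "x \<in> carrier M"
  shows "y \<in> N +>\<^bsub>M\<^esub> x \<longleftrightarrow> y \<in> carrier M \<and> y \<ominus>\<^bsub>M\<^esub> x \<in> N"
proof
  assume "y \<in> N +>\<^bsub>M\<^esub> x"
  then obtain h where "h \<in> N" "y = h \<oplus>\<^bsub>M\<^esub> x" by (auto simp: a_r_coset_def')
  then show "y \<in> carrier M \<and> y \<ominus>\<^bsub>M\<^esub> x \<in> N"
    using assms N.subset by (auto simp: a_minus_def M.a_assoc M.r_neg subset_iff)
next
  assume y: "y \<in> carrier M \<and> y \<ominus>\<^bsub>M\<^esub> x \<in> N"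
  then have "y = (y \<ominus>\<^bsub>M\<^esub> x) \<oplus>\<^bsub>M\<^esub> x"
    using assms by (simp add: a_minus_def M.a_assoc M.l_neg)
  with y show "y \<in> N +>\<^bsub>M\<^esub> x" by (auto simp: a_r_coset_def')
qed

lemma coset_eq_iff:
  assumes "x \<in> carrier M" "y \<in> carrier M"
  shows "N +>\<^bsub>M\<^esub> x = N +>\<^bsub>M\<^esub> y \<longleftrightarrow> x \<ominus>\<^bsub>M\<^esub> y \<in> N"
proof
  assume "N +>\<^bsub>M\<^esub> x = N +>\<^bsub>M\<^esub> y"
  then show "x \<ominus>\<^bsub>M\<^esub> y \<in> N"
    using coset_self[OF assms(1)] in_coset_iff[OF assms(2)] by simp
next
  assume "x \<ominus>\<^bsub>M\<^esub> y \<in> N"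
  then have "x \<in> N +>\<^bsub>M\<^esub> y" using assms by (simp add: in_coset_iff)
  then show "N +>\<^bsub>M\<^esub> x = N +>\<^bsub>M\<^esub> y"
    using M.a_repr_independence[OF _ assms(2) S.a_subgroup] by simp
qed

lemma coset_zero: "N +>\<^bsub>M\<^esub> \<zero>\<^bsub>M\<^esub> = N"
  by (rule M.a_coset_add_zero[OF N.subset])

lemma coset_eq_self_iff: "x \<in> carrier M \<Longrightarrow> N +>\<^bsub>M\<^esub> x = N \<longleftrightarrow> x \<in> N"
  using coset_eq_iff[of x "\<zero>\<^bsub>M\<^esub>"] by (simp add: coset_zero a_minus_def minus_zero_eq[OF N.module])

lemma quot_zero: "\<zero>\<^bsub>quot_module M N\<^esub> = N"
  by (simp add: quot_module_def)

lemma quot_add: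
  "\<lbrakk>x \<in> carrier M; y \<in> carrier M\<rbrakk> \<Longrightarrow>
    (N +>\<^bsub>M\<^esub> x) \<oplus>\<^bsub>quot_module M N\<^esub> (N +>\<^bsub>M\<^esub> y) = N +>\<^bsub>M\<^esub> (x \<oplus>\<^bsub>M\<^esub> y)"
  by (simp add: quot_module_def S.a_rcos_sum)

text \<open>The union in \<open>quot_module\<close> runs over all representatives. Each contributes
  the same coset, and there is at least one.\<close>

lemma quot_smult:
  assumes "a \<in> carrier R" "x \<in> carrier M"
  shows "a \<odot>\<^bsub>quot_module M N\<^esub> (N +>\<^bsub>M\<^esub> x) = N +>\<^bsub>M\<^esub> (a \<odot>\<^bsub>M\<^esub> x)"
proof -
  have eq: "N +>\<^bsub>M\<^esub> (a \<odot>\<^bsub>M\<^esub> y) = N +>\<^bsub>M\<^esub> (a \<odot>\<^bsub>M\<^esub> x)" if y: "y \<in> N +>\<^bsub>M\<^esub> x" for y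
  proof -
    from y assms(2) have *: "y \<in> carrier M" "y \<ominus>\<^bsub>M\<^esub> x \<in> N" by (auto simp: in_coset_iff)
    have "a \<odot>\<^bsub>M\<^esub> y \<ominus>\<^bsub>M\<^esub> a \<odot>\<^bsub>M\<^esub> x = a \<odot>\<^bsub>M\<^esub> (y \<ominus>\<^bsub>M\<^esub> x)"
      using assms * by (simp add: a_minus_def M.smult_r_distr M.smult_r_minus)
    also have "\<dots> \<in> N" using assms(1) *(2) by simp
    finally show ?thesis using assms * by (simp add: coset_eq_iff)
  qed
  have "N +>\<^bsub>M\<^esub> x \<noteq> {}" using coset_self[OF assms(2)] by (metis empty_iff)
  then have "(\<Union>y\<in>N +>\<^bsub>M\<^esub> x. N +>\<^bsub>M\<^esub> (a \<odot>\<^bsub>M\<^esub> y)) = N +>\<^bsub>M\<^esub> (a \<odot>\<^bsub>M\<^esub> x)"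
    by (rule SUP_eq_const[OF _ eq])
  then show ?thesis by (simp add: quot_module_def)
qed

lemma module_quot: "module R (quot_module M N)"
proof (rule module_image[OF M.module_axioms carrier_quot_module quot_add quot_smult])
  show "\<zero>\<^bsub>quot_module M N\<^esub> = N +>\<^bsub>M\<^esub> \<zero>\<^bsub>M\<^esub>"
    by (simp add: quot_zero coset_zero)
qed

lemma proj_hom: "(\<lambda>x. N +>\<^bsub>M\<^esub> x) \<in> module_hom R M (quot_module M N)"
  by (rule module_homI) (auto simp: quot_add quot_smult)

lemma zero_module_quot_iff: "zero_module (quot_module M N) \<longleftrightarrow> carrier M \<subseteq> N"
proof -
  have "carrier (quot_module M N) = {N} \<longleftrightarrow> (\<forall>x\<in>carrier M. N +>\<^bsub>M\<^esub> x = N)"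
    using coset_zero by (auto simp: carrier_quot_module)
  then show ?thesis
    by (auto simp: zero_module_def quot_zero coset_eq_self_iff)
qed

text \<open>Here \<open>the_elem\<close> picks the common value of \<open>f\<close> on a coset.\<close>

lemma
  assumes L: "module R L" and f: "f \<in> module_hom R M L"
    and f0: "\<And>x. x \<in> N \<Longrightarrow> f x = \<zero>\<^bsub>L\<^esub>"
  shows quot_lift_coset: "x \<in> carrier M \<Longrightarrow> the_elem (f ` (N +>\<^bsub>M\<^esub> x)) = f x"
    and quot_lift_hom: "(\<lambda>C. the_elem (f ` C)) \<in> module_hom R (quot_module M N) L"
proof -
  interpret L: Module.module R L by (rule L)
  show *: "the_elem (f ` (N +>\<^bsub>M\<^esub> x)) = f x" if x: "x \<in> carrier M" for x
  proof -
    have const: "f y = f x" if "y \<in> N +>\<^bsub>M\<^esub> x" for y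
    proof -
      from that x have y: "y \<in> carrier M" "y \<ominus>\<^bsub>M\<^esub> x \<in> N" by (auto simp: in_coset_iff)
      then have "f y \<ominus>\<^bsub>L\<^esub> f x = \<zero>\<^bsub>L\<^esub>"
        using f0[OF y(2)] hom_minus[OF M.module_axioms L f y(1) x] by simp
      then show ?thesis
        using hom_closed[OF f y(1)] hom_closed[OF f x] by simp
    qed
    have "f ` (N +>\<^bsub>M\<^esub> x) = {f x}"
    proof (intro equalityI subsetI)
      fix z assume "z \<in> f ` (N +>\<^bsub>M\<^esub> x)"
      then obtain y where "z = f y" "y \<in> N +>\<^bsub>M\<^esub> x" by (rule imageE)
      then show "z \<in> {f x}" by (simp add: const)
    next
      fix z assume "z \<in> {f x}"
      then show "z \<in> f ` (N +>\<^bsub>M\<^esub> x)" using imageI[OF coset_self[OF x]] by simp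
    qed
    then show ?thesis by simp
  qed
  show "(\<lambda>C. the_elem (f ` C)) \<in> module_hom R (quot_module M N) L"
  proof (rule module_homI; unfold carrier_quot_module; elim imageE; hypsubst)
    fix x assume x: "x \<in> carrier M"
    show "the_elem (f ` (N +>\<^bsub>M\<^esub> x)) \<in> carrier L"
      by (simp add: * x hom_closed[OF f])
    show "the_elem (f ` (a \<odot>\<^bsub>quot_module M N\<^esub> (N +>\<^bsub>M\<^esub> x)))
        = a \<odot>\<^bsub>L\<^esub> the_elem (f ` (N +>\<^bsub>M\<^esub> x))" if "a \<in> carrier R" for a
      by (simp add: * x that quot_smult hom_smult[OF f])
    fix y assume y: "y \<in> carrier M"
    show "the_elem (f ` ((N +>\<^bsub>M\<^esub> x) \<oplus>\<^bsub>quot_module M N\<^esub> (N +>\<^bsub>M\<^esub> y)))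
        = the_elem (f ` (N +>\<^bsub>M\<^esub> x)) \<oplus>\<^bsub>L\<^esub> the_elem (f ` (N +>\<^bsub>M\<^esub> y))"
      by (simp add: * x y quot_add hom_add[OF f])
  qed
qed

end

section \<open>Vanishing of Ext\<close>

lemma module_Hom:
  assumes P: "module R P" and Y: "module R Y"
  shows "module R (Hom_module R P Y)"
proof -
  interpret P: Module.module R P by fact
  interpret Y: Module.module R Y by fact
  note homc = hom_closed[of _ R P Y]
  have ext: "f = g" if "f \<in> extensional (carrier P)" "g \<in> extensional (carrier P)"
    "\<And>x. x \<in> carrier P \<Longrightarrow> f x = g x" for f g
    using that by (rule extensionalityI)
  have restr: "(\<lambda>x\<in>carrier P. f x) \<in> module_hom R P Y \<inter> extensional (carrier P)"
    if "f \<in> module_hom R P Y" for f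
    using that hom_cong[OF P that, of "\<lambda>x\<in>carrier P. f x"] by simp
  have smult_hom: "(\<lambda>x. a \<odot>\<^bsub>Y\<^esub> f x) \<in> module_hom R P Y"
    if "f \<in> module_hom R P Y" "a \<in> carrier R" for f a
    using that
    by (intro module_homI)
      (simp_all add: homc hom_add hom_smult Y.smult_r_distr Y.smult_assoc1[symmetric] P.R.m_comm)
  have neg: "\<exists>w\<in>module_hom R P Y \<inter> extensional (carrier P).
      (\<lambda>x\<in>carrier P. f x \<oplus>\<^bsub>Y\<^esub> w x) = (\<lambda>x\<in>carrier P. \<zero>\<^bsub>Y\<^esub>)" if f: "f \<in> module_hom R P Y" for f
    by (rule bexI[OF _ restr[OF hom_neg[OF Y f]]])
      (rule restrict_ext, simp add: homc[OF f] Y.r_neg)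
  show ?thesis
    unfolding Hom_module_def
    by (rule module_criteria)
      (auto simp: P.R.is_cring restr[simplified] hom_const_zero[OF Y] hom_plus[OF Y] smult_hom homc
        Y.smult_l_distr Y.smult_r_distr Y.smult_assoc1 Y.a_ac Y.r_neg
        neg[simplified] intro!: ext)
qed

text \<open>Vanishing of the \<open>n\<close>-th cohomology of \<open>Hom(P, Y)\<close>, with
  ordinary maps compared on carriers instead of extensional ones. Unlike \<open>Ext\<close> it
  refers to an arbitrary complex \<open>P\<close>, so vanishing can be moved between resolutions. In
  degree \<open>0\<close> there are no coboundaries except zero.\<close>

definition ext_vanishes ::
    "('a, 'r) ring_scheme \<Rightarrow> (nat \<Rightarrow> ('a, 'p) module) \<Rightarrow> (nat \<Rightarrow> 'p \<Rightarrow> 'p) \<Rightarrow> nat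
      \<Rightarrow> ('a, 'y) module \<Rightarrow> bool" where
  "ext_vanishes R P d n Y \<longleftrightarrow>
     (\<forall>f\<in>module_hom R (P n) Y. (\<forall>x\<in>carrier (P (Suc n)). f (d n x) = \<zero>\<^bsub>Y\<^esub>) \<longrightarrow>
        (case n of 0 \<Rightarrow> \<forall>x\<in>carrier (P 0). f x = \<zero>\<^bsub>Y\<^esub>
         | Suc m \<Rightarrow> \<exists>g\<in>module_hom R (P m) Y. \<forall>x\<in>carrier (P n). f x = g (d m x)))"

text \<open>The homotopy gives \<open>f = f \<psi> \<phi> + f d s + f s d\<close>. The middle term
  is zero for a cocycle \<open>f\<close>, and \<open>f \<psi>\<close> is a cocycle on
  \<open>Q\<close>, hence zero in degree \<open>0\<close> and of the form \<open>g d\<close> in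
  positive degree.\<close>

lemma (in cring) ext_vanishes_independent:
  fixes P :: "nat \<Rightarrow> ('a, 'p) module" and Q :: "nat \<Rightarrow> ('a, 'q) module"
    and X :: "('a, 'x) module" and Y :: "('a, 'y) module"
  assumes X: "module R X" and Y: "module R Y"
    and P: "resolution R X P dP eP" and projP: "\<And>i. fg_projective R (P i)"
    and Q: "resolution R X Q dQ eQ" and projQ: "\<And>i. fg_projective R (Q i)"
    and van: "ext_vanishes R Q dQ n Y"
  shows "ext_vanishes R P dP n Y"
  unfolding ext_vanishes_def
proof (intro ballI impI)
  interpret Y: Module.module R Y by fact
  note Pm = resolution_module[OF P] and dP = resolution_diff_hom[OF P]
  note Qm = resolution_module[OF Q] and dQ = resolution_diff_hom[OF Q]
  obtain \<phi> \<psi> s where \<phi>: "\<And>i. \<phi> i \<in> module_hom R (P i) (Q i)"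
    and \<psi>: "\<And>i. \<psi> i \<in> module_hom R (Q i) (P i)"
    and d\<phi>: "\<And>i x. x \<in> carrier (P (Suc i)) \<Longrightarrow> dQ i (\<phi> (Suc i) x) = \<phi> i (dP i x)"
    and d\<psi>: "\<And>i x. x \<in> carrier (Q (Suc i)) \<Longrightarrow> dP i (\<psi> (Suc i) x) = \<psi> i (dQ i x)"
    and s: "\<And>i. s i \<in> module_hom R (P i) (P (Suc i))"
    and h0: "\<And>x. x \<in> carrier (P 0) \<Longrightarrow> x = \<psi> 0 (\<phi> 0 x) \<oplus>\<^bsub>P 0\<^esub> dP 0 (s 0 x)"
    and hS: "\<And>i x. x \<in> carrier (P (Suc i)) \<Longrightarrow> x = \<psi> (Suc i) (\<phi> (Suc i) x) \<oplus>\<^bsub>P (Suc i)\<^esub>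
       (dP (Suc i) (s (Suc i) x) \<oplus>\<^bsub>P (Suc i)\<^esub> s i (dP i x))"
    by (rule comparison_homotopy[OF X P projP Q projQ]) (assumption | rule that)+
  have \<phi>c: "\<phi> i x \<in> carrier (Q i)" if "x \<in> carrier (P i)" for i x
    using hom_closed[OF \<phi> that] .
  have \<psi>c: "\<psi> i x \<in> carrier (P i)" if "x \<in> carrier (Q i)" for i x
    using hom_closed[OF \<psi> that] .
  have sc: "s i x \<in> carrier (P (Suc i))" if "x \<in> carrier (P i)" for i x
    using hom_closed[OF s that] .
  have dPc: "dP i x \<in> carrier (P i)" if "x \<in> carrier (P (Suc i))" for i x
    using hom_closed[OF dP that] .
  have dQc: "dQ i x \<in> carrier (Q i)" if "x \<in> carrier (Q (Suc i))" for i x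
    using hom_closed[OF dQ that] .
  fix f assume f: "f \<in> module_hom R (P n) Y" and fd: "\<forall>x\<in>carrier (P (Suc n)). f (dP n x) = \<zero>\<^bsub>Y\<^esub>"
  note fc = hom_closed[OF f]
  let ?f = "\<lambda>x. f (\<psi> n x)"
  have f': "?f \<in> module_hom R (Q n) Y" by (rule hom_comp[OF \<psi> f])
  have fd': "\<forall>x\<in>carrier (Q (Suc n)). ?f (dQ n x) = \<zero>\<^bsub>Y\<^esub>"
    using fd by (simp add: d\<psi>[symmetric] \<psi>c)
  note van' = van[unfolded ext_vanishes_def, rule_format, OF f' fd'[rule_format]]
  show "case n of 0 \<Rightarrow> \<forall>x\<in>carrier (P 0). f x = \<zero>\<^bsub>Y\<^esub>
         | Suc m \<Rightarrow> \<exists>g\<in>module_hom R (P m) Y. \<forall>x\<in>carrier (P n). f x = g (dP m x)"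
  proof (cases n)
    case 0
    have "f x = \<zero>\<^bsub>Y\<^esub>" if x: "x \<in> carrier (P 0)" for x
    proof -
      have "f x = f (\<psi> 0 (\<phi> 0 x)) \<oplus>\<^bsub>Y\<^esub> f (dP 0 (s 0 x))"
        using f[unfolded 0] x by (subst h0[OF x]) (simp add: hom_add \<phi>c \<psi>c sc dPc)
      then show ?thesis using van' fd x by (simp add: 0 \<phi>c sc)
    qed
    with 0 show ?thesis by simp
  next
    case (Suc m)
    obtain g where g: "g \<in> module_hom R (Q m) Y" "\<And>x. x \<in> carrier (Q n) \<Longrightarrow> f (\<psi> n x) = g (dQ m x)"
      using van' by (auto simp: Suc)
    \<comment> \<open>Since \<open>f \<psi> \<phi> = g d \<phi> = g \<phi> d\<close>, the cochain
      bounding \<open>f\<close> is \<open>g \<phi> + f s\<close>.\<close>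
    let ?g = "\<lambda>x. g (\<phi> m x) \<oplus>\<^bsub>Y\<^esub> f (s m x)"
    have "?g \<in> module_hom R (P m) Y"
      using hom_plus[OF Y hom_comp[OF \<phi> g(1)] hom_comp[OF s f[unfolded Suc]]] .
    moreover have "f x = ?g (dP m x)" if x: "x \<in> carrier (P n)" for x
    proof -
      interpret Pn: Module.module R "P (Suc m)" by (rule Pm)
      note x' = x[unfolded Suc]
      have c: "\<psi> (Suc m) (\<phi> (Suc m) x) \<in> carrier (P (Suc m))" "s m (dP m x) \<in> carrier (P (Suc m))"
          "dP (Suc m) (s (Suc m) x) \<in> carrier (P (Suc m))" "s (Suc m) x \<in> carrier (P (Suc (Suc m)))"
        using x' by (simp_all add: \<phi>c \<psi>c sc dPc)
      have "f x = f (\<psi> (Suc m) (\<phi> (Suc m) x)) \<oplus>\<^bsub>Y\<^esub> (f (dP (Suc m) (s (Suc m) x)) \<oplus>\<^bsub>Y\<^esub> f (s m (dP m x)))"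
        using f[unfolded Suc] c by (subst hS[OF x']) (simp add: hom_add)
      also have "f (dP (Suc m) (s (Suc m) x)) = \<zero>\<^bsub>Y\<^esub>" using fd c by (simp add: Suc)
      also have "f (\<psi> (Suc m) (\<phi> (Suc m) x)) = g (\<phi> m (dP m x))"
        using g(2)[unfolded Suc, OF \<phi>c[OF x']] d\<phi>[OF x'] by simp
      finally show ?thesis using fc[unfolded Suc, OF c(2)] by simp
    qed
    ultimately show ?thesis unfolding Suc by auto
  qed
qed

context local_noetherian
begin

lemma mfr_term_eq: "mfr_term R X n = free_module R (fst (mfr R X) n)"
  by (simp add: mfr_term_def)

lemma module_mfr_term [simp]: "module R (mfr_term R X n)"
  and projective_mfr_term [simp]: "fg_projective R (mfr_term R X n)"
  by (simp_all add: mfr_term_eq)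

lemma mfr_resolution:
  assumes "fg_module R X"
  obtains e where "resolution R X (mfr_term R X) (mfr_diff R X) e"
    "\<And>n x. x \<in> carrier (mfr_term R X (Suc n)) \<Longrightarrow> mfr_diff R X n x \<in> mvec (fst (mfr R X) n)"
proof -
  obtain e where e: "minimal_free_resolution R X (fst (mfr R X)) (mfr_diff R X) e"
    using mfr_minimal[OF assms] by metis
  have eq: "(\<lambda>n. free_module R (fst (mfr R X) n)) = mfr_term R X"
    by (simp add: mfr_term_eq fun_eq_iff)
  have res: "resolution R X (mfr_term R X) (mfr_diff R X) e"
    using e unfolding minimal_free_resolution_def eq by simp
  have "mfr_diff R X n x \<in> mvec (fst (mfr R X) n)" if x: "x \<in> carrier (mfr_term R X (Suc n))" for n x
    using e x hom_closed[OF resolution_diff_hom[OF res] x]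
    unfolding minimal_free_resolution_def mvec_def by (simp add: mfr_term_eq)
  with res show thesis by (rule that)
qed

lemma
  assumes X: "fg_module R X"
  shows mfr_diff_hom: "mfr_diff R X n \<in> module_hom R (mfr_term R X (Suc n)) (mfr_term R X n)"
  and mfr_diff_diff: "x \<in> carrier (mfr_term R X (Suc (Suc n))) \<Longrightarrow>
    mfr_diff R X n (mfr_diff R X (Suc n) x) = \<zero>\<^bsub>mfr_term R X n\<^esub>"
  by (rule mfr_resolution[OF X]; erule resolution_diff_hom resolution_diff_diff; assumption)+

section \<open>The cochain complex of the chosen minimal resolution\<close>

lemma carrier_cochains:
  "carrier (cochains R n X Y) = module_hom R (mfr_term R X n) Y \<inter> extensional (carrier (mfr_term R X n))"
  and zero_cochains: "\<zero>\<^bsub>cochains R n X Y\<^esub> = (\<lambda>x\<in>carrier (mfr_term R X n). \<zero>\<^bsub>Y\<^esub>)"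
  and add_cochains: "f \<oplus>\<^bsub>cochains R n X Y\<^esub> g = (\<lambda>x\<in>carrier (mfr_term R X n). f x \<oplus>\<^bsub>Y\<^esub> g x)"
  and smult_cochains: "a \<odot>\<^bsub>cochains R n X Y\<^esub> f = (\<lambda>x\<in>carrier (mfr_term R X n). a \<odot>\<^bsub>Y\<^esub> f x)"
  by (simp_all add: cochains_def Hom_module_def)

lemma restrict_cochain:
  "f \<in> module_hom R (mfr_term R X n) Y \<Longrightarrow>
    (\<lambda>x\<in>carrier (mfr_term R X n). f x) \<in> carrier (cochains R n X Y)"
  unfolding carrier_cochains
  by (intro IntI restrict_extensional) (rule hom_cong[OF module_mfr_term], assumption, simp)

lemma codiff_apply:
  "codiff R n X f = (\<lambda>x\<in>carrier (mfr_term R X (Suc n)). f (mfr_diff R X n x))"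
  by (simp add: codiff_def compose_def)

context
  fixes X :: "('a, 'm) module" and Y :: "('a, 'n) module"
  assumes X: "fg_module R X" and Y: "module R Y"
begin

lemma module_cochains: "module R (cochains R n X Y)"
  unfolding cochains_def by (rule module_Hom[OF module_mfr_term Y])

lemma codiff_hom: "codiff R n X \<in> module_hom R (cochains R n X Y) (cochains R (Suc n) X Y)"
proof (rule module_homI)
  note dc = hom_closed[OF mfr_diff_hom[OF X]]
  fix f assume f: "f \<in> carrier (cochains R n X Y)"
  then have "f \<in> module_hom R (mfr_term R X n) Y" by (simp add: carrier_cochains)
  from hom_comp[OF mfr_diff_hom[OF X] this]
  show "codiff R n X f \<in> carrier (cochains R (Suc n) X Y)"
    unfolding codiff_apply by (rule restrict_cochain)
  show "codiff R n X (a \<odot>\<^bsub>cochains R n X Y\<^esub> f) = a \<odot>\<^bsub>cochains R (Suc n) X Y\<^esub> codiff R n X f" for a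
    unfolding codiff_apply smult_cochains by (rule restrict_ext) (simp add: dc)
  fix g
  show "codiff R n X (f \<oplus>\<^bsub>cochains R n X Y\<^esub> g)
      = codiff R n X f \<oplus>\<^bsub>cochains R (Suc n) X Y\<^esub> codiff R n X g"
    unfolding codiff_apply add_cochains by (rule restrict_ext) (simp add: dc)
qed

lemma in_cocycles_iff:
  "f \<in> cocycles R n X Y \<longleftrightarrow> f \<in> carrier (cochains R n X Y) \<and>
    (\<forall>x\<in>carrier (mfr_term R X (Suc n)). f (mfr_diff R X n x) = \<zero>\<^bsub>Y\<^esub>)"
proof -
  have "codiff R n X f = \<zero>\<^bsub>cochains R (Suc n) X Y\<^esub> \<longleftrightarrow>
    (\<forall>x\<in>carrier (mfr_term R X (Suc n)). f (mfr_diff R X n x) = \<zero>\<^bsub>Y\<^esub>)"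
    unfolding codiff_apply zero_cochains by (auto simp: fun_eq_iff restrict_def)
  then show ?thesis by (simp add: cocycles_def a_kernel_def')
qed

lemma submodule_cocycles: "LinearCombinations.submodule R (cocycles R n X Y) (cochains R n X Y)"
  unfolding cocycles_def by (rule submodule_kernel[OF module_cochains module_cochains codiff_hom])

lemma submodule_coboundaries:
  "LinearCombinations.submodule R (coboundaries R n X Y) (cochains R n X Y)"
proof (cases n)
  case 0
  interpret C: Module.module R "cochains R 0 X Y" by (rule module_cochains)
  show ?thesis unfolding 0
    by (rule LinearCombinations.submodule.intro) (simp_all add: C.module_axioms)
next
  case (Suc m)
  then show ?thesis
    using submodule_image[OF module_cochains module_cochains codiff_hom] by simp
qed

lemma coboundaries_le_cocycles: "coboundaries R n X Y \<subseteq> cocycles R n X Y"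
proof (cases n)
  case 0
  interpret Z: LinearCombinations.submodule R "cocycles R 0 X Y" "cochains R 0 X Y"
    by (rule submodule_cocycles)
  show ?thesis unfolding 0 by simp
next
  case (Suc m)
  show ?thesis
  proof
    fix h assume "h \<in> coboundaries R n X Y"
    then obtain g where g: "g \<in> carrier (cochains R m X Y)" and h: "h = codiff R m X g"
      by (auto simp: Suc)
    have gh: "g \<in> module_hom R (mfr_term R X m) Y" using g by (simp add: carrier_cochains)
    have "h (mfr_diff R X n x) = \<zero>\<^bsub>Y\<^esub>" if x: "x \<in> carrier (mfr_term R X (Suc n))" for x
      using x hom_closed[OF mfr_diff_hom[OF X] x]
      by (simp add: h codiff_apply Suc mfr_diff_diff[OF X] hom_zero[OF module_mfr_term Y gh])
    then show "h \<in> cocycles R n X Y"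
      unfolding in_cocycles_iff using hom_closed[OF codiff_hom g] by (simp add: h Suc)
  qed
qed

text \<open>The record update keeps the operations of the cochain module, so closure is inherited
  and only the smaller ambient carrier is new.\<close>

lemma submodule_coboundaries_cocycles:
  "LinearCombinations.submodule R (coboundaries R n X Y) ((cochains R n X Y)\<lparr>carrier := cocycles R n X Y\<rparr>)"
proof -
  interpret C: Module.module R "cochains R n X Y" by (rule module_cochains)
  interpret B: LinearCombinations.submodule R "coboundaries R n X Y" "cochains R n X Y"
    by (rule submodule_coboundaries)
  show ?thesis
    by (rule LinearCombinations.submodule.intro)
      (simp_all add: coboundaries_le_cocycles C.submodule_is_module[OF submodule_cocycles])
qed

text \<open>\<open>Ext\<close> vanishes when every cocycle is a coboundary. Restriction to the
  carrier passes from the arbitrary maps of \<open>ext_vanishes\<close> to the extensional cochains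
  of \<open>Ext\<close>.\<close>

lemma zero_Ext_iff:
  "zero_module (Ext R n X Y) \<longleftrightarrow> ext_vanishes R (mfr_term R X) (mfr_diff R X) n Y"
proof -
  note dc = hom_closed[OF mfr_diff_hom[OF X]]
  have "zero_module (Ext R n X Y) \<longleftrightarrow> cocycles R n X Y \<subseteq> coboundaries R n X Y"
    unfolding Ext_def zero_module_quot_iff[OF submodule_coboundaries_cocycles] by simp
  also have "\<dots> \<longleftrightarrow> ext_vanishes R (mfr_term R X) (mfr_diff R X) n Y"
  proof
    assume sub: "cocycles R n X Y \<subseteq> coboundaries R n X Y"
    show "ext_vanishes R (mfr_term R X) (mfr_diff R X) n Y"
      unfolding ext_vanishes_def
    proof (intro ballI impI)
      fix f assume f: "f \<in> module_hom R (mfr_term R X n) Y"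
        and fd: "\<forall>x\<in>carrier (mfr_term R X (Suc n)). f (mfr_diff R X n x) = \<zero>\<^bsub>Y\<^esub>"
      let ?f = "\<lambda>x\<in>carrier (mfr_term R X n). f x"
      have "?f \<in> cocycles R n X Y"
        unfolding in_cocycles_iff using restrict_cochain[OF f] fd by (simp add: dc)
      then have fB: "?f \<in> coboundaries R n X Y" using sub by (rule subsetD[rotated])
      show "case n of 0 \<Rightarrow> \<forall>x\<in>carrier (mfr_term R X 0). f x = \<zero>\<^bsub>Y\<^esub>
         | Suc m \<Rightarrow> \<exists>g\<in>module_hom R (mfr_term R X m) Y. \<forall>x\<in>carrier (mfr_term R X n). f x = g (mfr_diff R X m x)"
      proof (cases n)
        case 0
        have eq: "?f = (\<lambda>x\<in>carrier (mfr_term R X n). \<zero>\<^bsub>Y\<^esub>)"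
          using fB by (simp add: 0 zero_cochains)
        have "f x = \<zero>\<^bsub>Y\<^esub>" if "x \<in> carrier (mfr_term R X 0)" for x
          using that fun_cong[OF eq, of x] by (simp add: 0)
        then show ?thesis by (simp add: 0)
      next
        case (Suc m)
        then obtain g where g: "g \<in> carrier (cochains R m X Y)" "?f = codiff R m X g"
          using fB by auto
        have "f x = g (mfr_diff R X m x)" if "x \<in> carrier (mfr_term R X n)" for x
          using fun_cong[OF g(2), of x] that by (simp add: codiff_apply Suc)
        then show ?thesis using g(1) by (auto simp: Suc carrier_cochains)
      qed
    qed
  next
    assume van: "ext_vanishes R (mfr_term R X) (mfr_diff R X) n Y"
    show "cocycles R n X Y \<subseteq> coboundaries R n X Y"
    proof
      fix f assume "f \<in> cocycles R n X Y"
      then have f: "f \<in> module_hom R (mfr_term R X n) Y" "f \<in> extensional (carrier (mfr_term R X n))"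
        and fd: "\<And>x. x \<in> carrier (mfr_term R X (Suc n)) \<Longrightarrow> f (mfr_diff R X n x) = \<zero>\<^bsub>Y\<^esub>"
        by (auto simp: in_cocycles_iff carrier_cochains)
      note van' = van[unfolded ext_vanishes_def, rule_format, OF f(1) fd]
      show "f \<in> coboundaries R n X Y"
      proof (cases n)
        case 0
        have "f = (\<lambda>x\<in>carrier (mfr_term R X 0). \<zero>\<^bsub>Y\<^esub>)"
          by (rule extensionalityI[OF f(2)[unfolded 0] restrict_extensional])
            (use van' in \<open>simp add: 0\<close>)
        then show ?thesis by (simp add: 0 zero_cochains)
      next
        case (Suc m)
        obtain g where g: "g \<in> module_hom R (mfr_term R X m) Y"
            "\<And>x. x \<in> carrier (mfr_term R X n) \<Longrightarrow> f x = g (mfr_diff R X m x)"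
          using van' by (auto simp: Suc)
        have "f = codiff R m X (\<lambda>x\<in>carrier (mfr_term R X m). g x)"
          unfolding codiff_apply
          by (rule extensionalityI[OF f(2)[unfolded Suc] restrict_extensional])
            (use g(2) in \<open>simp add: Suc dc\<close>)
        then show ?thesis
          using restrict_cochain[OF g(1)] by (simp add: Suc)
      qed
    qed
  qed
  finally show ?thesis .
qed

end

end

section \<open>The residue field and Betti numbers\<close>

context local_noetherian
begin

abbreviation k where "k \<equiv> residue_field R"

definition res :: "'a \<Rightarrow> 'a set" where
  "res a = max_ideal R +>\<^bsub>R\<^esub> a"

lemma field_residue_field: "field k"
  unfolding residue_field_def by (rule maximalideal.quotient_is_field[OF maximal_max_ideal is_cring])

interpretation k: field k
  by (rule field_residue_field)

interpretation I: ideal "max_ideal R" R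
  by (rule ideal_max_ideal)

lemma carrier_residue_field: "carrier k = res ` carrier R"
  by (auto simp: residue_field_def FactRing_def A_RCOSETS_def' res_def)

lemma res_closed [simp]: "a \<in> carrier R \<Longrightarrow> res a \<in> carrier k"
  by (simp add: carrier_residue_field)

lemma res_add: "a \<in> carrier R \<Longrightarrow> b \<in> carrier R \<Longrightarrow> res a \<oplus>\<^bsub>k\<^esub> res b = res (a \<oplus> b)"
  and res_mult: "a \<in> carrier R \<Longrightarrow> b \<in> carrier R \<Longrightarrow> res a \<otimes>\<^bsub>k\<^esub> res b = res (a \<otimes> b)"
  and res_one: "\<one>\<^bsub>k\<^esub> = res \<one>"
  by (simp_all add: residue_field_def FactRing_def res_def I.a_rcos_sum I.rcoset_mult_add)

lemma zero_residue_field: "\<zero>\<^bsub>k\<^esub> = max_ideal R"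
  by (simp add: residue_field_def FactRing_def)

lemma submodule_max_ideal: "LinearCombinations.submodule R (max_ideal R) (regular_module R)"
  by (rule LinearCombinations.submodule.intro)
    (auto simp: regular_module_def max_ideal_add max_ideal_zero max_ideal_mult
      intro: module_regular[unfolded regular_module_def])

lemma res_regular: "res a = max_ideal R +>\<^bsub>regular_module R\<^esub> a"
  by (simp add: res_def a_r_coset_def' regular_module_def)

lemma res_eq_zero_iff: "a \<in> carrier R \<Longrightarrow> res a = max_ideal R \<longleftrightarrow> a \<in> max_ideal R"
  unfolding res_regular using coset_eq_self_iff[OF submodule_max_ideal]
  by (simp add: regular_module_def)

lemma in_res: "a \<in> carrier R \<Longrightarrow> a \<in> res a"
  unfolding res_def by (rule I.a_rcos_self)

lemma in_resE:
  assumes "c \<in> res a" "a \<in> carrier R"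
  obtains h where "h \<in> max_ideal R" "c = h \<oplus> a"
  using assms by (auto simp: res_def a_r_coset_def')

section \<open>Modules killed by the maximal ideal as vector spaces over \<open>k\<close>\<close>

lemma carrier_space: "carrier (residue_space E) = carrier E"
  and zero_space: "\<zero>\<^bsub>residue_space E\<^esub> = \<zero>\<^bsub>E\<^esub>"
  and add_space: "x \<oplus>\<^bsub>residue_space E\<^esub> y = x \<oplus>\<^bsub>E\<^esub> y"
  by (simp_all add: residue_space_def)

context
  fixes E :: "('a, 'm) module"
  assumes E: "module R E"
    and killed: "\<And>a v. a \<in> max_ideal R \<Longrightarrow> v \<in> carrier E \<Longrightarrow> a \<odot>\<^bsub>E\<^esub> v = \<zero>\<^bsub>E\<^esub>"
begin

interpretation E: Module.module R E
  by (rule E)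

text \<open>In \<open>residue_space\<close> a class acts through \<open>the_elem\<close> of the set
  of products with all its members. As the maximal ideal kills \<open>E\<close>, this set is a
  singleton.\<close>

lemma smult_space:
  assumes a: "a \<in> carrier R" and v: "v \<in> carrier E"
  shows "res a \<odot>\<^bsub>residue_space E\<^esub> v = a \<odot>\<^bsub>E\<^esub> v"
proof -
  have "(\<lambda>c. c \<odot>\<^bsub>E\<^esub> v) ` res a = {a \<odot>\<^bsub>E\<^esub> v}"
  proof (intro equalityI subsetI)
    fix z assume "z \<in> (\<lambda>c. c \<odot>\<^bsub>E\<^esub> v) ` res a"
    then obtain c where z: "z = c \<odot>\<^bsub>E\<^esub> v" and "c \<in> res a" by (rule imageE)
    then obtain h where "h \<in> max_ideal R" "c = h \<oplus> a" using a by (elim in_resE)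
    then show "z \<in> {a \<odot>\<^bsub>E\<^esub> v}" using a v by (simp add: z E.smult_l_distr killed)
  next
    fix z assume "z \<in> {a \<odot>\<^bsub>E\<^esub> v}"
    then show "z \<in> (\<lambda>c. c \<odot>\<^bsub>E\<^esub> v) ` res a" using imageI[OF in_res[OF a]] by simp
  qed
  then show ?thesis by (simp add: residue_space_def)
qed

lemma vectorspace_space: "vectorspace k (residue_space E)"
proof -
  have "\<exists>w\<in>carrier E. v \<oplus>\<^bsub>E\<^esub> w = \<zero>\<^bsub>E\<^esub>" if "v \<in> carrier E" for v
    using that by (intro bexI[of _ "\<ominus>\<^bsub>E\<^esub> v"]) (simp_all add: E.r_neg)
  then have "module k (residue_space E)"
    by (intro module_criteria)
      (auto simp: carrier_space zero_space add_space carrier_residue_field smult_space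
        res_add res_mult res_one k.is_cring E.a_ac E.smult_l_distr E.smult_r_distr E.smult_assoc1)
  then show ?thesis using field_residue_field by (simp add: vectorspace_def)
qed

interpretation V: vectorspace k "residue_space E"
  by (rule vectorspace_space)

context
  fixes b and w :: "nat \<Rightarrow> 'm"
  assumes w: "\<And>i. i < b \<Longrightarrow> w i \<in> carrier E"
    and gen: "\<And>v. v \<in> carrier E \<Longrightarrow> \<exists>x\<in>carrier (free_module R b). v = comb E b w x"
    and indep: "\<And>x. x \<in> carrier (free_module R b) \<Longrightarrow> comb E b w x = \<zero>\<^bsub>E\<^esub> \<Longrightarrow> x \<in> mvec b"
begin

text \<open>If \<open>w i = w j\<close> with \<open>i \<noteq> j\<close>, the difference of the two
  unit vectors is a relation whose \<open>i\<close>-th coefficient is \<open>\<one>\<close>, against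
  \<open>indep\<close>. Injectivity matters because \<open>lincomb\<close> sums over a set of
  vectors and would lose a repetition.\<close>

lemma inj_generators: "inj_on w {..<b}"
proof (rule inj_onI, rule ccontr)
  interpret F: Module.module R "free_module R b" by simp
  fix i j assume ij: "i \<in> {..<b}" "j \<in> {..<b}" "w i = w j" "i \<noteq> j"
  let ?x = "unit_vec R b i \<oplus>\<^bsub>free_module R b\<^esub> (\<ominus> \<one>) \<odot>\<^bsub>free_module R b\<^esub> unit_vec R b j"
  have w': "w \<in> {..<b} \<rightarrow> carrier E" using w by auto
  note h = comb_hom[OF E w']
  have "comb E b w ?x = w i \<oplus>\<^bsub>E\<^esub> (\<ominus> \<one>) \<odot>\<^bsub>E\<^esub> w j"
    using ij by (simp add: hom_add[OF h] hom_smult[OF h] comb_unit_vec[OF E w'])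
  also have "\<dots> = \<zero>\<^bsub>E\<^esub>"
    using ij w by (simp add: E.smult_minus_1 E.r_neg)
  finally have x: "?x \<in> mvec b" using indep by simp
  have "?x i = \<one>"
    using ij by (simp add: unit_vec_def add_free smult_free)
  then show False using x ij one_notin_max_ideal by (auto simp: mvec_def)
qed

lemma finsum_space:
  "f \<in> A \<rightarrow> carrier E \<Longrightarrow> (\<Oplus>\<^bsub>residue_space E\<^esub>i\<in>A. f i) = (\<Oplus>\<^bsub>E\<^esub>i\<in>A. f i)"
proof (induct A rule: infinite_finite_induct)
  case (insert x A)
  then have "f \<in> A \<rightarrow> carrier E" "f x \<in> carrier E" by auto
  with insert show ?case by (simp add: add_space carrier_space)
qed (simp_all add: zero_space)

lemma lincomb_eq_comb:
  assumes x: "x \<in> carrier (free_module R b)" and a: "\<And>i. i < b \<Longrightarrow> a (w i) = res (x i)"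
  shows "V.lincomb a (w ` {..<b}) = comb E b w x"
proof -
  have "V.lincomb a (w ` {..<b}) = (\<Oplus>\<^bsub>residue_space E\<^esub>i\<in>{..<b}. a (w i) \<odot>\<^bsub>residue_space E\<^esub> w i)"
    unfolding V.lincomb_def
    by (rule V.M.finsum_reindex)
      (use inj_generators in \<open>auto simp: a carrier_space smult_space w free_coeff_closed[OF x]\<close>)
  also have "\<dots> = (\<Oplus>\<^bsub>residue_space E\<^esub>i\<in>{..<b}. x i \<odot>\<^bsub>E\<^esub> w i)"
    by (rule V.M.finsum_cong')
      (auto simp: a carrier_space smult_space w free_coeff_closed[OF x])
  also have "\<dots> = comb E b w x"
    unfolding comb_def by (rule finsum_space) (simp add: w free_coeff_closed[OF x])
  finally show ?thesis .
qed

text \<open>\<open>gen\<close> and \<open>indep\<close> say over \<open>R\<close> what a basis says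
  over \<open>k\<close>: coefficients in \<open>k\<close> lift to \<open>R\<close>, and a lift lies
  in the maximal ideal iff the coefficient is zero.\<close>

lemma dim_residue_space: "vectorspace.dim k (residue_space E) = b"
proof -
  let ?A = "w ` {..<b}"
  have fin: "finite ?A" and sub: "?A \<subseteq> carrier (residue_space E)" using w by (auto simp: carrier_space)
  have "V.lin_indpt ?A"
  proof (rule V.finite_lin_indpt2[OF fin sub])
    fix a assume a: "a \<in> ?A \<rightarrow> carrier k" and 0: "V.lincomb a ?A = \<zero>\<^bsub>residue_space E\<^esub>"
    have "\<exists>c. i < b \<longrightarrow> c \<in> carrier R \<and> a (w i) = res c" for i
    proof (cases "i < b")
      case True
      then have "a (w i) \<in> res ` carrier R"
        using a unfolding carrier_residue_field by (simp add: Pi_iff)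
      then obtain c where "a (w i) = res c" "c \<in> carrier R" by (rule imageE)
      then show ?thesis by (intro exI[of _ c]) simp
    qed simp
    then obtain c where c: "\<And>i. i < b \<Longrightarrow> c i \<in> carrier R" "\<And>i. i < b \<Longrightarrow> a (w i) = res (c i)"
      by metis
    let ?x = "\<lambda>i\<in>{..<b}. c i"
    have x: "?x \<in> carrier (free_module R b)" using c by (auto simp: carrier_free)
    have "comb E b w ?x = \<zero>\<^bsub>E\<^esub>"
      using lincomb_eq_comb[OF x, of a] c 0 by (simp add: zero_space)
    from indep[OF x this] have "c i \<in> max_ideal R" if "i < b" for i
      using that by (simp add: mvec_def)
    then show "\<forall>v\<in>?A. a v = \<zero>\<^bsub>k\<^esub>"
      using c by (auto simp: zero_residue_field res_eq_zero_iff)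
  qed
  moreover have "V.span ?A = carrier (residue_space E)"
  proof (rule equalityI[OF V.span_is_subset2[OF sub] subsetI])
    fix v assume "v \<in> carrier (residue_space E)"
    then obtain x where x: "x \<in> carrier (free_module R b)" "v = comb E b w x"
      using gen by (auto simp: carrier_space)
    let ?u = "inv_into {..<b} w"
    let ?a = "\<lambda>v. res (x (?u v))"
    have u: "?u (w i) = i" if "i < b" for i
      using that inj_generators by (simp add: inv_into_f_f)
    have "?a \<in> ?A \<rightarrow> carrier k" using x by (auto simp: u free_coeff_closed)
    moreover have "v = V.lincomb ?a ?A"
      using lincomb_eq_comb[OF x(1), of ?a] u x(2) by simp
    ultimately show "v \<in> V.span ?A"
      unfolding V.finite_span[OF fin sub] by auto
  qed
  ultimately have "V.basis ?A" using sub by (simp add: V.basis_def)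
  then have "V.dim = card ?A" by (rule V.dim_basis[OF fin])
  then show ?thesis using card_image[OF inj_generators] by simp
qed

end

end

lemma comb_quot:
  assumes N: "LinearCombinations.submodule R N M" and M: "module R M"
    and v: "v \<in> {..<n} \<rightarrow> carrier M" and x: "x \<in> carrier (free_module R n)"
  shows "comb (quot_module M N) n (\<lambda>i. N +>\<^bsub>M\<^esub> v i) x = N +>\<^bsub>M\<^esub> comb M n v x"
proof -
  have v': "(\<lambda>i. N +>\<^bsub>M\<^esub> v i) \<in> {..<n} \<rightarrow> carrier (quot_module M N)"
    using v coset_in_quot[OF N] by auto
  show ?thesis
    by (rule free_hom_ext[OF module_quot[OF N] comb_hom[OF module_quot[OF N] v']
          hom_comp[OF comb_hom[OF M v] proj_hom[OF N]] _ x])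
      (simp add: comb_unit_vec[OF module_quot[OF N] v'] comb_unit_vec[OF M v])
qed

text \<open>In \<open>F / \<mm> F\<close> the classes of the \<open>b\<close> unit vectors form a
  basis over \<open>k\<close>, and the classes of \<open>S\<close> span. This count, in the spirit
  of Nakayama's lemma, turns generation modulo \<open>\<mm>\<close> into a bound on ranks.\<close>

lemma rank_le_card:
  assumes S: "finite S" "S \<subseteq> carrier (free_module R b)"
    and gen: "\<And>y. y \<in> carrier (free_module R b) \<Longrightarrow>
      \<exists>s\<in>LinearCombinations.module.span R (free_module R b) S. \<exists>z\<in>mvec b. y = s \<oplus>\<^bsub>free_module R b\<^esub> z"
  shows "b \<le> card S"
proof -
  let ?F = "free_module R b" and ?p = "\<lambda>y. mvec b +>\<^bsub>free_module R b\<^esub> y"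
  interpret F: Module.module R ?F by simp
  define E where "E = quot_module ?F (mvec b)"
  have E: "module R E" unfolding E_def by (rule module_quot[OF submodule_mvec])
  interpret E: Module.module R E by (rule E)
  have p: "?p \<in> module_hom R ?F E" unfolding E_def by (rule proj_hom[OF submodule_mvec])
  have carE: "carrier E = ?p ` carrier ?F"
    unfolding E_def by (rule carrier_quot_module[OF submodule_mvec])
  have p0: "?p y = \<zero>\<^bsub>E\<^esub> \<longleftrightarrow> y \<in> mvec b" if "y \<in> carrier ?F" for y
    unfolding E_def quot_zero[OF submodule_mvec] by (rule coset_eq_self_iff[OF submodule_mvec that])
  have killed: "a \<odot>\<^bsub>E\<^esub> v = \<zero>\<^bsub>E\<^esub>" if a: "a \<in> max_ideal R" and v: "v \<in> carrier E" for a v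
  proof -
    obtain y where y: "v = ?p y" "y \<in> carrier ?F" using v unfolding carE by (rule imageE)
    have "a \<odot>\<^bsub>E\<^esub> v = ?p (a \<odot>\<^bsub>?F\<^esub> y)" using a y by (simp add: hom_smult[OF p])
    also have "\<dots> = \<zero>\<^bsub>E\<^esub>" using a y by (simp add: p0 mvec_smult_max)
    finally show ?thesis .
  qed
  interpret V: vectorspace k "residue_space E" by (rule vectorspace_space[OF E killed])
  have comb: "comb E b (\<lambda>i. ?p (unit_vec R b i)) x = ?p x" if x: "x \<in> carrier ?F" for x
    using comb_quot[OF submodule_mvec module_free _ x, of "unit_vec R b"]
    by (simp add: E_def free_expand[OF x])
  have dim: "V.dim = b"
    by (rule dim_residue_space[OF E killed, where w = "\<lambda>i. ?p (unit_vec R b i)"])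
      (auto simp: comb p0 hom_closed[OF p] carE)
  let ?A = "?p ` S"
  have smult: "res a \<odot>\<^bsub>residue_space E\<^esub> v = a \<odot>\<^bsub>E\<^esub> v" if "a \<in> carrier R" "v \<in> carrier E" for a v
    by (rule smult_space[OF E killed that])
  note sp = carrier_space smult add_space zero_space
  have A: "?A \<subseteq> carrier (residue_space E)"
    using S(2) by (auto simp: sp carE)
  interpret A: LinearCombinations.submodule k "V.span ?A" "residue_space E"
    by (rule V.span_is_submodule[OF A])
  \<comment> \<open>\<open>F.span\<close> is taken over \<open>R\<close> and \<open>V.span\<close>
    over \<open>k\<close>. The preimage \<open>?L\<close> of the latter is an
    \<open>R\<close>-submodule containing \<open>S\<close>, which links the two.\<close>
  let ?L = "{y \<in> carrier ?F. ?p y \<in> V.span ?A}"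
  have L: "LinearCombinations.submodule R ?L ?F"
  proof (rule LinearCombinations.submodule.intro)
    show "x \<oplus>\<^bsub>?F\<^esub> y \<in> ?L" if "x \<in> ?L" "y \<in> ?L" for x y
      using that A.m_closed[of "?p x" "?p y"] by (simp add: sp hom_add[OF p])
    show "\<zero>\<^bsub>?F\<^esub> \<in> ?L"
      using A.zero_closed by (simp add: sp hom_zero[OF module_free E p])
    show "c \<odot>\<^bsub>?F\<^esub> x \<in> ?L" if "c \<in> carrier R" "x \<in> ?L" for c x
      using that A.smult_closed[of "res c" "?p x"] by (simp add: sp hom_smult[OF p] hom_closed[OF p])
  qed auto
  have "F.span S \<subseteq> ?L"
    by (rule F.span_is_subset[OF _ L]) (use S(2) V.in_own_span[OF A] in auto)
  then have span: "?p s \<in> V.span ?A" if "s \<in> F.span S" for s using that by auto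
  have "V.span ?A = carrier (residue_space E)"
  proof (rule equalityI[OF V.span_is_subset2[OF A] subsetI])
    fix v assume "v \<in> carrier (residue_space E)"
    then obtain y where y: "y \<in> carrier ?F" "v = ?p y" by (auto simp: sp carE)
    from gen[OF y(1)] obtain s z where s: "s \<in> F.span S" and z: "z \<in> mvec b" and yz: "y = s \<oplus>\<^bsub>?F\<^esub> z"
      by auto
    have "s \<in> carrier ?F" using F.span_is_subset2[OF S(2)] s by auto
    then have "v = ?p s"
      using z by (simp add: y(2) yz hom_add[OF p] p0 mvec_closed hom_closed[OF p])
    then show "v \<in> V.span ?A" using span[OF s] by simp
  qed
  then have "V.dim \<le> card ?A"
    by (rule V.gen_ge_dim[OF finite_imageI[OF S(1)] A])
  also have "\<dots> \<le> card S" by (rule card_image_le[OF S(1)])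
  finally show ?thesis unfolding dim .
qed

end

context local_noetherian
begin

section \<open>Extensions by the residue field and Betti numbers as ranks\<close>

lemma module_residue_module: "module R (residue_module R)"
  unfolding residue_module_def by (rule module_quot[OF submodule_max_ideal])

lemma carrier_residue_module: "carrier (residue_module R) = res ` carrier R"
  unfolding residue_module_def carrier_quot_module[OF submodule_max_ideal]
  by (simp add: res_regular[abs_def] regular_module_def)

lemma zero_residue_module: "\<zero>\<^bsub>residue_module R\<^esub> = max_ideal R"
  unfolding residue_module_def by (rule quot_zero[OF submodule_max_ideal])

lemma res_hom: "res \<in> module_hom R (regular_module R) (residue_module R)"
  unfolding residue_module_def res_regular[abs_def] by (rule proj_hom[OF submodule_max_ideal])

lemma smult_residue_module:
  "a \<in> carrier R \<Longrightarrow> c \<in> carrier R \<Longrightarrow> a \<odot>\<^bsub>residue_module R\<^esub> res c = res (a \<otimes> c)"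
  using hom_smult[OF res_hom, of a c] by (simp add: regular_module_def)

lemma residue_module_killed:
  assumes a: "a \<in> max_ideal R" and v: "v \<in> carrier (residue_module R)"
  shows "a \<odot>\<^bsub>residue_module R\<^esub> v = \<zero>\<^bsub>residue_module R\<^esub>"
proof -
  obtain c where c: "v = res c" "c \<in> carrier R"
    using v unfolding carrier_residue_module by (rule imageE)
  then show ?thesis
    using a by (simp add: smult_residue_module zero_residue_module res_eq_zero_iff max_ideal_mult_right)
qed

text \<open>\<open>f\<close> maps \<open>\<mm> F\<close> into \<open>\<mm> k = 0\<close>. Hence
  \<open>Hom(-, k)\<close> turns the differentials of a minimal resolution into zero maps.\<close>

lemma hom_residue_module_mvec:
  assumes f: "f \<in> module_hom R (free_module R b) (residue_module R)" and x: "x \<in> mvec b"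
  shows "f x = \<zero>\<^bsub>residue_module R\<^esub>"
proof -
  interpret K: Module.module R "residue_module R" by (rule module_residue_module)
  have "LinearCombinations.submodule R {\<zero>\<^bsub>residue_module R\<^esub>} (residue_module R)"
    by (rule LinearCombinations.submodule.intro) (simp_all add: module_residue_module)
  then have "comb (residue_module R) b (\<lambda>i. f (unit_vec R b i)) x \<in> {\<zero>\<^bsub>residue_module R\<^esub>}"
    unfolding comb_def
    by (rule finsum_submodule)
      (use x in \<open>auto simp: mvec_def intro!: residue_module_killed hom_closed[OF f]\<close>)
  then show ?thesis
    using free_hom_eq_comb[OF module_residue_module f mvec_closed[OF x]] by simp
qed

text \<open>By minimality all codifferentials into \<open>k\<close> are zero, so
  \<open>Ext^n(X, k)\<close> is \<open>Hom(P_n, k)\<close>, whose dimension over \<open>k\<close> is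
  the rank of \<open>P_n\<close>.\<close>

lemma betti_eq:
  assumes X: "fg_module R X"
  shows "betti R X n = fst (mfr R X) n"
proof -
  define b where "b = fst (mfr R X) n"
  let ?K = "residue_module R" and ?C = "cochains R n X (residue_module R)"
  let ?P = "mfr_term R X n"
  let ?E = "Ext R n X ?K"
  have P: "?P = free_module R b" by (simp add: mfr_term_eq b_def)
  interpret K: Module.module R ?K by (rule module_residue_module)
  interpret C: Module.module R ?C by (rule module_cochains[OF X module_residue_module])
  have f_mvec: "f (mfr_diff R X i x) = \<zero>\<^bsub>?K\<^esub>"
    if "f \<in> module_hom R (mfr_term R X i) ?K" "x \<in> carrier (mfr_term R X (Suc i))" for f i x
    using mfr_resolution[OF X] hom_residue_module_mvec that unfolding mfr_term_eq[of X i] by metis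
  have "f \<in> cocycles R n X ?K \<longleftrightarrow> f \<in> carrier ?C" for f
    using f_mvec[of f n] unfolding in_cocycles_iff[OF X module_residue_module]
    by (simp add: carrier_cochains conj_commute) (metis IntD1 carrier_cochains)
  then have Z: "cocycles R n X ?K = carrier ?C" by (simp add: set_eq_iff)
  have B: "coboundaries R n X ?K = {\<zero>\<^bsub>?C\<^esub>}"
  proof (cases n)
    case (Suc m)
    have "codiff R m X f = \<zero>\<^bsub>?C\<^esub>" if f: "f \<in> carrier (cochains R m X ?K)" for f
      unfolding codiff_apply zero_cochains Suc
      by (rule restrict_ext) (use f f_mvec in \<open>simp add: carrier_cochains\<close>)
    \<comment> \<open>The image of the zero codifferential is \<open>{0}\<close> and not empty
      because there is at least one cochain.\<close>
    moreover have "carrier (cochains R m X ?K) \<noteq> {}"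
      using Module.module.axioms(2)[OF module_cochains[OF X module_residue_module]]
        abelian_group.axioms(1) abelian_monoid.zero_closed by (metis empty_iff)
    ultimately show ?thesis unfolding Suc by (simp only: coboundaries.simps) (auto simp: Suc)
  qed simp
  have E: "?E = quot_module ?C {\<zero>\<^bsub>?C\<^esub>}"
    unfolding Ext_def Z B by simp
  have sub: "LinearCombinations.submodule R {\<zero>\<^bsub>?C\<^esub>} ?C"
    by (rule LinearCombinations.submodule.intro) (simp_all add: C.module_axioms)
  \<comment> \<open>\<open>Ext\<close> is formally still a quotient, by the zero submodule;
    \<open>?p\<close> identifies cochains with their classes.\<close>
  let ?p = "\<lambda>f. {\<zero>\<^bsub>?C\<^esub>} +>\<^bsub>?C\<^esub> f"
  have mE: "module R ?E" unfolding E by (rule module_quot[OF sub])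
  have p: "?p \<in> module_hom R ?C ?E" unfolding E by (rule proj_hom[OF sub])
  have carE: "carrier ?E = ?p ` carrier ?C" unfolding E by (rule carrier_quot_module[OF sub])
  have p0: "?p f = \<zero>\<^bsub>?E\<^esub> \<longleftrightarrow> f = \<zero>\<^bsub>?C\<^esub>" if "f \<in> carrier ?C" for f
    unfolding E quot_zero[OF sub] using coset_eq_self_iff[OF sub that] by simp
  have chom: "f \<in> module_hom R (free_module R b) ?K" if "f \<in> carrier ?C" for f
    using that by (simp add: carrier_cochains P)
  have cochain_eq: "f = g" if f: "f \<in> carrier ?C" and g: "g \<in> carrier ?C"
    and eq: "\<And>i. i < b \<Longrightarrow> f (unit_vec R b i) = g (unit_vec R b i)" for f g
  proof (rule extensionalityI)
    show "f \<in> extensional (carrier ?P)" "g \<in> extensional (carrier ?P)"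
      using f g by (simp_all add: carrier_cochains)
    show "f x = g x" if "x \<in> carrier ?P" for x
      by (rule free_hom_ext[OF module_residue_module chom[OF f] chom[OF g] eq]) (use that P in auto)
  qed
  have killed: "a \<odot>\<^bsub>?E\<^esub> v = \<zero>\<^bsub>?E\<^esub>" if a: "a \<in> max_ideal R" and v: "v \<in> carrier ?E" for a v
  proof -
    obtain f where f: "v = ?p f" "f \<in> carrier ?C" using v unfolding carE by (rule imageE)
    have "a \<odot>\<^bsub>?C\<^esub> f = \<zero>\<^bsub>?C\<^esub>"
      unfolding smult_cochains zero_cochains
      by (rule restrict_ext) (use a f hom_closed[OF chom] P in \<open>simp add: residue_module_killed\<close>)
    then have "a \<odot>\<^bsub>?E\<^esub> v = ?p \<zero>\<^bsub>?C\<^esub>" using a f by (simp add: hom_smult[OF p, symmetric])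
    also have "\<dots> = \<zero>\<^bsub>?E\<^esub>" by (rule hom_zero[OF C.module_axioms mE p])
    finally show ?thesis .
  qed
  \<comment> \<open>The dual basis: coordinate functions reduced modulo the maximal ideal and
    restricted to become cochains.\<close>
  define w where "w j = (\<lambda>x\<in>carrier ?P. res (x j))" for j
  have w: "w j \<in> carrier ?C" if "j < b" for j
    unfolding w_def
    by (rule restrict_cochain) (use hom_comp[OF coord_hom[OF that] res_hom] P in simp)
  then have w': "w \<in> {..<b} \<rightarrow> carrier ?C" by simp
  let ?G = "comb ?C b w"
  have Gc: "?G x \<in> carrier ?C" if "x \<in> carrier (free_module R b)" for x
    using comb_hom[OF C.module_axioms w'] that by (rule hom_closed)
  \<comment> \<open>Evaluation at the unit vectors recovers the coefficients modulo the maximal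
    ideal; generation and independence both follow from this.\<close>
  have G: "?G x (unit_vec R b i) = res (x i)" if x: "x \<in> carrier (free_module R b)" and i: "i < b" for x i
  proof -
    let ?e = "unit_vec R b i"
    have ev: "(\<lambda>f. f ?e) \<in> module_hom R ?C ?K"
      by (rule module_homI)
        (use hom_closed[OF chom] in \<open>simp_all add: add_cochains smult_cochains P\<close>)
    have "?G x ?e = (\<Oplus>\<^bsub>?K\<^esub>j\<in>{..<b}. (x j \<odot>\<^bsub>?C\<^esub> w j) ?e)"
      unfolding comb_def
      by (rule hom_finsum[OF C.module_axioms module_residue_module ev])
        (use w x in \<open>auto simp: free_coeff_closed\<close>)
    also have "\<dots> = (\<Oplus>\<^bsub>?K\<^esub>j\<in>{..<b}. if i = j then res (x j) else \<zero>\<^bsub>?K\<^esub>)"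
    proof (rule K.finsum_cong')
      fix j assume "j \<in> {..<b}"
      then have j: "j < b" "x j \<in> carrier R" using x by (simp_all add: free_coeff_closed)
      have "(x j \<odot>\<^bsub>?C\<^esub> w j) ?e = x j \<odot>\<^bsub>?K\<^esub> res (?e j)"
        by (simp add: smult_cochains P w_def)
      also have "\<dots> = (if i = j then res (x j) else \<zero>\<^bsub>?K\<^esub>)"
        using j by (simp add: unit_vec_def smult_residue_module zero_residue_module
            res_eq_zero_iff max_ideal_zero)
      finally show "(x j \<odot>\<^bsub>?C\<^esub> w j) ?e = (if i = j then res (x j) else \<zero>\<^bsub>?K\<^esub>)" .
    qed (use x K.zero_closed in \<open>auto simp: carrier_residue_module free_coeff_closed\<close>)
    also have "\<dots> = res (x i)"
      by (rule K.finsum_singleton)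
        (use i x in \<open>auto simp: carrier_residue_module free_coeff_closed\<close>)
    finally show ?thesis .
  qed
  have cq: "comb ?E b (\<lambda>j. ?p (w j)) x = ?p (?G x)" if "x \<in> carrier (free_module R b)" for x
    unfolding E by (rule comb_quot[OF sub C.module_axioms w' that])
  have "vectorspace.dim (residue_field R) (residue_space ?E) = b"
  proof (rule dim_residue_space[OF mE killed, where w = "\<lambda>j. ?p (w j)"])
    show "?p (w j) \<in> carrier ?E" if "j < b" for j
      using hom_closed[OF p w[OF that]] .
  next
    fix v assume "v \<in> carrier ?E"
    then obtain f where f: "v = ?p f" "f \<in> carrier ?C" unfolding carE by (rule imageE)
    have "\<forall>i. \<exists>a. a \<in> carrier R \<and> f (unit_vec R b i) = res a"
      using hom_closed[OF chom[OF f(2)] unit_vec_closed] unfolding carrier_residue_module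
      by (metis imageE)
    then obtain a where a: "\<And>i. a i \<in> carrier R" "\<And>i. f (unit_vec R b i) = res (a i)" by metis
    let ?x = "\<lambda>i\<in>{..<b}. a i"
    have x: "?x \<in> carrier (free_module R b)" using a by (simp add: carrier_free)
    have "?G ?x = f"
      by (rule cochain_eq[OF Gc[OF x] f(2)]) (simp add: G[OF x] a(2))
    then show "\<exists>x\<in>carrier (free_module R b). v = comb ?E b (\<lambda>j. ?p (w j)) x"
      using x f(1) by (intro bexI[OF _ x]) (simp add: cq)
  next
    fix x assume x: "x \<in> carrier (free_module R b)"
      and "comb ?E b (\<lambda>j. ?p (w j)) x = \<zero>\<^bsub>?E\<^esub>"
    then have "?G x = \<zero>\<^bsub>?C\<^esub>" by (simp add: cq p0 Gc)
    then have "res (x i) = max_ideal R" if "i < b" for i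
      using G[OF x that] by (simp add: zero_cochains P zero_residue_module)
    then show "x \<in> mvec b"
      using x by (simp add: mvec_def res_eq_zero_iff free_coeff_closed)
  qed
  then show ?thesis by (simp add: betti_def b_def)
qed

end

section \<open>The modules attached to cohomology classes\<close>

lemma direct_sum_simps:
  "carrier (direct_sum M N) = carrier M \<times> carrier N"
  "\<zero>\<^bsub>direct_sum M N\<^esub> = (\<zero>\<^bsub>M\<^esub>, \<zero>\<^bsub>N\<^esub>)"
  "u \<oplus>\<^bsub>direct_sum M N\<^esub> v = (fst u \<oplus>\<^bsub>M\<^esub> fst v, snd u \<oplus>\<^bsub>N\<^esub> snd v)"
  "a \<odot>\<^bsub>direct_sum M N\<^esub> u = (a \<odot>\<^bsub>M\<^esub> fst u, a \<odot>\<^bsub>N\<^esub> snd u)"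
  by (simp_all add: direct_sum_def)

lemma fst_hom: "fst \<in> module_hom R (direct_sum M N) M"
  and snd_hom: "snd \<in> module_hom R (direct_sum M N) N"
  by (auto intro!: module_homI simp: direct_sum_simps)

lemma hom_pair:
  "f \<in> module_hom R L M \<Longrightarrow> g \<in> module_hom R L N \<Longrightarrow> (\<lambda>x. (f x, g x)) \<in> module_hom R L (direct_sum M N)"
  by (rule module_homI) (simp_all add: direct_sum_simps hom_closed hom_add hom_smult)

text \<open>Concatenation of vectors identifies the sum with \<open>R^(a + c)\<close>, and
  \<open>?p\<close> cuts a vector after \<open>a\<close> entries.\<close>

lemma (in cring) projective_direct_sum:
  "fg_projective R (direct_sum (free_module R a) (free_module R c))"
proof -
  let ?S = "direct_sum (free_module R a) (free_module R c)"
  let ?i = "\<lambda>u. \<lambda>j\<in>{..<a + c}. if j < a then fst u j else snd u (j - a)"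
  let ?p = "\<lambda>z. (\<lambda>j\<in>{..<a}. z j, \<lambda>j\<in>{..<c}. z (a + j))"
  have c: "fst u j \<in> carrier R" if "u \<in> carrier ?S" "j < a" for u j
    using that by (intro free_coeff_closed[of "fst u" a]) (auto simp: direct_sum_simps)
  have c': "snd u j \<in> carrier R" if "u \<in> carrier ?S" "j < c" for u j
    using that by (intro free_coeff_closed[of "snd u" c]) (auto simp: direct_sum_simps)
  have i: "?i \<in> module_hom R ?S (free_module R (a + c))"
  proof (rule module_homI)
    show "?i u \<in> carrier (free_module R (a + c))" if "u \<in> carrier ?S" for u
      using c[OF that] c'[OF that] by (simp add: carrier_free)
    show "?i (u \<oplus>\<^bsub>?S\<^esub> v) = ?i u \<oplus>\<^bsub>free_module R (a + c)\<^esub> ?i v" for u v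
      unfolding direct_sum_simps add_free by (rule restrict_ext) auto
    show "?i (r \<odot>\<^bsub>?S\<^esub> u) = r \<odot>\<^bsub>free_module R (a + c)\<^esub> ?i u" for r u
      unfolding direct_sum_simps smult_free by (rule restrict_ext) auto
  qed
  have p: "?p \<in> module_hom R (free_module R (a + c)) ?S"
  proof (rule module_homI)
    fix z assume z: "z \<in> carrier (free_module R (a + c))"
    then show "?p z \<in> carrier ?S"
      by (simp add: carrier_free direct_sum_simps free_coeff_closed[OF z])
    show "?p (z \<oplus>\<^bsub>free_module R (a + c)\<^esub> y) = ?p z \<oplus>\<^bsub>?S\<^esub> ?p y" for y
      unfolding direct_sum_simps add_free fst_conv snd_conv
      by (intro arg_cong2[where f = Pair] restrict_ext) auto
    show "?p (r \<odot>\<^bsub>free_module R (a + c)\<^esub> z) = r \<odot>\<^bsub>?S\<^esub> ?p z" for r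
      unfolding direct_sum_simps smult_free fst_conv snd_conv
      by (intro arg_cong2[where f = Pair] restrict_ext) auto
  qed
  have "?p (?i u) = u" if "u \<in> carrier ?S" for u
  proof -
    have u: "fst u \<in> extensional {..<a}" "snd u \<in> extensional {..<c}"
      using that by (simp_all add: direct_sum_simps carrier_free mem_Times_iff PiE_iff)
    have "(\<lambda>j\<in>{..<a}. ?i u j) = fst u"
      by (rule extensionalityI[OF restrict_extensional u(1)]) simp
    moreover have "(\<lambda>j\<in>{..<c}. ?i u (a + j)) = snd u"
      by (rule extensionalityI[OF restrict_extensional u(2)]) simp
    ultimately show ?thesis by (intro prod_eqI) (simp_all only: fst_conv snd_conv)
  qed
  moreover have "module R ?S" by (rule direct_sum_is_module) simp_all
  ultimately show ?thesis
    unfolding fg_projective_def by (intro conjI exI[of _ "a + c"] bexI[OF _ i] bexI[OF _ p] ballI)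
qed

text \<open>The preimage of the span on the right is a submodule that contains \<open>S\<close>, so
  no linear combination has to be mapped.\<close>

lemma hom_span:
  assumes M: "module R M" and N: "module R N" and f: "f \<in> module_hom R M N"
    and S: "S \<subseteq> carrier M" and x: "x \<in> LinearCombinations.module.span R M S"
  shows "f x \<in> LinearCombinations.module.span R N (f ` S)"
proof -
  interpret M: Module.module R M by fact
  interpret N: Module.module R N by fact
  have fS: "f ` S \<subseteq> carrier N" using S hom_closed[OF f] by auto
  interpret L: LinearCombinations.submodule R "N.span (f ` S)" N
    by (rule N.span_is_submodule[OF fS])
  have "LinearCombinations.submodule R {y \<in> carrier M. f y \<in> N.span (f ` S)} M"
    by (rule LinearCombinations.submodule.intro)
      (auto simp: M.module_axioms hom_add[OF f] hom_smult[OF f] hom_zero[OF M N f])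
  then have "M.span S \<subseteq> {y \<in> carrier M. f y \<in> N.span (f ` S)}"
    by (rule M.span_is_subset[rotated]) (use S N.in_own_span[OF fS] in auto)
  with x show ?thesis by auto
qed

lemma (in cring) free_span_unit_vec:
  assumes "q \<in> carrier (free_module R n)"
  shows "q \<in> LinearCombinations.module.span R (free_module R n) (unit_vec R n ` {..<n})"
proof -
  interpret F: Module.module R "free_module R n" by simp
  have E: "unit_vec R n ` {..<n} \<subseteq> carrier (free_module R n)" by auto
  interpret L: LinearCombinations.submodule R "F.span (unit_vec R n ` {..<n})" "free_module R n"
    by (rule F.span_is_submodule[OF E])
  have "comb (free_module R n) n (unit_vec R n) q \<in> F.span (unit_vec R n ` {..<n})"
    unfolding comb_def
    by (rule finsum_submodule[OF F.span_is_submodule[OF E]])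
      (use F.in_own_span[OF E] assms in \<open>auto simp: free_coeff_closed\<close>)
  then show ?thesis by (simp add: free_expand[OF assms])
qed

context local_noetherian
begin

text \<open>The \<open>SOME\<close> in \<open>K_module\<close> is usable once a representative
  exists: a cocycle in the coset \<open>\<eta>\<close> kills the boundaries and descends to the
  syzygy. Both maps of the pushout are then pulled back along the surjection from \<open>P_n\<close>
  to the syzygy, which leaves the submodule to be divided out unchanged and removes the syzygy from
  the presentation.\<close>

lemma K_module_eq:
  assumes X: "fg_module R X" and n: "n = Suc m" and \<eta>: "\<eta> \<in> carrier (Ext R n X X)"
  obtains f where "f \<in> module_hom R (mfr_term R X n) X"
    "\<And>x. x \<in> carrier (mfr_term R X (Suc n)) \<Longrightarrow> f (mfr_diff R X n x) = \<zero>\<^bsub>X\<^esub>"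
    "K_module R n X X \<eta> = quot_module (direct_sum X (mfr_term R X m))
       ((\<lambda>w. (f w, \<ominus>\<^bsub>mfr_term R X m\<^esub> mfr_diff R X m w)) ` carrier (mfr_term R X n))"
proof -
  let ?P = "mfr_term R X" and ?d = "mfr_diff R X"
  let ?N = "?d n ` carrier (?P (Suc n))"
  have X': "module R X" using X by (simp add: fg_module_def)
  note d = mfr_diff_hom[OF X]
  have N: "LinearCombinations.submodule R ?N (?P n)"
    by (rule submodule_image[OF module_mfr_term module_mfr_term d])
  let ?F = "SOME f. represents R n X X f \<eta>"
  have "\<exists>f. represents R n X X f \<eta>"
  proof -
    note BZ = submodule_coboundaries_cocycles[OF X X']
    from \<eta> obtain c where c: "c \<in> cocycles R n X X"
      and \<eta>c: "\<eta> = coboundaries R n X X +>\<^bsub>(cochains R n X X)\<lparr>carrier := cocycles R n X X\<rparr>\<^esub> c"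
      unfolding Ext_def carrier_quot_module[OF BZ] by auto
    have c\<eta>: "c \<in> \<eta>" unfolding \<eta>c by (rule coset_self[OF BZ]) (simp add: c)
    have ch: "c \<in> module_hom R (?P n) X" "c \<in> extensional (carrier (?P n))"
      and cd: "\<And>x. x \<in> carrier (?P (Suc n)) \<Longrightarrow> c (?d n x) = \<zero>\<^bsub>X\<^esub>"
      using c by (simp_all add: in_cocycles_iff[OF X X'] carrier_cochains)
    have c0: "c x = \<zero>\<^bsub>X\<^esub>" if "x \<in> ?N" for x using that cd by auto
    let ?G = "\<lambda>C. the_elem (c ` C)"
    have "?G \<in> module_hom R (syzygy R n X) X"
      unfolding syzygy_def by (rule quot_lift_hom[OF N X' ch(1) c0])
    moreover have "compose (carrier (?P n)) ?G (syzygy_proj R n X) = c"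
    proof (rule extensionalityI[OF compose_extensional ch(2)])
      fix x assume x: "x \<in> carrier (?P n)"
      show "compose (carrier (?P n)) ?G (syzygy_proj R n X) x = c x"
        using quot_lift_coset[OF N X' ch(1) c0 x] x by (simp add: compose_def syzygy_proj_def)
    qed
    ultimately have "represents R n X X ?G \<eta>" using c\<eta> by (simp add: represents_def)
    then show ?thesis by (rule exI[of _ ?G])
  qed
  then have "represents R n X X ?F \<eta>" by (rule someI_ex)
  then have F: "?F \<in> module_hom R (quot_module (?P n) ?N) X"
    by (simp add: represents_def syzygy_def)
  let ?f = "\<lambda>x. ?F (?N +>\<^bsub>?P n\<^esub> x)"
  show thesis
  proof (rule that[of ?f])
    show f: "?f \<in> module_hom R (?P n) X" by (rule hom_comp[OF proj_hom[OF N] F])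
    show "?f (?d n x) = \<zero>\<^bsub>X\<^esub>" if x: "x \<in> carrier (?P (Suc n))" for x
    proof -
      have "?N +>\<^bsub>?P n\<^esub> ?d n x = ?N"
        using coset_eq_self_iff[OF N hom_closed[OF d x]] x by simp
      then show ?thesis
        using hom_zero[OF module_quot[OF N] X' F] by (simp add: quot_zero[OF N])
    qed
    \<comment> \<open>By \<open>d d = 0\<close> the differential is constant on cosets, so the
      \<open>the_elem\<close> in \<open>syzygy_incl\<close> returns its value.\<close>
    have dN: "?d m x = \<zero>\<^bsub>?P m\<^esub>" if "x \<in> ?N" for x
      using that mfr_diff_diff[OF X] by (auto simp: n)
    have incl: "syzygy_incl R n X (?N +>\<^bsub>?P n\<^esub> x) = ?d m x" if "x \<in> carrier (?P n)" for x
      unfolding syzygy_incl_def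
      using quot_lift_coset[OF N module_mfr_term d[of m, folded n] dN that] by (simp add: n)
    show "K_module R n X X \<eta> = quot_module (direct_sum X (?P m))
       ((\<lambda>w. (?f w, \<ominus>\<^bsub>?P m\<^esub> ?d m w)) ` carrier (?P n))"
    proof -
      have "(\<lambda>w. (?F w, \<ominus>\<^bsub>?P m\<^esub> syzygy_incl R n X w)) ` carrier (syzygy R n X)
          = (\<lambda>w. (?f w, \<ominus>\<^bsub>?P m\<^esub> ?d m w)) ` carrier (?P n)"
        unfolding syzygy_def carrier_quot_module[OF N] image_image
        by (rule image_cong[OF refl]) (simp add: incl)
      then show ?thesis by (simp add: K_module_def pushout_def n)
    qed
  qed
qed

section \<open>The mapping cone of a lifted cocycle of degree \<open>Suc m\<close>\<close>

context
  fixes X :: "('a, 'm) module" and b d e m f \<theta>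
  assumes X: "module R X"
    and res: "resolution R X (\<lambda>i. free_module R (b i)) d e"
    and min: "\<And>n x. x \<in> carrier (free_module R (b (Suc n))) \<Longrightarrow> d n x \<in> mvec (b n)"
    and f: "f \<in> module_hom R (free_module R (b (Suc m))) X"
    and \<theta>: "\<And>i. \<theta> i \<in> module_hom R (free_module R (b (Suc (i + m)))) (free_module R (b i))"
    and \<theta>0: "\<And>x. x \<in> carrier (free_module R (b (Suc m))) \<Longrightarrow> e (\<theta> 0 x) = f x"
    and \<theta>d: "\<And>i x. x \<in> carrier (free_module R (b (Suc (Suc (i + m))))) \<Longrightarrow>
      d i (\<theta> (Suc i) x) = \<theta> i (d (Suc (i + m)) x)"
begin

abbreviation P where "P i \<equiv> free_module R (b i)"

definition U where "U = (\<lambda>w. (f w, \<ominus>\<^bsub>P m\<^esub> d m w)) ` carrier (P (Suc m))"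

definition cone where "cone i = direct_sum (P i) (P (i + m))"

text \<open>The sign turns \<open>d \<theta> = \<theta> d\<close> into the vanishing of the square.
  It also matches the pushout relation: in degree \<open>0\<close>, applying \<open>e\<close> to the
  first entry of the boundary of \<open>(u, w)\<close> gives \<open>(f w, - d w)\<close>.\<close>

definition cone_diff where
  "cone_diff i u = (d i (fst u) \<oplus>\<^bsub>P i\<^esub> \<theta> i (snd u), \<ominus>\<^bsub>P (i + m)\<^esub> d (i + m) (snd u))"

definition cone_aug where "cone_aug u = U +>\<^bsub>direct_sum X (P m)\<^esub> (e (fst u), snd u)"

lemmas dh = resolution_diff_hom[OF res]
lemmas eh = resolution_aug_hom[OF res]

lemma dc: "x \<in> carrier (P (Suc i)) \<Longrightarrow> d i x \<in> carrier (P i)"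
  by (rule hom_closed[OF dh])

lemma \<theta>c: "x \<in> carrier (P (Suc (i + m))) \<Longrightarrow> \<theta> i x \<in> carrier (P i)"
  by (rule hom_closed[OF \<theta>])

lemma module_cone: "module R (cone i)"
  unfolding cone_def by (rule direct_sum_is_module) simp_all

lemma carrier_cone: "carrier (cone i) = carrier (P i) \<times> carrier (P (i + m))"
  by (simp add: cone_def direct_sum_simps)

lemma cone_diff_hom: "cone_diff i \<in> module_hom R (cone (Suc i)) (cone i)"
proof -
  have "(\<lambda>u. (d i (fst u) \<oplus>\<^bsub>P i\<^esub> \<theta> i (snd u), \<ominus>\<^bsub>P (i + m)\<^esub> d (i + m) (snd u)))
      \<in> module_hom R (direct_sum (P (Suc i)) (P (Suc (i + m)))) (direct_sum (P i) (P (i + m)))"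
    by (intro hom_pair hom_plus hom_neg module_free hom_comp[OF fst_hom dh] hom_comp[OF snd_hom dh]
        hom_comp[OF snd_hom \<theta>])
  then show ?thesis by (simp add: cone_def cone_diff_def[abs_def])
qed

lemma submodule_U: "LinearCombinations.submodule R U (direct_sum X (P m))"
  unfolding U_def
  by (rule submodule_image[OF module_free direct_sum_is_module[OF X module_free]
        hom_pair[OF f hom_neg[OF module_free dh]]])

lemma cone_aug_hom: "cone_aug \<in> module_hom R (cone 0) (quot_module (direct_sum X (P m)) U)"
proof -
  have "(\<lambda>u. (e (fst u), snd u)) \<in> module_hom R (direct_sum (P 0) (P m)) (direct_sum X (P m))"
    by (intro hom_pair hom_comp[OF fst_hom eh] snd_hom)
  from hom_comp[OF this proj_hom[OF submodule_U]] show ?thesis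
    by (simp add: cone_def cone_aug_def[abs_def])
qed

text \<open>A diagram chase on pairs. If \<open>(e x, y) \<in> U\<close>, then
  \<open>e x = f w = e (\<theta> w)\<close> and \<open>y = - d w\<close> for some \<open>w\<close>,
  so \<open>x - \<theta> w\<close> is a boundary. If \<open>(u, w)\<close> is a cycle in positive
  degree, then \<open>w = d w'\<close> for some \<open>w'\<close>, and
  \<open>u + \<theta> w'\<close> is a cycle of \<open>P\<close>.\<close>

lemma cone_resolution:
  "resolution R (quot_module (direct_sum X (P m)) U) cone cone_diff cone_aug"
  unfolding resolution_def
proof (intro conjI allI)
  show "module R (cone i)" for i by (rule module_cone)
  show "cone_aug \<in> module_hom R (cone 0) (quot_module (direct_sum X (P m)) U)"
    by (rule cone_aug_hom)
  show "cone_diff i \<in> module_hom R (cone (Suc i)) (cone i)" for i by (rule cone_diff_hom)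
  note U0 = coset_eq_self_iff[OF submodule_U]
  have aug0: "cone_aug u = \<zero>\<^bsub>quot_module (direct_sum X (P m)) U\<^esub> \<longleftrightarrow> (e (fst u), snd u) \<in> U"
    if "u \<in> carrier (cone 0)" for u
    unfolding cone_aug_def quot_zero[OF submodule_U]
    by (rule U0) (use that hom_closed[OF eh] in \<open>auto simp: direct_sum_simps carrier_cone\<close>)
  show "cone_aug ` carrier (cone 0) = carrier (quot_module (direct_sum X (P m)) U)"
  proof -
    have eq: "(\<lambda>u. (e (fst u), snd u)) ` carrier (cone 0) = carrier (direct_sum X (P m))"
    proof (intro equalityI subsetI)
      fix v assume "v \<in> (\<lambda>u. (e (fst u), snd u)) ` carrier (cone 0)"
      then show "v \<in> carrier (direct_sum X (P m))"
        using hom_closed[OF eh] by (auto simp: carrier_cone direct_sum_simps)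
    next
      fix v assume v: "v \<in> carrier (direct_sum X (P m))"
      then have "fst v \<in> e ` carrier (P 0)"
        unfolding resolution_aug_surj[OF res] by (auto simp: direct_sum_simps)
      then obtain x where "fst v = e x" "x \<in> carrier (P 0)" by (rule imageE)
      then show "v \<in> (\<lambda>u. (e (fst u), snd u)) ` carrier (cone 0)"
        using v by (intro image_eqI[of _ _ "(x, snd v)"]) (auto simp: carrier_cone direct_sum_simps)
    qed
    show ?thesis
      unfolding carrier_quot_module[OF submodule_U] cone_aug_def[abs_def]
      by (simp only: eq[symmetric] image_image)
  qed
  show "cone_diff 0 ` carrier (cone 1) = a_kernel (cone 0) (quot_module (direct_sum X (P m)) U) cone_aug"
  proof (intro equalityI subsetI)
    interpret X: Module.module R X by (rule X)
    fix v assume "v \<in> cone_diff 0 ` carrier (cone 1)"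
    then obtain u w where uw: "u \<in> carrier (P (Suc 0))" "w \<in> carrier (P (Suc m))" "v = cone_diff 0 (u, w)"
      by (auto simp: carrier_cone)
    have v: "v \<in> carrier (cone 0)"
      unfolding uw(3) by (rule hom_closed[OF cone_diff_hom]) (use uw in \<open>simp add: carrier_cone\<close>)
    have "e (d 0 u \<oplus>\<^bsub>P 0\<^esub> \<theta> 0 w) = f w"
      using uw hom_closed[OF f] \<theta>c[of w 0] dc[OF uw(1)]
      by (simp add: hom_add[OF eh] resolution_aug_diff[OF res] \<theta>0)
    then have "(e (fst v), snd v) \<in> U"
      using uw(2) by (auto simp: uw(3) cone_diff_def U_def)
    then show "v \<in> a_kernel (cone 0) (quot_module (direct_sum X (P m)) U) cone_aug"
      using v aug0[OF v] by (simp add: a_kernel_def')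
  next
    interpret X: Module.module R X by (rule X)
    interpret P0: Module.module R "P 0" by simp
    fix v assume "v \<in> a_kernel (cone 0) (quot_module (direct_sum X (P m)) U) cone_aug"
    then have v: "v \<in> carrier (cone 0)"
      and "cone_aug v = \<zero>\<^bsub>quot_module (direct_sum X (P m)) U\<^esub>"
      by (simp_all add: a_kernel_def')
    then have "(e (fst v), snd v) \<in> U" using aug0[OF v] by simp
    then obtain w where w: "w \<in> carrier (P (Suc m))" "e (fst v) = f w" "snd v = \<ominus>\<^bsub>P m\<^esub> d m w"
      by (auto simp: U_def)
    have x: "fst v \<in> carrier (P 0)" and t: "\<theta> 0 w \<in> carrier (P 0)"
      using v \<theta>c[of w 0] w(1) by (auto simp: carrier_cone)
    have "e (fst v \<ominus>\<^bsub>P 0\<^esub> \<theta> 0 w) = \<zero>\<^bsub>X\<^esub>"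
      using hom_closed[OF f w(1)]
      by (simp add: hom_minus[OF module_free X eh x t] w \<theta>0)
    then have "fst v \<ominus>\<^bsub>P 0\<^esub> \<theta> 0 w \<in> d 0 ` carrier (P (Suc 0))"
      using x t by (intro resolution_aug_kernel[OF res]) simp_all
    then obtain u where u: "fst v \<ominus>\<^bsub>P 0\<^esub> \<theta> 0 w = d 0 u" "u \<in> carrier (P (Suc 0))"
      by (rule imageE)
    have "fst v = d 0 u \<oplus>\<^bsub>P 0\<^esub> \<theta> 0 w"
      using x t by (simp add: u(1)[symmetric] a_minus_def P0.a_assoc P0.l_neg)
    then have "v = cone_diff 0 (u, w)"
      using w(3) by (simp add: cone_diff_def prod_eq_iff)
    then show "v \<in> cone_diff 0 ` carrier (cone 1)"
      using u(2) w(1) by (auto simp: carrier_cone)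
  qed
  show "cone_diff (Suc i) ` carrier (cone (Suc (Suc i))) = a_kernel (cone (Suc i)) (cone i) (cone_diff i)" for i
  proof (intro equalityI subsetI)
    interpret Pi: Module.module R "P i" by simp
    interpret Pim: Module.module R "P (i + m)" by simp
    interpret PSim: Module.module R "P (Suc (i + m))" by simp
    fix v assume "v \<in> cone_diff (Suc i) ` carrier (cone (Suc (Suc i)))"
    then obtain u w where uw: "u \<in> carrier (P (Suc (Suc i)))" "w \<in> carrier (P (Suc (Suc (i + m))))"
        "v = cone_diff (Suc i) (u, w)"
      by (auto simp: carrier_cone)
    have v: "v \<in> carrier (cone (Suc i))"
      unfolding uw(3) by (rule hom_closed[OF cone_diff_hom]) (use uw in \<open>simp add: carrier_cone\<close>)
    let ?t = "\<theta> (Suc i) w" and ?dw = "d (Suc (i + m)) w"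
    have c: "?t \<in> carrier (P (Suc i))" "?dw \<in> carrier (P (Suc (i + m)))" "d (Suc i) u \<in> carrier (P (Suc i))"
      using uw \<theta>c[of w "Suc i"] by (simp_all add: dc)
    have td: "\<theta> i ?dw \<in> carrier (P i)" using c by (simp add: \<theta>c)
    have "cone_diff i v = \<zero>\<^bsub>cone i\<^esub>"
      unfolding uw(3) cone_diff_def using uw c td
      by (simp add: cone_def direct_sum_simps hom_add[OF dh] resolution_diff_diff[OF res] \<theta>d
          hom_uminus[OF module_free module_free \<theta>] hom_uminus[OF module_free module_free dh] Pi.r_neg
          minus_zero_eq[OF module_free])
    then show "v \<in> a_kernel (cone (Suc i)) (cone i) (cone_diff i)"
      using v by (simp add: a_kernel_def')
  next
    interpret Pi: Module.module R "P i" by simp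
    interpret PSi: Module.module R "P (Suc i)" by simp
    interpret Pim: Module.module R "P (i + m)" by simp
    interpret PSim: Module.module R "P (Suc (i + m))" by simp
    fix v assume "v \<in> a_kernel (cone (Suc i)) (cone i) (cone_diff i)"
    then obtain u w where v: "v = (u, w)" and uw: "u \<in> carrier (P (Suc i))" "w \<in> carrier (P (Suc (i + m)))"
      and du: "d i u \<oplus>\<^bsub>P i\<^esub> \<theta> i w = \<zero>\<^bsub>P i\<^esub>" and "\<ominus>\<^bsub>P (i + m)\<^esub> d (i + m) w = \<zero>\<^bsub>P (i + m)\<^esub>"
      by (auto simp: a_kernel_def' carrier_cone cone_diff_def cone_def direct_sum_simps)
    then have "d (i + m) w = \<zero>\<^bsub>P (i + m)\<^esub>"
      using Pim.minus_minus[OF dc[OF uw(2)]] by (simp add: minus_zero_eq[OF module_free])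
    then have "w \<in> d (Suc (i + m)) ` carrier (P (Suc (Suc (i + m))))"
      by (rule resolution_diff_kernel[OF res uw(2)])
    then obtain w' where w': "w = d (Suc (i + m)) w'" "w' \<in> carrier (P (Suc (Suc (i + m))))"
      by (rule imageE)
    let ?t = "\<theta> (Suc i) w'"
    have t: "?t \<in> carrier (P (Suc i))" using \<theta>c[of w' "Suc i"] w'(2) by simp
    have "d i (u \<oplus>\<^bsub>P (Suc i)\<^esub> ?t) = \<zero>\<^bsub>P i\<^esub>"
      using uw t du w'(2) by (simp add: hom_add[OF dh] \<theta>d w'(1))
    then have "u \<oplus>\<^bsub>P (Suc i)\<^esub> ?t \<in> d (Suc i) ` carrier (P (Suc (Suc i)))"
      using uw t by (intro resolution_diff_kernel[OF res]) simp_all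
    then obtain u' where u': "u \<oplus>\<^bsub>P (Suc i)\<^esub> ?t = d (Suc i) u'" "u' \<in> carrier (P (Suc (Suc i)))"
      by (rule imageE)
    interpret PSSim: Module.module R "P (Suc (Suc (i + m)))" by simp
    \<comment> \<open>The sign in \<open>cone_diff\<close> forces the second entry
      \<open>- w'\<close>: its differential, negated, is \<open>d w' = w\<close>, and
      \<open>\<theta>\<close> of it removes the summand \<open>?t\<close> that was added to
      \<open>u\<close>.\<close>
    have "v = cone_diff (Suc i) (u', \<ominus>\<^bsub>P (Suc (Suc (i + m)))\<^esub> w')"
      unfolding v cone_diff_def
      using w' uw t hom_uminus[OF module_free module_free \<theta>[of "Suc i"], of w'] dc[OF w'(2)]
      by (simp add: u'(1)[symmetric] hom_uminus[OF module_free module_free dh] PSi.a_assoc PSi.r_neg)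
    then show "v \<in> cone_diff (Suc i) ` carrier (cone (Suc (Suc i)))"
      using u'(2) w'(2) by (auto simp: carrier_cone)
  qed
qed

text \<open>The homotopy identity of the cone is evaluated at \<open>(x, 0)\<close> and projected to
  the first summand. Apart from the part through \<open>Q_i\<close> and a value of
  \<open>\<theta>\<close>, every term contains a differential of \<open>P\<close> and lies in
  \<open>\<mm> P_i\<close>.\<close>

lemma cone_cover:
  assumes Q: "resolution R (quot_module (direct_sum X (P m)) U) (\<lambda>i. free_module R (c i)) dQ eQ"
  obtains p where "p \<in> module_hom R (free_module R (c i)) (P i)"
    "\<And>x. x \<in> carrier (P i) \<Longrightarrow> \<exists>q\<in>carrier (free_module R (c i)). \<exists>v\<in>carrier (P (Suc (i + m))).
       \<exists>z\<in>mvec (b i). x = p q \<oplus>\<^bsub>P i\<^esub> (\<theta> i v \<oplus>\<^bsub>P i\<^esub> z)"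
proof -
  have proj: "fg_projective R (cone i)" for i unfolding cone_def by (rule projective_direct_sum)
  have K: "module R (quot_module (direct_sum X (P m)) U)" by (rule module_quot[OF submodule_U])
  obtain \<phi> \<psi> s where \<phi>: "\<And>i. \<phi> i \<in> module_hom R (cone i) (free_module R (c i))"
    and \<psi>: "\<And>i. \<psi> i \<in> module_hom R (free_module R (c i)) (cone i)"
    and s: "\<And>i. s i \<in> module_hom R (cone i) (cone (Suc i))"
    and h0: "\<And>x. x \<in> carrier (cone 0) \<Longrightarrow> x = \<psi> 0 (\<phi> 0 x) \<oplus>\<^bsub>cone 0\<^esub> cone_diff 0 (s 0 x)"
    and hS: "\<And>i x. x \<in> carrier (cone (Suc i)) \<Longrightarrow> x = \<psi> (Suc i) (\<phi> (Suc i) x) \<oplus>\<^bsub>cone (Suc i)\<^esub>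
       (cone_diff (Suc i) (s (Suc i) x) \<oplus>\<^bsub>cone (Suc i)\<^esub> s i (cone_diff i x))"
    by (rule comparison_homotopy[OF K cone_resolution proj Q projective_free]) (assumption | rule that)+
  interpret Pi: Module.module R "P i" by simp
  let ?u = "\<lambda>x. (x, \<zero>\<^bsub>P (i + m)\<^esub>)"
  have u: "?u x \<in> carrier (cone i)" if "x \<in> carrier (P i)" for x
    using that Module.module.axioms(2)[OF module_free, THEN abelian_group.axioms(1), THEN abelian_monoid.zero_closed]
    by (simp add: carrier_cone)
  have p: "(\<lambda>q. fst (\<psi> i q)) \<in> module_hom R (free_module R (c i)) (P i)"
    using hom_comp[OF \<psi>[of i, unfolded cone_def] fst_hom] .
  show thesis
  proof (rule that[OF p])
    fix x assume x: "x \<in> carrier (P i)"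
    let ?q = "\<phi> i (?u x)" and ?w = "s i (?u x)"
    have q: "?q \<in> carrier (free_module R (c i))" by (rule hom_closed[OF \<phi> u[OF x]])
    have "?w \<in> carrier (cone (Suc i))" by (rule hom_closed[OF s u[OF x]])
    then have w: "fst ?w \<in> carrier (P (Suc i))" "snd ?w \<in> carrier (P (Suc (i + m)))"
      by (auto simp: carrier_cone)
    have tw: "\<theta> i (snd ?w) \<in> carrier (P i)" by (rule \<theta>c[OF w(2)])
    have dw: "d i (fst ?w) \<in> mvec (b i)" by (rule min[OF w(1)])
    have pq: "fst (\<psi> i ?q) \<in> carrier (P i)" by (rule hom_closed[OF p q])
    have "\<exists>z\<in>mvec (b i). x = fst (\<psi> i ?q) \<oplus>\<^bsub>P i\<^esub> (\<theta> i (snd ?w) \<oplus>\<^bsub>P i\<^esub> z)"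
    proof (cases i)
      case 0
      have "x = fst (\<psi> i ?q) \<oplus>\<^bsub>P i\<^esub> (d i (fst ?w) \<oplus>\<^bsub>P i\<^esub> \<theta> i (snd ?w))"
        using arg_cong[OF h0[OF u[OF x, unfolded 0]], of fst]
        by (simp add: 0 cone_def direct_sum_simps cone_diff_def)
      then show ?thesis
        using dw tw mvec_closed[OF dw] by (intro bexI[OF _ dw]) (simp add: Pi.a_comm)
    next
      case (Suc j)
      interpret Pj: Module.module R "P j" by simp
      interpret Pjm: Module.module R "P (j + m)" by simp
      interpret PSjm: Module.module R "P (Suc (j + m))" by simp
      \<comment> \<open>The boundary of \<open>(x, 0)\<close> is \<open>(d x, 0)\<close>, so this
        homotopy term depends linearly on \<open>d x\<close>, which lies in
        \<open>\<mm> P_j\<close>; it is part of the error.\<close>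
      let ?g = "\<lambda>y. fst (s j (y, \<zero>\<^bsub>P (j + m)\<^esub>))"
      have "?g \<in> module_hom R (P j) (P (Suc j))"
        by (rule hom_comp[OF hom_comp[OF hom_pair[OF hom_id hom_const_zero[OF module_free]] s[of j, unfolded cone_def]] fst_hom])
      then have g: "?g (d j x) \<in> mvec (b i)"
        using hom_mvec min[of x j] x by (simp add: Suc)
      have "cone_diff j (?u x) = (d j x, \<zero>\<^bsub>P (j + m)\<^esub>)"
        using dc[OF x[unfolded Suc]]
        by (simp add: cone_diff_def Suc hom_zero[OF module_free module_free \<theta>]
            hom_zero[OF module_free module_free dh] minus_zero_eq[OF module_free])
      then have "x = fst (\<psi> i ?q) \<oplus>\<^bsub>P i\<^esub> ((d i (fst ?w) \<oplus>\<^bsub>P i\<^esub> \<theta> i (snd ?w)) \<oplus>\<^bsub>P i\<^esub> ?g (d j x))"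
        using arg_cong[OF hS[OF u[OF x, unfolded Suc]], of fst]
        by (simp add: Suc cone_def direct_sum_simps cone_diff_def)
      also have "(d i (fst ?w) \<oplus>\<^bsub>P i\<^esub> \<theta> i (snd ?w)) \<oplus>\<^bsub>P i\<^esub> ?g (d j x)
          = \<theta> i (snd ?w) \<oplus>\<^bsub>P i\<^esub> (d i (fst ?w) \<oplus>\<^bsub>P i\<^esub> ?g (d j x))"
        using tw mvec_closed[OF dw] mvec_closed[OF g] by (simp add: Pi.a_ac)
      finally show ?thesis
        using mvec_add[OF dw g] by (intro bexI[of _ "d i (fst ?w) \<oplus>\<^bsub>P i\<^esub> ?g (d j x)"])
    qed
    then show "\<exists>q\<in>carrier (free_module R (c i)). \<exists>v\<in>carrier (P (Suc (i + m))).
       \<exists>z\<in>mvec (b i). x = fst (\<psi> i q) \<oplus>\<^bsub>P i\<^esub> (\<theta> i v \<oplus>\<^bsub>P i\<^esub> z)"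
      by (intro bexI[OF _ q] bexI[OF _ w(2)])
  qed
qed

section \<open>Iterates of the chain map and the bound on ranks\<close>

definition shift where "shift t = t * Suc m"

lemma shift_0: "shift 0 = 0"
  and shift_Suc: "i + shift (Suc t) = Suc (i + m) + shift t"
  by (simp_all add: shift_def)

text \<open>The composite of \<open>t\<close> components of \<open>\<theta>\<close>, a map from
  \<open>P (i + shift t)\<close> to \<open>P i\<close>. The recursion splits off the outermost
  factor, so the remaining power lives at index \<open>Suc (i + m)\<close> and inductions keep
  \<open>i\<close> arbitrary.\<close>

fun theta_pow where
  "theta_pow 0 i v = v"
| "theta_pow (Suc t) i v = \<theta> i (theta_pow t (Suc (i + m)) v)"

lemma theta_pow_hom: "theta_pow t i \<in> module_hom R (P (i + shift t)) (P i)"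
proof (induction t arbitrary: i)
  case 0
  then show ?case by (simp add: shift_0 hom_id)
next
  case (Suc t)
  have "(\<lambda>v. \<theta> i (theta_pow t (Suc (i + m)) v)) \<in> module_hom R (P (Suc (i + m) + shift t)) (P i)"
    by (rule hom_comp[OF Suc.IH \<theta>])
  then show ?case by (simp add: shift_Suc)
qed

lemma theta_pow_closed: "v \<in> carrier (P (i + shift t)) \<Longrightarrow> theta_pow t i v \<in> carrier (P i)"
  by (rule hom_closed[OF theta_pow_hom])

lemma theta_pow_diff:
  "v \<in> carrier (P (Suc (i + shift t))) \<Longrightarrow> d i (theta_pow t (Suc i) v) = theta_pow t i (d (i + shift t) v)"
proof (induction t arbitrary: i v)
  case (Suc t)
  have v: "v \<in> carrier (P (Suc (Suc (i + m) + shift t)))"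
    using Suc.prems by (simp add: shift_Suc)
  have "theta_pow t (Suc (Suc (i + m))) v \<in> carrier (P (Suc (Suc (i + m))))"
    by (rule theta_pow_closed) (use v in simp)
  then have "d i (theta_pow (Suc t) (Suc i) v) = \<theta> i (d (Suc (i + m)) (theta_pow t (Suc (Suc (i + m))) v))"
    by (simp add: \<theta>d)
  also have "\<dots> = \<theta> i (theta_pow t (Suc (i + m)) (d (Suc (i + m) + shift t) v))"
    by (simp only: Suc.IH[OF v])
  finally show ?case by (simp add: shift_Suc)
qed (simp add: shift_0)

text \<open>If a power of the class vanishes in \<open>Ext\<close>, the corresponding chain map is null homotopic.
  As the resolution is minimal, its components then have image in \<open>\<mm> P\<^sub>i\<close>.\<close>

lemma theta_pow_mvec:
  assumes t: "0 < t" and van: "ext_vanishes R P d (shift t) X"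
    and v: "v \<in> carrier (P (i + shift t))"
  shows "theta_pow t i v \<in> mvec (b i)"
proof -
  interpret P0: Module.module R "P 0" by simp
  interpret X: Module.module R X by (rule X)
  obtain l where l: "shift t = Suc l" using t by (cases t) (auto simp: shift_def)
  have Th: "theta_pow t 0 \<in> module_hom R (P (Suc l)) (P 0)"
    using theta_pow_hom[of t 0] by (simp add: l)
  have "e (theta_pow t 0 (d (shift t) x)) = \<zero>\<^bsub>X\<^esub>" if x: "x \<in> carrier (P (Suc (shift t)))" for x
    using theta_pow_diff[of x 0 t, symmetric] theta_pow_closed[of x "Suc 0" t] x
    by (simp add: resolution_aug_diff[OF res])
  with van hom_comp[OF Th eh] obtain g where g: "g \<in> module_hom R (P l) X"
      "\<And>x. x \<in> carrier (P (Suc l)) \<Longrightarrow> e (theta_pow t 0 x) = g (d l x)"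
    unfolding ext_vanishes_def l by fastforce
  obtain h where h: "h \<in> module_hom R (P l) (P 0)" "\<And>x. x \<in> carrier (P l) \<Longrightarrow> e (h x) = g x"
    by (rule projective_lift[OF projective_free X module_free g(1) eh])
      (simp_all add: resolution_aug_surj[OF res] hom_closed[OF g(1)])
  \<comment> \<open>The class of \<open>e \<theta>^t\<close> vanishes, so
    \<open>e \<theta>^t = g d\<close>, and \<open>h\<close> lifts \<open>g\<close> through
    \<open>e\<close>. Subtracting \<open>h d\<close> in degree \<open>0\<close> makes the chain map
    lie over zero; the neighbouring square still commutes because \<open>h d d = 0\<close>.\<close>
  let ?T = "\<lambda>i v. if i = 0 then theta_pow t 0 v \<ominus>\<^bsub>P 0\<^esub> h (d l v) else theta_pow t i v"
  have hd: "(\<lambda>v. h (d l v)) \<in> module_hom R (P (Suc l)) (P 0)" by (rule hom_comp[OF dh h(1)])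
  have T: "?T i \<in> module_hom R (P (i + shift t)) (P i)" for i
    using hom_diff[OF module_free Th hd] theta_pow_hom[of t i] by (cases "i = 0") (simp_all add: l)
  have T0: "e (?T 0 x) = \<zero>\<^bsub>X\<^esub>" if "x \<in> carrier (P (0 + shift t))" for x
    using that hom_closed[OF Th] hom_closed[OF hd] hom_closed[OF g(1) dc]
    by (simp add: l hom_minus[OF module_free X eh] h(2) dc g(2))
  have Td: "d i (?T (Suc i) x) = ?T i (d (i + shift t) x)" if x: "x \<in> carrier (P (Suc i + shift t))" for i x
  proof (cases i)
    case 0
    have x': "x \<in> carrier (P (Suc (Suc l)))" using x by (simp add: 0 l)
    have "h (d l (d (Suc l) x)) = \<zero>\<^bsub>P 0\<^esub>"
      by (simp add: resolution_diff_diff[OF res x'] hom_zero[OF module_free module_free h(1)])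
    moreover have "theta_pow t 0 (d (Suc l) x) \<in> carrier (P 0)"
      by (rule hom_closed[OF Th dc[OF x']])
    ultimately show ?thesis
      using theta_pow_diff[of x 0 t] x' by (simp add: 0 l a_minus_def minus_zero_eq[OF module_free])
  next
    case (Suc j)
    then show ?thesis using theta_pow_diff[of x i t] x by simp
  qed
  obtain s where s: "\<And>i. s i \<in> module_hom R (P (i + shift t)) (P (Suc i))"
      "\<And>x. x \<in> carrier (P (0 + shift t)) \<Longrightarrow> ?T 0 x = d 0 (s 0 x)"
      "\<And>i x. x \<in> carrier (P (Suc i + shift t)) \<Longrightarrow>
        ?T (Suc i) x = d (Suc i) (s (Suc i) x) \<oplus>\<^bsub>P (Suc i)\<^esub> s i (d (i + shift t) x)"
  proof (rule null_homotopy[where P = "\<lambda>i. P (i + shift t)" and dP = "\<lambda>i. d (i + shift t)" and \<theta> = ?T,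
        OF _ _ _ res T T0 Td])
    show "d (i + shift t) \<in> module_hom R (P (Suc i + shift t)) (P (i + shift t))" for i
      using dh[of "i + shift t"] by simp
    show "d (i + shift t) (d (Suc i + shift t) x) = \<zero>\<^bsub>P (i + shift t)\<^esub>"
      if "x \<in> carrier (P (Suc (Suc i) + shift t))" for i x
      using resolution_diff_diff[OF res, of x "i + shift t"] that by simp
  qed (assumption | rule that projective_free)+
  show ?thesis
  proof (cases i)
    case 0
    have v': "v \<in> carrier (P (Suc l))" using v by (simp add: 0 l)
    have c: "theta_pow t 0 v \<in> carrier (P 0)" "h (d l v) \<in> carrier (P 0)"
      using hom_closed[OF Th v'] hom_closed[OF hd v'] .
    have "theta_pow t 0 v = ?T 0 v \<oplus>\<^bsub>P 0\<^esub> h (d l v)"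
      using c by (simp add: a_minus_def P0.a_assoc P0.l_neg)
    also have "\<dots> \<in> mvec (b 0)"
    proof (rule mvec_add)
      have sv: "s 0 v \<in> carrier (P (Suc 0))" by (rule hom_closed[OF s(1)[of 0]]) (simp add: l v')
      show "?T 0 v \<in> mvec (b 0)"
        using s(2)[of v] min[OF sv] v' by (simp add: l)
      show "h (d l v) \<in> mvec (b 0)" by (rule hom_mvec[OF h(1) min[OF v']])
    qed
    finally show ?thesis by (simp add: 0)
  next
    case (Suc j)
    have v': "v \<in> carrier (P (Suc j + shift t))" using v by (simp add: Suc)
    have "theta_pow t i v = d (Suc j) (s (Suc j) v) \<oplus>\<^bsub>P (Suc j)\<^esub> s j (d (j + shift t) v)"
      using s(3)[OF v'] by (simp add: Suc)
    also have "\<dots> \<in> mvec (b (Suc j))"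
    proof (rule mvec_add)
      show "d (Suc j) (s (Suc j) v) \<in> mvec (b (Suc j))"
        by (rule min[OF hom_closed[OF s(1) v']])
      show "s j (d (j + shift t) v) \<in> mvec (b (Suc j))"
        by (rule hom_mvec[OF s(1) min]) (use v' in simp)
    qed
    finally show ?thesis by (simp add: Suc)
  qed
qed

text \<open>Covers are substituted into each other: the argument of \<open>\<theta> i\<close> in
  \<open>cone_cover\<close> is itself covered in degree \<open>Suc (i + m)\<close>. A round adds the
  images of the \<open>c i\<close> unit vectors and moves the older generators by
  \<open>\<theta> i\<close>; errors stay in \<open>\<mm> P\<close> because homomorphisms respect
  it.\<close>

lemma theta_pow_cover:
  assumes Q: "resolution R (quot_module (direct_sum X (P m)) U) (\<lambda>i. free_module R (c i)) dQ eQ"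
  shows "\<exists>S. finite S \<and> S \<subseteq> carrier (P i) \<and> card S \<le> (\<Sum>j<t. c (i + shift j)) \<and>
    (\<forall>x\<in>carrier (P i). \<exists>s\<in>LinearCombinations.module.span R (P i) S.
       \<exists>v\<in>carrier (P (i + shift t)). \<exists>z\<in>mvec (b i). x = s \<oplus>\<^bsub>P i\<^esub> (theta_pow t i v \<oplus>\<^bsub>P i\<^esub> z))"
proof (induction t arbitrary: i)
  case 0
  interpret Pi: Module.module R "P i" by simp
  have "\<zero>\<^bsub>P i\<^esub> \<in> Pi.span {}"
    using Pi.span_is_submodule[of "{}"] LinearCombinations.submodule.zero_closed by fastforce
  then show ?case
    by (intro exI[of _ "{}"] conjI ballI bexI[of _ "\<zero>\<^bsub>P i\<^esub>"] bexI[OF _ mvec_zero] bexI)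
      (simp_all add: shift_0)
next
  case (Suc t)
  let ?i' = "Suc (i + m)"
  interpret Pi: Module.module R "P i" by simp
  interpret Pi': Module.module R "P ?i'" by simp
  from Suc.IH[of ?i'] obtain S' where S': "finite S'" "S' \<subseteq> carrier (P ?i')"
      "card S' \<le> (\<Sum>j<t. c (?i' + shift j))"
    and cov': "\<And>x. x \<in> carrier (P ?i') \<Longrightarrow> \<exists>s\<in>Pi'.span S'.
       \<exists>v\<in>carrier (P (?i' + shift t)). \<exists>z\<in>mvec (b ?i'). x = s \<oplus>\<^bsub>P ?i'\<^esub> (theta_pow t ?i' v \<oplus>\<^bsub>P ?i'\<^esub> z)"
    by (elim exE conjE) (rule that, auto)
  obtain p where p: "p \<in> module_hom R (free_module R (c i)) (P i)"
    and cov: "\<And>x. x \<in> carrier (P i) \<Longrightarrow> \<exists>q\<in>carrier (free_module R (c i)). \<exists>v\<in>carrier (P ?i').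
       \<exists>z\<in>mvec (b i). x = p q \<oplus>\<^bsub>P i\<^esub> (\<theta> i v \<oplus>\<^bsub>P i\<^esub> z)"
    by (rule cone_cover[OF Q, of i]) (rule that)
  let ?E = "unit_vec R (c i) ` {..<c i}"
  let ?S = "p ` ?E \<union> \<theta> i ` S'"
  have E: "?E \<subseteq> carrier (free_module R (c i))" by auto
  have S: "?S \<subseteq> carrier (P i)" using hom_closed[OF p] hom_closed[OF \<theta>[of i]] S'(2) by auto
  interpret S: LinearCombinations.submodule R "Pi.span ?S" "P i"
    by (rule Pi.span_is_submodule[OF S])
  show ?case
  proof (intro exI[of _ ?S] conjI ballI)
    show "finite ?S" using S'(1) by simp
    show "?S \<subseteq> carrier (P i)" by (rule S)
    have "card ?S \<le> card (p ` ?E) + card (\<theta> i ` S')" by (rule card_Un_le)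
    also have "card (p ` ?E) \<le> c i"
      using card_image_le[of ?E p] card_image_le[of "{..<c i}" "unit_vec R (c i)"] by simp
    also have "card (\<theta> i ` S') \<le> (\<Sum>j<t. c (?i' + shift j))"
      using card_image_le[OF S'(1), of "\<theta> i"] S'(3) by simp
    also have "c i + (\<Sum>j<t. c (?i' + shift j)) = (\<Sum>j<Suc t. c (i + shift j))"
      unfolding sum.lessThan_Suc_shift shift_Suc by (simp add: shift_0)
    finally show "card ?S \<le> (\<Sum>j<Suc t. c (i + shift j))" by simp
  next
    fix x assume x: "x \<in> carrier (P i)"
    from cov[OF x] obtain q v z where q: "q \<in> carrier (free_module R (c i))"
      and v: "v \<in> carrier (P ?i')" and z: "z \<in> mvec (b i)"
      and xq: "x = p q \<oplus>\<^bsub>P i\<^esub> (\<theta> i v \<oplus>\<^bsub>P i\<^esub> z)" by (elim bexE)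
    from cov'[OF v] obtain s w z' where s: "s \<in> Pi'.span S'" and w: "w \<in> carrier (P (?i' + shift t))"
      and z': "z' \<in> mvec (b ?i')" and vs: "v = s \<oplus>\<^bsub>P ?i'\<^esub> (theta_pow t ?i' w \<oplus>\<^bsub>P ?i'\<^esub> z')"
      by (elim bexE)
    have sc: "s \<in> carrier (P ?i')" using Pi'.span_is_subset2[OF S'(2)] s by (rule subsetD)
    have tw: "theta_pow t ?i' w \<in> carrier (P ?i')" by (rule theta_pow_closed[OF w])
    note z'c = mvec_closed[OF z'] and zc = mvec_closed[OF z]
    have tv: "\<theta> i v = \<theta> i s \<oplus>\<^bsub>P i\<^esub> (theta_pow (Suc t) i w \<oplus>\<^bsub>P i\<^esub> \<theta> i z')"
      using sc tw z'c by (simp add: vs hom_add[OF \<theta>])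
    have c: "p q \<in> carrier (P i)" "\<theta> i s \<in> carrier (P i)" "theta_pow (Suc t) i w \<in> carrier (P i)"
        "\<theta> i z' \<in> carrier (P i)"
      using hom_closed[OF p q] sc tw z'c by (simp_all add: \<theta>c)
    have "x = (p q \<oplus>\<^bsub>P i\<^esub> \<theta> i s) \<oplus>\<^bsub>P i\<^esub> (theta_pow (Suc t) i w \<oplus>\<^bsub>P i\<^esub> (\<theta> i z' \<oplus>\<^bsub>P i\<^esub> z))"
      unfolding xq tv using c zc by (simp add: Pi.a_assoc del: theta_pow.simps)
    moreover have "p q \<oplus>\<^bsub>P i\<^esub> \<theta> i s \<in> Pi.span ?S"
    proof (rule S.m_closed)
      have "q \<in> LinearCombinations.module.span R (free_module R (c i)) ?E"
        by (rule free_span_unit_vec[OF q])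
      from hom_span[OF module_free module_free p E this]
      show "p q \<in> Pi.span ?S" by (rule subsetD[OF Pi.span_is_monotone[OF Un_upper1]])
      from hom_span[OF module_free module_free \<theta> S'(2) s]
      show "\<theta> i s \<in> Pi.span ?S" by (rule subsetD[OF Pi.span_is_monotone[OF Un_upper2]])
    qed
    moreover have "\<theta> i z' \<oplus>\<^bsub>P i\<^esub> z \<in> mvec (b i)" by (rule mvec_add[OF hom_mvec[OF \<theta> z'] z])
    moreover have "w \<in> carrier (P (i + shift (Suc t)))" using w by (simp add: shift_Suc)
    ultimately show "\<exists>s\<in>Pi.span ?S. \<exists>v\<in>carrier (P (i + shift (Suc t))). \<exists>z\<in>mvec (b i).
        x = s \<oplus>\<^bsub>P i\<^esub> (theta_pow (Suc t) i v \<oplus>\<^bsub>P i\<^esub> z)"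
      by (intro bexI)
  qed
qed

text \<open>When the power of \<open>\<theta>\<close> maps into \<open>\<mm> P_i\<close>, its term
  in the cover is absorbed by the error. The set \<open>S\<close> then generates \<open>P_i\<close>
  modulo \<open>\<mm> P_i\<close>, and its size bounds the rank.\<close>

lemma rank_bound:
  assumes K: "K = quot_module (direct_sum X (P m)) ((\<lambda>w. (f w, \<ominus>\<^bsub>P m\<^esub> d m w)) ` carrier (P (Suc m)))"
    and Q: "resolution R K (\<lambda>i. free_module R (c i)) dQ eQ"
    and t: "0 < t" and van: "ext_vanishes R P d (t * Suc m) X"
  shows "b i \<le> (\<Sum>j<t. c (i + j * Suc m))"
proof -
  note Q = Q[unfolded K, folded U_def] and van = van[folded shift_def]
  interpret Pi: Module.module R "P i" by simp
  obtain S where S: "finite S" "S \<subseteq> carrier (P i)" "card S \<le> (\<Sum>j<t. c (i + shift j))"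
    and cov: "\<And>x. x \<in> carrier (P i) \<Longrightarrow> \<exists>s\<in>Pi.span S.
       \<exists>v\<in>carrier (P (i + shift t)). \<exists>z\<in>mvec (b i). x = s \<oplus>\<^bsub>P i\<^esub> (theta_pow t i v \<oplus>\<^bsub>P i\<^esub> z)"
    using theta_pow_cover[OF Q, of i t] by (elim exE conjE) (rule that, auto)
  have "b i \<le> card S"
  proof (rule rank_le_card[OF S(1,2)])
    fix y assume "y \<in> carrier (P i)"
    from cov[OF this] obtain s v z where s: "s \<in> Pi.span S" and v: "v \<in> carrier (P (i + shift t))"
      and z: "z \<in> mvec (b i)" and y: "y = s \<oplus>\<^bsub>P i\<^esub> (theta_pow t i v \<oplus>\<^bsub>P i\<^esub> z)" by (elim bexE)
    show "\<exists>s\<in>Pi.span S. \<exists>z\<in>mvec (b i). y = s \<oplus>\<^bsub>P i\<^esub> z"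
      by (intro bexI[OF _ s] bexI[OF _ mvec_add[OF theta_pow_mvec[OF t van v] z]]) (rule y)
  qed
  from this S(3)[unfolded shift_def] show ?thesis by (rule order_trans)
qed

end

end

section \<open>Finite generation of images, free modules and direct sums\<close>

lemma fg_module_image:
  assumes M: "fg_module R M" and N: "module R N" and f: "f \<in> module_hom R M N"
    and surj: "f ` carrier M = carrier N"
  shows "fg_module R N"
proof -
  obtain S where M': "module R M" and S: "finite S" "S \<subseteq> carrier M"
      "LinearCombinations.module.span R M S = carrier M"
    using M unfolding fg_module_def by auto
  interpret N: Module.module R N by fact
  have fS: "f ` S \<subseteq> carrier N" using S(2) hom_closed[OF f] by auto
  have "carrier N \<subseteq> N.span (f ` S)"
    unfolding surj[symmetric] using hom_span[OF M' N f S(2)] S(3) by auto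
  with N.span_is_subset2[OF fS] have "N.span (f ` S) = carrier N" by (intro equalityI)
  then show ?thesis unfolding fg_module_def using N S(1) fS by (intro conjI exI[of _ "f ` S"]) auto
qed

lemma (in cring) fg_module_free: "fg_module R (free_module R n)"
proof -
  interpret F: Module.module R "free_module R n" by simp
  have E: "unit_vec R n ` {..<n} \<subseteq> carrier (free_module R n)" by auto
  have "F.span (unit_vec R n ` {..<n}) = carrier (free_module R n)"
    using F.span_is_subset2[OF E] free_span_unit_vec by (intro equalityI subsetI) auto
  then show ?thesis unfolding fg_module_def using E by (intro conjI exI) auto
qed

lemma fg_module_direct_sum:
  fixes M :: "('a, 'm) module" and N :: "('a, 'n) module"
  assumes M: "fg_module R M" and N: "fg_module R N"
  shows "fg_module R (direct_sum M N)"
proof -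
  obtain S where M': "module R M" and S: "finite S" "S \<subseteq> carrier M"
      "LinearCombinations.module.span R M S = carrier M"
    using M unfolding fg_module_def by auto
  obtain T where N': "module R N" and T: "finite T" "T \<subseteq> carrier N"
      "LinearCombinations.module.span R N T = carrier N"
    using N unfolding fg_module_def by auto
  have D: "module R (direct_sum M N)" by (rule direct_sum_is_module[OF M' N'])
  interpret M: Module.module R M by fact
  interpret N: Module.module R N by fact
  interpret D: Module.module R "direct_sum M N" by fact
  let ?l = "\<lambda>x. (x, \<zero>\<^bsub>N\<^esub>)" and ?r = "\<lambda>y. (\<zero>\<^bsub>M\<^esub>, y)"
  have l: "?l \<in> module_hom R M (direct_sum M N)"
    by (rule hom_pair[OF hom_id hom_const_zero[OF N']])
  have r: "?r \<in> module_hom R N (direct_sum M N)"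
    by (rule hom_pair[OF hom_const_zero[OF M'] hom_id])
  let ?G = "?l ` S \<union> ?r ` T"
  have G: "?G \<subseteq> carrier (direct_sum M N)"
    using S(2) T(2) by (auto simp: direct_sum_simps)
  interpret G: LinearCombinations.submodule R "D.span ?G" "direct_sum M N"
    by (rule D.span_is_submodule[OF G])
  have "u \<in> D.span ?G" if u: "u \<in> carrier (direct_sum M N)" for u
  proof -
    have c: "fst u \<in> carrier M" "snd u \<in> carrier N" using u by (auto simp: direct_sum_simps)
    have "?l (fst u) \<in> D.span (?l ` S)" by (rule hom_span[OF M' D l S(2)]) (simp add: S(3) c)
    then have "?l (fst u) \<in> D.span ?G" by (rule subsetD[OF D.span_is_monotone[OF Un_upper1]])
    moreover have "?r (snd u) \<in> D.span (?r ` T)" by (rule hom_span[OF N' D r T(2)]) (simp add: T(3) c)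
    then have "?r (snd u) \<in> D.span ?G" by (rule subsetD[OF D.span_is_monotone[OF Un_upper2]])
    ultimately have "?l (fst u) \<oplus>\<^bsub>direct_sum M N\<^esub> ?r (snd u) \<in> D.span ?G" by (rule G.m_closed)
    then show ?thesis using c by (simp add: direct_sum_simps)
  qed
  then have "D.span ?G = carrier (direct_sum M N)"
    using D.span_is_subset2[OF G] by (intro equalityI subsetI) auto
  then show ?thesis
    unfolding fg_module_def using D G S(1) T(1) by (intro conjI exI[of _ ?G]) auto
qed

section \<open>Complexity\<close>

text \<open>Finitely many bounded shifts cost a constant factor: \<open>t\<close> for the number of
  summands, \<open>2 ^ s\<close> for passing from \<open>i + j * n\<close> to \<open>i\<close>, and
  \<open>\<bar>a\<bar>\<close> to have a nonnegative factor whatever the sign of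
  \<open>a\<close>.\<close>

lemma growth_shift:
  fixes \<beta> \<gamma> :: "nat \<Rightarrow> nat" and s :: nat and a :: real
  assumes \<beta>: "\<And>i. \<beta> i \<le> (\<Sum>j<t. \<gamma> (i + j * n))"
    and ev: "eventually (\<lambda>i. real (\<gamma> i) \<le> a * real i powi (int s - 1)) sequentially"
  shows "eventually (\<lambda>i. real (\<beta> i) \<le> (real t * (\<bar>a\<bar> * 2 ^ s)) * real i powi (int s - 1)) sequentially"
proof -
  from ev obtain N where N: "\<And>i. N \<le> i \<Longrightarrow> real (\<gamma> i) \<le> a * real i powi (int s - 1)"
    unfolding eventually_sequentially by metis
  \<comment> \<open>In this range the shifted index is at most \<open>2 * i\<close>, the origin of
    \<open>2 ^ s\<close>. For \<open>s = 0\<close> the exponent is \<open>-1\<close>, and increasing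
    the index does not increase the value.\<close>
  have le: "real (i + j * n) powi (int s - 1) \<le> 2 ^ s * real i powi (int s - 1)"
    if i: "1 \<le> i" "t * n \<le> i" and j: "j < t" for i j
  proof (cases s)
    case 0
    then show ?thesis using i by (simp add: power_int_minus divide_simps)
  next
    case (Suc r)
    have "j * n \<le> t * n" using j by simp
    then have "i + j * n \<le> 2 * i" using i(2) by linarith
    then have "real (i + j * n) \<le> real (2 * i)" by (simp only: of_nat_le_iff)
    then have "real (i + j * n) \<le> 2 * real i" by (simp only: of_nat_mult of_nat_numeral)
    then have "real (i + j * n) ^ r \<le> (2 * real i) ^ r" by (rule power_mono) simp
    also have "\<dots> = 2 ^ r * real i ^ r" by (simp add: power_mult_distrib)
    also have "\<dots> \<le> 2 ^ s * real i ^ r" by (intro mult_right_mono) (simp_all add: Suc)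
    finally show ?thesis by (simp add: Suc)
  qed
  \<comment> \<open>The threshold \<open>1\<close> excludes \<open>i = 0\<close>, where
    \<open>0 powi -1 = 0\<close> breaks the estimate for \<open>s = 0\<close>.\<close>
  have "real (\<beta> i) \<le> (real t * (\<bar>a\<bar> * 2 ^ s)) * real i powi (int s - 1)"
    if i: "max (max N 1) (t * n) \<le> i" for i
  proof -
    have "real (\<gamma> (i + j * n)) \<le> \<bar>a\<bar> * (2 ^ s * real i powi (int s - 1))" if j: "j < t" for j
    proof -
      have "real (\<gamma> (i + j * n)) \<le> a * real (i + j * n) powi (int s - 1)" using i by (intro N) simp
      also have "\<dots> \<le> \<bar>a\<bar> * real (i + j * n) powi (int s - 1)" by (intro mult_right_mono) simp_all
      also have "\<dots> \<le> \<bar>a\<bar> * (2 ^ s * real i powi (int s - 1))"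
        using le[of i j] i j by (intro mult_left_mono) simp_all
      finally show ?thesis .
    qed
    then have "(\<Sum>j<t. real (\<gamma> (i + j * n))) \<le> (\<Sum>j<t. \<bar>a\<bar> * (2 ^ s * real i powi (int s - 1)))"
      by (intro sum_mono) simp
    moreover have "real (\<beta> i) \<le> (\<Sum>j<t. real (\<gamma> (i + j * n)))"
      using \<beta>[of i] by (simp flip: of_nat_sum)
    ultimately show ?thesis by (simp add: mult_ac)
  qed
  then show ?thesis unfolding eventually_sequentially by metis
qed

context local_noetherian
begin

text \<open>The map \<open>\<theta>\<close> is the lift of the cocycle \<open>f\<close> from the
  shifted complex with terms \<open>P_(i+n)\<close>; with \<open>n = Suc m\<close>, the index
  \<open>n - 1\<close> in \<open>K_module\<close> is \<open>m\<close>. Both sides of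
  \<open>rank_bound\<close> are ranks in minimal resolutions, that is, Betti numbers; for this
  \<open>K_module\<close> has to be finitely generated.\<close>

lemma betti_le_betti_K_module:
  assumes X: "fg_module R X" and n: "0 < n" and \<eta>: "\<eta> \<in> carrier (Ext R n X X)"
    and t: "0 < t" and zero: "zero_module (Ext R (t * n) X X)"
  shows "betti R X i \<le> (\<Sum>j<t. betti R (K_module R n X X \<eta>) (i + j * n))"
proof -
  obtain m where m: "n = Suc m" using n by (cases n) auto
  have X': "module R X" using X by (simp add: fg_module_def)
  let ?b = "fst (mfr R X)" and ?d = "mfr_diff R X"
  have terms: "mfr_term R Y = (\<lambda>i. free_module R (fst (mfr R Y) i))" for Y :: "('a, 'y) module"
    by (simp add: mfr_term_eq fun_eq_iff)
  obtain f where f: "f \<in> module_hom R (mfr_term R X n) X"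
      and fd: "\<And>x. x \<in> carrier (mfr_term R X (Suc n)) \<Longrightarrow> f (?d n x) = \<zero>\<^bsub>X\<^esub>"
      and K: "K_module R n X X \<eta> = quot_module (direct_sum X (mfr_term R X m))
         ((\<lambda>w. (f w, \<ominus>\<^bsub>mfr_term R X m\<^esub> ?d m w)) ` carrier (mfr_term R X n))"
    by (rule K_module_eq[OF X m \<eta>]) (rule that)
  obtain e where res: "resolution R X (mfr_term R X) ?d e"
    and min: "\<And>n x. x \<in> carrier (mfr_term R X (Suc n)) \<Longrightarrow> ?d n x \<in> mvec (?b n)"
    by (rule mfr_resolution[OF X]) (rule that)
  obtain \<theta> where \<theta>: "\<And>i. \<theta> i \<in> module_hom R (mfr_term R X (Suc (i + m))) (mfr_term R X i)"
    and \<theta>0: "\<And>x. x \<in> carrier (mfr_term R X (Suc (0 + m))) \<Longrightarrow> e (\<theta> 0 x) = f x"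
    and \<theta>d: "\<And>i x. x \<in> carrier (mfr_term R X (Suc (Suc i + m))) \<Longrightarrow>
      ?d i (\<theta> (Suc i) x) = \<theta> i (?d (Suc (i + m)) x)"
  proof (rule chain_map_lift[where P = "\<lambda>i. mfr_term R X (Suc (i + m))" and dP = "\<lambda>i. ?d (Suc (i + m))"
        and f = f, OF projective_mfr_term _ _ X' res])
    show "?d (Suc (i + m)) \<in> module_hom R (mfr_term R X (Suc (Suc i + m))) (mfr_term R X (Suc (i + m)))" for i
      using mfr_diff_hom[OF X, of "Suc (i + m)"] by simp
    show "?d (Suc (i + m)) (?d (Suc (Suc i + m)) x) = \<zero>\<^bsub>mfr_term R X (Suc (i + m))\<^esub>"
      if "x \<in> carrier (mfr_term R X (Suc (Suc (Suc i) + m)))" for i x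
      using mfr_diff_diff[OF X, of x "Suc (i + m)"] that by simp
    show "f \<in> module_hom R (mfr_term R X (Suc (0 + m))) X" using f by (simp add: m)
    show "f (?d (Suc (0 + m)) x) = \<zero>\<^bsub>X\<^esub>" if "x \<in> carrier (mfr_term R X (Suc (Suc 0 + m)))" for x
      using fd[of x] that by (simp add: m)
  qed (rule that)
  have dm: "?d m \<in> module_hom R (mfr_term R X n) (mfr_term R X m)"
    using mfr_diff_hom[OF X, of m] by (simp add: m)
  have D: "module R (direct_sum X (mfr_term R X m))"
    by (rule direct_sum_is_module[OF X' module_mfr_term])
  have U: "LinearCombinations.submodule R
      ((\<lambda>w. (f w, \<ominus>\<^bsub>mfr_term R X m\<^esub> ?d m w)) ` carrier (mfr_term R X n)) (direct_sum X (mfr_term R X m))"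
    by (rule submodule_image[OF module_mfr_term D hom_pair[OF f hom_neg[OF module_mfr_term dm]]])
  have "fg_module R (direct_sum X (mfr_term R X m))"
    unfolding mfr_term_eq by (rule fg_module_direct_sum[OF X fg_module_free])
  then have Kfg: "fg_module R (K_module R n X X \<eta>)"
    unfolding K by (rule fg_module_image[OF _ module_quot[OF U] proj_hom[OF U]])
      (rule carrier_quot_module[OF U, symmetric])
  obtain eQ where Q: "resolution R (K_module R n X X \<eta>) (mfr_term R (K_module R n X X \<eta>))
      (mfr_diff R (K_module R n X X \<eta>)) eQ"
    by (rule mfr_resolution[OF Kfg]) (rule that)
  have van: "ext_vanishes R (mfr_term R X) ?d (t * Suc m) X"
    using zero zero_Ext_iff[OF X X'] by (simp add: m)
  have "?b i \<le> (\<Sum>j<t. fst (mfr R (K_module R (Suc m) X X \<eta>)) (i + j * Suc m))"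
    by (rule rank_bound[where b = ?b and d = ?d and e = e and f = f and \<theta> = \<theta> and m = m,
          OF X' res[unfolded terms] min[unfolded terms] _ _ _ _
          K[unfolded m terms] Q[unfolded m terms] t van[unfolded terms]])
      (use f \<theta> \<theta>0 \<theta>d in \<open>simp_all add: terms m\<close>)
  then show ?thesis by (simp only: betti_eq[OF X] betti_eq[OF Kfg, unfolded m] m)
qed

text \<open>By \<open>growth_shift\<close>, every exponent that bounds the growth for
  \<open>K_module\<close> also bounds it for \<open>X\<close>, so the infimum for \<open>X\<close>
  is taken over a larger set.\<close>

lemma cx_le_cx_K_module:
  assumes X: "fg_module R X" and n: "0 < n" and \<eta>: "\<eta> \<in> carrier (Ext R n X X)"
    and t: "0 < t" and zero: "zero_module (Ext R (t * n) X X)"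
  shows "cx R X \<le> cx R (K_module R n X X \<eta>)"
  unfolding cx_def
  by (rule Inf_superset_mono) (use growth_shift[OF betti_le_betti_K_module[OF assms]] in blast)

end

section \<open>Projective dimension\<close>

lemma Sup_enat_infinite:
  assumes "infinite B"
  shows "Sup (enat ` B) = \<infinity>"
proof -
  have "infinite (enat ` B)" using assms by (simp add: finite_image_iff inj_on_def)
  moreover have "enat ` B \<noteq> {}" using assms by auto
  ultimately show ?thesis by (simp only: Sup_enat_def if_False)
qed

context local_noetherian
begin

text \<open>With \<open>Q i\<close> zero, the comparison identity on \<open>P_i\<close> retains only
  homotopy terms. These lie in \<open>\<mm> P_i\<close> by minimality, but a unit vector does
  not.\<close>

lemma minimal_rank_zero:
  fixes Q :: "nat \<Rightarrow> ('a, 'q) module"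
  assumes X: "fg_module R X" and Q: "resolution R X Q dQ eQ" and proj: "\<And>i. fg_projective R (Q i)"
    and zero: "zero_module (Q i)"
  shows "fst (mfr R X) i = 0"
proof (rule ccontr)
  assume b: "fst (mfr R X) i \<noteq> 0"
  let ?P = "mfr_term R X" and ?d = "mfr_diff R X"
  have X': "module R X" using X by (simp add: fg_module_def)
  obtain e where P: "resolution R X ?P ?d e"
    and min: "\<And>n x. x \<in> carrier (?P (Suc n)) \<Longrightarrow> ?d n x \<in> mvec (fst (mfr R X) n)"
    by (rule mfr_resolution[OF X]) (rule that)
  obtain \<phi> \<psi> s where \<phi>: "\<And>i. \<phi> i \<in> module_hom R (?P i) (Q i)"
    and \<psi>: "\<And>i. \<psi> i \<in> module_hom R (Q i) (?P i)"
    and s: "\<And>i. s i \<in> module_hom R (?P i) (?P (Suc i))"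
    and h0: "\<And>x. x \<in> carrier (?P 0) \<Longrightarrow> x = \<psi> 0 (\<phi> 0 x) \<oplus>\<^bsub>?P 0\<^esub> ?d 0 (s 0 x)"
    and hS: "\<And>i x. x \<in> carrier (?P (Suc i)) \<Longrightarrow> x = \<psi> (Suc i) (\<phi> (Suc i) x) \<oplus>\<^bsub>?P (Suc i)\<^esub>
       (?d (Suc i) (s (Suc i) x) \<oplus>\<^bsub>?P (Suc i)\<^esub> s i (?d i x))"
    by (rule comparison_homotopy[OF X' P projective_mfr_term Q proj]) (assumption | rule that)+
  let ?x = "unit_vec R (fst (mfr R X) i) 0"
  have x: "?x \<in> carrier (?P i)" by (simp add: mfr_term_eq)
  have "\<phi> i ?x = \<zero>\<^bsub>Q i\<^esub>"
    using hom_closed[OF \<phi> x] zero by (simp add: zero_module_def)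
  then have "\<psi> i (\<phi> i ?x) = \<zero>\<^bsub>?P i\<^esub>"
    using hom_zero[OF resolution_module[OF Q] module_mfr_term \<psi>] by simp
  then have \<psi>x: "\<psi> i (\<phi> i ?x) \<in> mvec (fst (mfr R X) i)"
    by (simp add: mfr_term_eq mvec_zero)
  have ds: "?d i (s i ?x) \<in> mvec (fst (mfr R X) i)"
    by (rule min[OF hom_closed[OF s x]])
  have "?x \<in> mvec (fst (mfr R X) i)"
  proof (cases i)
    case 0
    then have "?x = \<psi> i (\<phi> i ?x) \<oplus>\<^bsub>?P i\<^esub> ?d i (s i ?x)"
      using h0[of ?x] x by (simp only: 0)
    then show ?thesis using mvec_add[OF \<psi>x ds] by (simp only: mfr_term_eq)
  next
    case (Suc j)
    have "s j \<in> module_hom R (free_module R (fst (mfr R X) j)) (free_module R (fst (mfr R X) i))"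
      using s[of j] by (simp only: Suc mfr_term_eq)
    then have sd: "s j (?d j ?x) \<in> mvec (fst (mfr R X) i)"
      by (rule hom_mvec) (rule min[OF x[unfolded Suc], folded Suc])
    have "?x = \<psi> i (\<phi> i ?x) \<oplus>\<^bsub>?P i\<^esub> (?d i (s i ?x) \<oplus>\<^bsub>?P i\<^esub> s j (?d j ?x))"
      using hS[of ?x j] x by (simp only: Suc)
    then show ?thesis using mvec_add[OF \<psi>x mvec_add[OF ds sd]] by (simp only: mfr_term_eq)
  qed
  then show False using unit_vec_notin_mvec b by simp
qed

lemma free_zero: "zero_module (free_module R 0)"
  by (simp add: zero_module_def carrier_free zero_free restrict_def)

text \<open>The terms of the minimal resolution consist of vectors, whereas \<open>pd\<close>
  quantifies over modules whose elements are sets of vectors. Division by the zero submodule yields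
  an isomorphic copy of the required type.\<close>

lemma resolution_in_universe:
  assumes X: "module R X" and res: "resolution R X (\<lambda>n. free_module R (b n)) d e"
  obtains P :: "nat \<Rightarrow> 'a fgmod" and d' e' where "resolution R X P d' e'"
    "\<And>i. fg_projective R (P i)" "\<And>i. b i = 0 \<Longrightarrow> zero_module (P i)"
proof -
  let ?F = "\<lambda>i. free_module R (b i)"
  define N where "N i = {\<zero>\<^bsub>?F i\<^esub>}" for i
  define P where "P i = quot_module (?F i) (N i)" for i
  define \<pi> where "\<pi> i x = N i +>\<^bsub>?F i\<^esub> x" for i x
  \<comment> \<open>The inverse of \<open>\<pi>\<close>: it extracts the member of a singleton
    coset. The image under the identity map is written out so that \<open>quot_lift_hom\<close> and
    \<open>quot_lift_coset\<close> apply.\<close>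
  define \<iota> where "\<iota> i C = the_elem ((\<lambda>x. x) ` C)" for i :: nat and C :: "(nat \<Rightarrow> 'a) set"
  have N: "LinearCombinations.submodule R (N i) (?F i)" for i
  proof -
    interpret F: Module.module R "?F i" by simp
    show ?thesis unfolding N_def by (rule LinearCombinations.submodule.intro) (simp_all add: F.module_axioms)
  qed
  have mP: "module R (P i)" for i unfolding P_def by (rule module_quot[OF N])
  have \<pi>: "\<pi> i \<in> module_hom R (?F i) (P i)" for i
    unfolding P_def \<pi>_def[abs_def] by (rule proj_hom[OF N])
  have carP: "carrier (P i) = \<pi> i ` carrier (?F i)" for i
    unfolding P_def \<pi>_def[abs_def] by (rule carrier_quot_module[OF N])
  have \<pi>0: "\<pi> i x = \<zero>\<^bsub>P i\<^esub> \<longleftrightarrow> x = \<zero>\<^bsub>?F i\<^esub>" if "x \<in> carrier (?F i)" for i x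
    unfolding P_def \<pi>_def quot_zero[OF N] using coset_eq_self_iff[OF N that] by (simp add: N_def)
  have 0: "f x = \<zero>\<^bsub>L\<^esub>" if "f \<in> module_hom R (?F i) L" "module R L" "x \<in> N i" for f L i x
    using hom_zero[OF module_free that(2,1)] that(3) by (simp add: N_def)
  have \<iota>: "\<iota> i \<in> module_hom R (P i) (?F i)" for i
    unfolding P_def \<iota>_def by (rule quot_lift_hom[OF N module_free hom_id 0[OF hom_id module_free]])
  have \<iota>\<pi>: "\<iota> i (\<pi> i x) = x" if "x \<in> carrier (?F i)" for i x
    unfolding \<iota>_def \<pi>_def by (rule quot_lift_coset[OF N module_free hom_id 0[OF hom_id module_free] that])
  have \<pi>\<iota>: "\<pi> i (\<iota> i C) = C" if "C \<in> carrier (P i)" for i C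
  proof -
    obtain x where "C = \<pi> i x" "x \<in> carrier (?F i)" using \<open>C \<in> carrier (P i)\<close> unfolding carP by (rule imageE)
    then show ?thesis by (simp add: \<iota>\<pi>)
  qed
  have \<iota>im: "\<iota> i ` carrier (P i) = carrier (?F i)" for i
    unfolding carP image_image by (simp add: \<iota>\<pi>)
  note dh = resolution_diff_hom[OF res] and eh = resolution_aug_hom[OF res]
  let ?d = "\<lambda>i C. \<pi> i (d i (\<iota> (Suc i) C))" and ?e = "\<lambda>C. e (\<iota> 0 C)"
  have "resolution R X P ?d ?e"
    unfolding resolution_def
  proof (intro conjI allI)
    show "module R (P i)" for i by (rule mP)
    show "?e \<in> module_hom R (P 0) X" by (rule hom_comp[OF \<iota> eh])
    show "?d i \<in> module_hom R (P (Suc i)) (P i)" for i by (rule hom_comp[OF hom_comp[OF \<iota> dh] \<pi>])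
    have dim: "?d i ` carrier (P (Suc i)) = \<pi> i ` d i ` carrier (?F (Suc i))" for i
      unfolding \<iota>im[symmetric] image_image ..
    have ker: "\<pi> i ` a_kernel (?F i) L f = a_kernel (P i) L' g"
      if "\<And>x. x \<in> carrier (?F i) \<Longrightarrow> g (\<pi> i x) = \<zero>\<^bsub>L'\<^esub> \<longleftrightarrow> f x = \<zero>\<^bsub>L\<^esub>"
      for i f g and L :: "('a, 'l) module" and L' :: "('a, 'k) module"
      unfolding a_kernel_def' carP using that by auto
    have "e ` \<iota> 0 ` carrier (P 0) = carrier X"
      unfolding \<iota>im by (rule resolution_aug_surj[OF res])
    then show "?e ` carrier (P 0) = carrier X" by (simp only: image_image)
    have "?d 0 ` carrier (P (Suc 0)) = a_kernel (P 0) X ?e"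
      unfolding dim resolution_exact_0[OF res] by (rule ker) (simp add: \<iota>\<pi>)
    then show "?d 0 ` carrier (P 1) = a_kernel (P 0) X ?e" by simp
    show "?d (Suc i) ` carrier (P (Suc (Suc i))) = a_kernel (P (Suc i)) (P i) (?d i)" for i
      unfolding dim resolution_exact_Suc[OF res]
      by (rule ker) (simp add: \<iota>\<pi> \<pi>0 hom_closed[OF dh])
  qed
  moreover have "fg_projective R (P i)" for i
    unfolding fg_projective_def
    by (intro conjI exI[of _ "b i"] bexI[OF _ \<iota>] bexI[OF _ \<pi>] ballI mP \<pi>\<iota>)
  moreover have "zero_module (P i)" if "b i = 0" for i
    unfolding P_def zero_module_quot_iff[OF N] using free_zero that by (simp add: N_def zero_module_def)
  ultimately show thesis by (rule that)
qed

text \<open>By \<open>minimal_rank_zero\<close> no projective resolution can stop before the minimal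
  one. If only finitely many ranks are nonzero, the minimal resolution, moved into the universe of
  \<open>pd\<close>, attains the bound; otherwise the supremum is
  \<open>\<infinity>\<close>.\<close>

lemma pd_eq_Sup_ranks:
  assumes X: "fg_module R X"
  shows "pd R X = Sup {enat n | n. fst (mfr R X) n \<noteq> 0}"
proof (rule antisym)
  have X': "module R X" using X by (simp add: fg_module_def)
  let ?B = "{n. fst (mfr R X) n \<noteq> 0}"
  have eq: "{enat n | n. fst (mfr R X) n \<noteq> 0} = enat ` ?B" by auto
  show "Sup {enat n | n. fst (mfr R X) n \<noteq> 0} \<le> pd R X"
    unfolding pd_def
  proof (rule Inf_greatest, rule Sup_least)
    fix u v assume "u \<in> {enat n | n. \<exists>(P :: nat \<Rightarrow> 'a fgmod) d e.
        resolution R X P d e \<and> (\<forall>i. fg_projective R (P i)) \<and> (\<forall>i>n. zero_module (P i))}"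
      and "v \<in> {enat n | n. fst (mfr R X) n \<noteq> 0}"
    then obtain n i P d e where u: "u = enat n" and v: "v = enat i" and i: "fst (mfr R X) i \<noteq> 0"
      and P: "resolution R X (P :: nat \<Rightarrow> 'a fgmod) d e" "\<And>i. fg_projective R (P i)"
        "\<And>i. i > n \<Longrightarrow> zero_module (P i)" by auto
    have "\<not> i > n" using minimal_rank_zero[OF X P(1,2) P(3)] i by metis
    then show "v \<le> u" by (simp add: u v)
  qed
  show "pd R X \<le> Sup {enat n | n. fst (mfr R X) n \<noteq> 0}"
  proof (cases "finite ?B")
    case False
    then have "Sup (enat ` ?B) = \<infinity>" by (rule Sup_enat_infinite)
    then show ?thesis unfolding eq by simp
  next
    case True
    \<comment> \<open>If all ranks are zero, the length \<open>0\<close> agrees with the supremum of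
      the empty set in \<open>enat\<close>.\<close>
    define n where "n = (if ?B = {} then 0 else Max ?B)"
    have n: "fst (mfr R X) i = 0" if "i > n" for i
    proof (rule ccontr)
      assume "fst (mfr R X) i \<noteq> 0"
      then have "i \<in> ?B" by simp
      then have "i \<le> n" using Max_ge[OF True] by (auto simp: n_def)
      with that show False by simp
    qed
    obtain e where res: "resolution R X (mfr_term R X) (mfr_diff R X) e"
      by (rule mfr_resolution[OF X]) (rule that)
    have res': "resolution R X (\<lambda>i. free_module R (fst (mfr R X) i)) (mfr_diff R X) e"
      using res by (simp add: mfr_term_eq[abs_def])
    obtain P :: "nat \<Rightarrow> 'a fgmod" and d' e' where P: "resolution R X P d' e'"
      "\<And>i. fg_projective R (P i)" "\<And>i. fst (mfr R X) i = 0 \<Longrightarrow> zero_module (P i)"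
      by (rule resolution_in_universe[OF X' res']) (rule that)
    have "pd R X \<le> enat n"
      unfolding pd_def
      by (rule Inf_lower) (use P n in \<open>auto intro!: exI[of _ P] exI[of _ d'] exI[of _ e']\<close>)
    also have "enat n \<le> Sup (enat ` ?B)"
    proof (cases "?B = {}")
      case True
      then show ?thesis by (simp add: n_def zero_enat_def[symmetric])
    next
      case False
      then have "n \<in> ?B" unfolding n_def if_not_P[OF False] by (rule Max_in[OF True])
      then show ?thesis by (intro Sup_upper imageI)
    qed
    finally show ?thesis unfolding eq .
  qed
qed

lemma Ext_zero_if_rank_zero:
  assumes X: "fg_module R X" and Y: "module R Y" and b: "fst (mfr R X) n = 0"
  shows "zero_module (Ext R n X Y)"
  unfolding zero_Ext_iff[OF X Y] ext_vanishes_def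
proof (intro ballI impI)
  fix f assume f: "f \<in> module_hom R (mfr_term R X n) Y"
  have "f x = \<zero>\<^bsub>Y\<^esub>" if "x \<in> carrier (mfr_term R X n)" for x
    using that free_zero hom_zero[OF module_mfr_term Y f] by (simp add: mfr_term_eq b zero_module_def)
  then show "case n of 0 \<Rightarrow> \<forall>x\<in>carrier (mfr_term R X 0). f x = \<zero>\<^bsub>Y\<^esub>
         | Suc m \<Rightarrow> \<exists>g\<in>module_hom R (mfr_term R X m) Y. \<forall>x\<in>carrier (mfr_term R X n). f x = g (mfr_diff R X m x)"
    using hom_const_zero[OF Y, of "mfr_term R X _"] by (auto split: nat.split)
qed

text \<open>A generator of \<open>P\<^sub>p\<close> is sent to the image in \<open>X\<close> of a generator of \<open>P\<^sub>0\<close>.  This cocycle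
  is not a coboundary, for a coboundary has values in \<open>\<mm> X\<close>.\<close>

lemma Ext_top_nonzero:
  assumes X: "fg_module R X" and nz: "\<not> zero_module X"
    and b: "fst (mfr R X) p \<noteq> 0" and b': "fst (mfr R X) (Suc p) = 0"
  shows "\<not> zero_module (Ext R p X X)"
proof
  assume "zero_module (Ext R p X X)"
  have X': "module R X" using X by (simp add: fg_module_def)
  interpret X: Module.module R X by (rule X')
  let ?b = "fst (mfr R X)" and ?P = "mfr_term R X" and ?d = "mfr_diff R X"
  note van = \<open>zero_module (Ext R p X X)\<close>[unfolded zero_Ext_iff[OF X X'] ext_vanishes_def]
  obtain e where res: "resolution R X ?P ?d e"
    and min: "\<And>n x. x \<in> carrier (?P (Suc n)) \<Longrightarrow> ?d n x \<in> mvec (?b n)"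
    by (rule mfr_resolution[OF X]) (rule that)
  note eh = resolution_aug_hom[OF res]
  \<comment> \<open>A nonzero \<open>X\<close> needs at least one generator, so \<open>P_0\<close>
    has a unit vector whose image can serve as the value of the cocycle.\<close>
  have b0: "?b 0 \<noteq> 0"
  proof
    assume "?b 0 = 0"
    then have "carrier (?P 0) = {\<zero>\<^bsub>?P 0\<^esub>}" using free_zero by (simp add: mfr_term_eq zero_module_def)
    then have "carrier X = {\<zero>\<^bsub>X\<^esub>}"
      using resolution_aug_surj[OF res] hom_zero[OF module_mfr_term X' eh] by auto
    with nz show False by (simp add: zero_module_def)
  qed
  let ?x = "unit_vec R (?b 0) 0"
  have x: "?x \<in> carrier (?P 0)" by (simp add: mfr_term_eq)
  \<comment> \<open>The kernel of \<open>e\<close> is the image of the differential, which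
    minimality puts into \<open>\<mm> P_0\<close>.\<close>
  have ker: "y \<in> mvec (?b 0)" if y: "y \<in> carrier (?P 0)" "e y = \<zero>\<^bsub>X\<^esub>" for y
    using resolution_aug_kernel[OF res, OF y] min[of _ 0] by auto
  define f where "f = comb X (?b p) (\<lambda>_. e ?x)"
  have v: "(\<lambda>_. e ?x) \<in> {..<?b p} \<rightarrow> carrier X" using hom_closed[OF eh x] by simp
  have f: "f \<in> module_hom R (?P p) X" unfolding f_def mfr_term_eq by (rule comb_hom[OF X' v])
  let ?u = "unit_vec R (?b p) 0"
  have u: "?u \<in> carrier (?P p)" by (simp add: mfr_term_eq)
  have fu: "f ?u = e ?x" unfolding f_def using comb_unit_vec[OF X' v, of 0] b by simp
  have fd: "\<forall>y\<in>carrier (?P (Suc p)). f (?d p y) = \<zero>\<^bsub>X\<^esub>"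
  proof
    fix y assume y: "y \<in> carrier (?P (Suc p))"
    then have "y = \<zero>\<^bsub>?P (Suc p)\<^esub>" using free_zero by (simp add: mfr_term_eq b' zero_module_def)
    then show "f (?d p y) = \<zero>\<^bsub>X\<^esub>"
      using hom_zero[OF module_mfr_term module_mfr_term mfr_diff_hom[OF X]] hom_zero[OF module_mfr_term X' f]
      by simp
  qed
  note van' = van[rule_format, OF f fd[rule_format]]
  have "?x \<in> mvec (?b 0)"
  proof (cases p)
    case 0
    then have "e ?x = \<zero>\<^bsub>X\<^esub>" using van' u fu by simp
    then show ?thesis by (rule ker[OF x])
  next
    case (Suc m)
    obtain g where g: "g \<in> module_hom R (?P m) X" "\<And>y. y \<in> carrier (?P p) \<Longrightarrow> f y = g (?d m y)"
      using van' by (auto simp: Suc)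
    \<comment> \<open>Lifting \<open>g\<close> through \<open>e\<close> moves the argument from
      \<open>\<mm> X\<close> to \<open>\<mm> P_0\<close>, where membership is tested on coordinates:
      \<open>?x\<close> differs from a vector of \<open>\<mm> P_0\<close> by an element of the
      kernel of \<open>e\<close>.\<close>
    obtain h where h: "h \<in> module_hom R (?P m) (?P 0)" "\<And>y. y \<in> carrier (?P m) \<Longrightarrow> e (h y) = g y"
      by (rule projective_lift[OF projective_mfr_term X' module_mfr_term g(1) eh])
        (simp_all add: resolution_aug_surj[OF res] hom_closed[OF g(1)])
    have du: "?d m ?u \<in> mvec (?b m)" by (rule min[OF u[unfolded Suc], folded Suc])
    have du': "?d m ?u \<in> carrier (?P m)" using mvec_closed[OF du] by (simp add: mfr_term_eq)
    let ?w = "h (?d m ?u)"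
    have w: "?w \<in> mvec (?b 0)" by (rule hom_mvec[OF h(1)[unfolded mfr_term_eq] du])
    have w': "?w \<in> carrier (?P 0)" by (rule hom_closed[OF h(1) du'])
    interpret P0: Module.module R "?P 0" by simp
    have "e ?w = e ?x" using h(2)[OF du'] g(2)[OF u] fu by simp
    then have "e (?x \<ominus>\<^bsub>?P 0\<^esub> ?w) = \<zero>\<^bsub>X\<^esub>"
      using hom_closed[OF eh x] by (simp add: hom_minus[OF module_mfr_term X' eh x w'])
    then have k: "?x \<ominus>\<^bsub>?P 0\<^esub> ?w \<in> mvec (?b 0)" using x w' by (intro ker) simp_all
    have "?x = (?x \<ominus>\<^bsub>?P 0\<^esub> ?w) \<oplus>\<^bsub>?P 0\<^esub> ?w"
      using x w' by (simp add: a_minus_def P0.a_assoc P0.l_neg)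
    then show ?thesis using mvec_add[OF k w] by (simp only: mfr_term_eq)
  qed
  then show False using unit_vec_notin_mvec b0 by simp
qed

end

section \<open>Transport along isomorphisms\<close>

lemma iso_modulesE:
  assumes "iso_modules R X M" and X: "module R X" and M: "module R M"
  obtains h g where "h \<in> module_hom R X M" "g \<in> module_hom R M X"
    "\<And>x. x \<in> carrier X \<Longrightarrow> g (h x) = x" "\<And>y. y \<in> carrier M \<Longrightarrow> h (g y) = y"
proof -
  obtain h where h: "h \<in> module_hom R X M" "bij_betw h (carrier X) (carrier M)"
    using assms(1) unfolding iso_modules_def by auto
  show thesis
    by (rule that[OF h(1) hom_inv[OF X h]])
      (use h(2) in \<open>simp_all add: bij_betw_inv_into_left bij_betw_inv_into_right\<close>)
qed

lemma resolution_iso: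
  assumes res: "resolution R X P d e" and X: "module R X" and M: "module R M"
    and h: "h \<in> module_hom R X M" and g: "g \<in> module_hom R M X"
    and gh: "\<And>x. x \<in> carrier X \<Longrightarrow> g (h x) = x" and hg: "\<And>y. y \<in> carrier M \<Longrightarrow> h (g y) = y"
  shows "resolution R M P d (\<lambda>x. h (e x))"
proof -
  note eh = resolution_aug_hom[OF res]
  have "h (e x) = \<zero>\<^bsub>M\<^esub> \<longleftrightarrow> e x = \<zero>\<^bsub>X\<^esub>" if "x \<in> carrier (P 0)" for x
    using gh[OF hom_closed[OF eh that]] hom_zero[OF X M h] hom_zero[OF M X g] by metis
  then have "a_kernel (P 0) M (\<lambda>x. h (e x)) = a_kernel (P 0) X e" by (auto simp: a_kernel_def')
  moreover have "h ` carrier X = carrier M"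
    using hom_closed[OF h] hom_closed[OF g] hg by (metis (no_types, lifting) image_iff subsetI subset_antisym image_subsetI)
  then have "h ` e ` carrier (P 0) = carrier M" by (simp only: resolution_aug_surj[OF res])
  then have "(\<lambda>x. h (e x)) ` carrier (P 0) = carrier M" by (simp only: image_image)
  ultimately show ?thesis
    using res hom_comp[OF eh h] unfolding resolution_def by simp
qed

lemma ext_vanishes_iso:
  assumes van: "ext_vanishes R P d n M" and X: "module R X" and M: "module R M"
    and h: "h \<in> module_hom R X M" and g: "g \<in> module_hom R M X"
    and gh: "\<And>x. x \<in> carrier X \<Longrightarrow> g (h x) = x"
  shows "ext_vanishes R P d n X"
  unfolding ext_vanishes_def
proof (intro ballI impI)
  fix f assume f: "f \<in> module_hom R (P n) X" and fd: "\<forall>x\<in>carrier (P (Suc n)). f (d n x) = \<zero>\<^bsub>X\<^esub>"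
  have hf: "(\<lambda>x. h (f x)) \<in> module_hom R (P n) M" by (rule hom_comp[OF f h])
  have "\<forall>x\<in>carrier (P (Suc n)). h (f (d n x)) = \<zero>\<^bsub>M\<^esub>" using fd hom_zero[OF X M h] by simp
  note van' = van[unfolded ext_vanishes_def, rule_format, OF hf this[rule_format]]
  have ghf: "g (h (f x)) = f x" if "x \<in> carrier (P n)" for x
    using gh[OF hom_closed[OF f that]] .
  show "case n of 0 \<Rightarrow> \<forall>x\<in>carrier (P 0). f x = \<zero>\<^bsub>X\<^esub>
         | Suc m \<Rightarrow> \<exists>g\<in>module_hom R (P m) X. \<forall>x\<in>carrier (P n). f x = g (d m x)"
  proof (cases n)
    case 0
    then have "f x = \<zero>\<^bsub>X\<^esub>" if "x \<in> carrier (P 0)" for x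
      using van' ghf[of x] that hom_zero[OF M X g] by simp
    then show ?thesis by (simp add: 0)
  next
    case (Suc m)
    then obtain k where k: "k \<in> module_hom R (P m) M" "\<And>x. x \<in> carrier (P n) \<Longrightarrow> h (f x) = k (d m x)"
      using van' by auto
    have "f x = g (k (d m x))" if "x \<in> carrier (P n)" for x
      using ghf[OF that] k(2)[OF that] by simp
    then show ?thesis unfolding Suc nat.case
      using hom_comp[OF k(1) g] by (intro bexI[of _ "\<lambda>y. g (k y)"]) (simp_all add: Suc)
  qed
qed

text \<open>Composing the augmentation with \<open>h\<close> turns a resolution of \<open>X\<close>
  into one of \<open>M\<close> with the same terms, so every length admissible for \<open>X\<close>
  is admissible for \<open>M\<close>.\<close>

lemma pd_iso_le:
  assumes X: "module R X" and M: "module R M" and h: "h \<in> module_hom R X M" and g: "g \<in> module_hom R M X"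
    and gh: "\<And>x. x \<in> carrier X \<Longrightarrow> g (h x) = x" and hg: "\<And>y. y \<in> carrier M \<Longrightarrow> h (g y) = y"
  shows "pd R M \<le> pd R X"
  unfolding pd_def
proof (rule Inf_superset_mono, rule subsetI)
  fix u assume "u \<in> {enat n | n. \<exists>(P :: nat \<Rightarrow> 'a fgmod) d e.
        resolution R X P d e \<and> (\<forall>i. fg_projective R (P i)) \<and> (\<forall>i>n. zero_module (P i))}"
  then obtain n P d e where u: "u = enat n" and P: "resolution R X (P :: nat \<Rightarrow> 'a fgmod) d e"
      "\<forall>i. fg_projective R (P i)" "\<forall>i>n. zero_module (P i)" by auto
  have "resolution R M P d (\<lambda>x. h (e x))" by (rule resolution_iso[OF P(1) X M h g gh hg])
  with P(2,3) u show "u \<in> {enat n | n. \<exists>(P :: nat \<Rightarrow> 'a fgmod) d e.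
        resolution R M P d e \<and> (\<forall>i. fg_projective R (P i)) \<and> (\<forall>i>n. zero_module (P i))}" by auto
qed

text \<open>Both arguments of Ext change. The minimal resolution of \<open>X\<close> also resolves
  \<open>M\<close>, and independence of the resolution moves the vanishing to it; after that the
  coefficients are transported from \<open>M\<close> to \<open>X\<close>.\<close>

lemma (in local_noetherian) zero_Ext_iso:
  assumes M: "fg_module R M" and X: "fg_module R X" and iso: "iso_modules R X M"
    and zero: "zero_module (Ext R n M M)"
  shows "zero_module (Ext R n X X)"
proof -
  have X': "module R X" and M': "module R M" using X M by (simp_all add: fg_module_def)
  obtain h g where h: "h \<in> module_hom R X M" and g: "g \<in> module_hom R M X"
    and gh: "\<And>x. x \<in> carrier X \<Longrightarrow> g (h x) = x" and hg: "\<And>y. y \<in> carrier M \<Longrightarrow> h (g y) = y"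
    by (rule iso_modulesE[OF iso X' M']) (rule that)
  obtain eM where resM: "resolution R M (mfr_term R M) (mfr_diff R M) eM"
    by (rule mfr_resolution[OF M]) (rule that)
  obtain eX where resX: "resolution R X (mfr_term R X) (mfr_diff R X) eX"
    by (rule mfr_resolution[OF X]) (rule that)
  have "resolution R M (mfr_term R X) (mfr_diff R X) (\<lambda>x. h (eX x))"
    by (rule resolution_iso[OF resX X' M' h g gh hg])
  from ext_vanishes_independent[OF M' M' this projective_mfr_term resM projective_mfr_term]
  have "ext_vanishes R (mfr_term R X) (mfr_diff R X) n M"
    using zero zero_Ext_iff[OF M M'] by simp
  then show ?thesis
    unfolding zero_Ext_iff[OF X X'] by (rule ext_vanishes_iso[OF _ X' M' h g gh])
qed

section \<open>Degrees of nonvanishing self-extensions against degrees of nonzero rank\<close>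

theorem corollary3p2:
  fixes A :: "('a, 'r) ring_scheme" and M :: "('a, 'm) module"
  assumes "local_ring A" and "noetherian_ring A"
    and "fg_module A M" and "\<not> zero_module M"
    and "reducible_complexity A M"
  shows "Sup {enat n | n. \<not> zero_module (Ext A n M M)} = pd A M"
proof -
  interpret local_noetherian A
    using assms(1,2) by (simp add: local_noetherian_def local_noetherian_axioms_def local_ring_def)
  note M = \<open>fg_module A M\<close>
  have M': "module A M" using M by (simp add: fg_module_def)
  obtain X where red: "reducible_cx_fgmod A X" and iso: "iso_modules A X M"
    using assms(5) unfolding reducible_complexity_def by auto
  from red have X: "fg_module A X" by (cases rule: reducible_cx_fgmod.cases)
  have X': "module A X" using X by (simp add: fg_module_def)
  let ?S = "{n. \<not> zero_module (Ext A n M M)}" and ?B = "{n. fst (mfr A M) n \<noteq> 0}"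
  have pd: "pd A M = Sup (enat ` ?B)"
    unfolding pd_eq_Sup_ranks[OF M] by (rule arg_cong[of _ _ Sup]) auto
  have SB: "?S \<subseteq> ?B" using Ext_zero_if_rank_zero[OF M M'] by auto
  have "Sup (enat ` ?S) = Sup (enat ` ?B)"
  proof (cases "finite ?B")
    case True
    show ?thesis
    proof (rule antisym)
      show "Sup (enat ` ?S) \<le> Sup (enat ` ?B)" by (rule Sup_subset_mono[OF image_mono[OF SB]])
      show "Sup (enat ` ?B) \<le> Sup (enat ` ?S)"
      proof (rule Sup_least)
        fix u assume "u \<in> enat ` ?B"
        then obtain n where n: "u = enat n" "n \<in> ?B" by (rule imageE)
        let ?p = "Max ?B"
        have p: "?p \<in> ?B" using Max_in[OF True] n(2) by auto
        \<comment> \<open>The rank after the largest nonzero one is zero, so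
          \<open>Ext_top_nonzero\<close> applies at \<open>?p\<close>.\<close>
        have "Suc ?p \<notin> ?B" using Max_ge[OF True, of "Suc ?p"] by auto
        then have "?p \<in> ?S" using Ext_top_nonzero[OF M assms(4), of ?p] p by simp
        then have "enat ?p \<le> Sup (enat ` ?S)" by (intro Sup_upper imageI)
        moreover have "n \<le> ?p" using Max_ge[OF True n(2)] .
        ultimately show "u \<le> Sup (enat ` ?S)" by (simp add: n(1) order_trans[of _ "enat ?p"])
      qed
    qed
  next
    case False
    \<comment> \<open>With infinitely many nonzero ranks the right-hand supremum is
      \<open>\<infinity>\<close>, so it remains to see that \<open>?S\<close> is infinite.\<close>
    have "infinite ?S"
    proof
      assume "finite ?S"
      then obtain N where N: "\<And>n. n \<in> ?S \<Longrightarrow> n \<le> N" using finite_nat_set_iff_bounded_le by auto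
      \<comment> \<open>The reductions are given for the copy \<open>X\<close> in the universe, so
        the vanishing is carried over from \<open>M\<close>.\<close>
      have zero: "zero_module (Ext A n X X)" if "n > N" for n
        using zero_Ext_iso[OF M X iso, of n] N[of n] that by auto
      from red show False
      proof (cases rule: reducible_cx_fgmod.cases)
        case finite_pd
        \<comment> \<open>Finite projective dimension of \<open>X\<close> passes to
          \<open>M\<close>, whereas infinitely many nonzero ranks force \<open>pd A M\<close> to be
          \<open>\<infinity>\<close>.\<close>
        obtain h g where "h \<in> module_hom A X M" "g \<in> module_hom A M X"
            "\<And>x. x \<in> carrier X \<Longrightarrow> g (h x) = x" "\<And>y. y \<in> carrier M \<Longrightarrow> h (g y) = y"
          by (rule iso_modulesE[OF iso X' M']) (rule that)
        then have "pd A M \<le> pd A X" by (intro pd_iso_le[OF X' M'])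
        then have "Sup (enat ` ?B) < \<infinity>" using finite_pd(2) unfolding pd by (rule le_less_trans)
        then show False using Sup_enat_infinite[OF False] by simp
      next
        case (reduce n \<eta> Z)
        \<comment> \<open>The exponent \<open>t = Suc N\<close> suffices: \<open>t * n\<close>
          exceeds \<open>N\<close> because \<open>n > 0\<close>, so \<open>Ext\<close> of
          \<open>X\<close> with itself vanishes in that degree. The resulting inequality contradicts
          the strict drop of complexity in the reduction.\<close>
        have "N < Suc N * n" using reduce(4) by (cases n) auto
        then have "cx A X \<le> cx A (K_module A n X X \<eta>)"
          using cx_le_cx_K_module[OF X reduce(4,5) zero_less_Suc zero] by simp
        with reduce(6) show False by simp
      qed
    qed
    from Sup_enat_infinite[OF this] Sup_enat_infinite[OF False] show ?thesis by (rule trans[OF _ sym])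
  qed
  moreover have "{enat n | n. \<not> zero_module (Ext A n M M)} = enat ` ?S" by auto
  ultimately show ?thesis using pd by simp
qed

end
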